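(* Let $p$ be an odd prime and let $D_p=\langle\tau,\sigma\mid\tau^2=\sigma^p=1,\ \tau\sigma\tau=\sigma^{-1}\rangle$ be the dihedral group of order $2p$. Let $\chi_1$ be the two-dimensional complex representation of $D_p$ given by $$\chi_1(\sigma^j)=\begin{pmatrix}e^{2\pi i j/p}&0\\0&e^{-2\pi i j/p}\end{pmatrix},\qquad \chi_1(\tau)=\begin{pmatrix}0&1\\1&0\end{pmatrix},$$ and let $x=c_1(\chi_1)$, $y=c_2(\chi_1)$. Then $$R^*_{\mathbb C}(D_p)=\frac{\mathbb Z[x,y]}{(2x,\ py,\ xy)},$$ i.e. the homomorphism from the polynomial ring $\mathbb Z[x,y]$ to $R^*_{\mathbb C}(D_p)$ sending the variables to the classes of the same name is surjective with kernel $(2x,py,xy)$.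
   Context: Let $G$ be a finite group. $R_{\mathbb C}(G)$ is the ring of virtual complex characters of $G$ (the free abelian group on the irreducible complex characters, with product induced by tensor product), with augmentation $\epsilon:R_{\mathbb C}(G)\to\mathbb Z$ the degree map and $I=\ker\epsilon$. Exterior powers of representations give maps $\lambda^n$ on characters, extended to $R_{\mathbb C}(G)$ by requiring $\lambda^0=1$ and $\lambda^n(x+y)=\sum_{i+j=n}\lambda^i(x)\lambda^j(y)$. Put $\gamma^n(x)=\lambda^n(x+n-1)$. Let $\Gamma^n\subseteq R_{\mathbb C}(G)$ be the additive subgroup generated by all products $\gamma^{i_1}(x_1)\cdots\gamma^{i_r}(x_r)$ with $x_j\in I$ and $\sum_j i_j\ge n$; then $\Gamma^0=R_{\mathbb C}(G)$, $\Gamma^1=I$, $\Gamma^m\Gamma^n\subseteq\Gamma^{m+n}$. The graded character ring is $R^*_{\mathbb C}(G)=\bigoplus_{n\ge0}\Gamma^n/\Gamma^{n+1}$. The $n$-th Chern class of $\rho\in R_{\mathbb C}(G)$ is the class $c_n(\rho)\in\Gamma^n/\Gamma^{n+1}$ of $\gamma^n(\rho-\epsilon(\rho))$. Representations are identified with their characters. *)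

theory Defs
  imports
    "HOL-Algebra.Product_Groups"
    "HOL-Algebra.QuotRing"
    "HOL-Algebra.Generated_Groups"
    "HOL-Computational_Algebra.Polynomial"
    "Jordan_Normal_Form.VS_Connect"
    "Jordan_Normal_Form.DL_Submatrix"
begin

section \<open>Complex representations and characters\<close>

definition complex_representation :: "('a, 'b) monoid_scheme \<Rightarrow> nat \<Rightarrow> ('a \<Rightarrow> complex mat) \<Rightarrow> bool" where
  "complex_representation G d \<rho> \<longleftrightarrow> \<rho> \<in> hom G (units_of (ring_mat TYPE(complex) d ()))"

definition irreducible_complex_representation ::
  "('a, 'b) monoid_scheme \<Rightarrow> nat \<Rightarrow> ('a \<Rightarrow> complex mat) \<Rightarrow> bool" where
  "irreducible_complex_representation G d \<rho> \<longleftrightarrow> complex_representation G d \<rho> \<and> d > 0 \<and>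
     (\<forall>W. VectorSpace.subspace class_ring W (module_vec TYPE(complex) d) \<longrightarrow>
          (\<forall>g\<in>carrier G. \<forall>w\<in>W. \<rho> g *\<^sub>v w \<in> W) \<longrightarrow>
          W = {0\<^sub>v d} \<or> W = carrier_vec d)"

definition mat_trace :: "complex mat \<Rightarrow> complex" where
  "mat_trace A = (\<Sum>i<dim_row A. A $$ (i, i))"

text \<open>Functions on \<open>G\<close> are represented by functions on the ambient type that vanish outside
  the carrier.\<close>

definition character :: "('a, 'b) monoid_scheme \<Rightarrow> ('a \<Rightarrow> complex mat) \<Rightarrow> 'a \<Rightarrow> complex" where
  "character G \<rho> = (\<lambda>g. if g \<in> carrier G then mat_trace (\<rho> g) else 0)"

definition function_ring :: "('a, 'b) monoid_scheme \<Rightarrow> ('a \<Rightarrow> complex) ring" where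
  "function_ring G = \<lparr>
     carrier = {f. \<forall>g. g \<notin> carrier G \<longrightarrow> f g = 0},
     monoid.mult = (\<lambda>f h g. f g * h g),
     one = (\<lambda>g. if g \<in> carrier G then 1 else 0),
     zero = (\<lambda>g. 0),
     add = (\<lambda>f h g. f g + h g)\<rparr>"

text \<open>Distinct irreducible characters are linearly independent, so their integral span inside the
  ring of functions is the free abelian group on them; the tensor product of representations
  corresponds to the pointwise product of characters.\<close>

definition virtual_character_ring :: "('a, 'b) monoid_scheme \<Rightarrow> ('a \<Rightarrow> complex) ring" where
  "virtual_character_ring G = (function_ring G)\<lparr>carrier :=
     generate (add_monoid (function_ring G))
       {character G \<rho> | d \<rho>. irreducible_complex_representation G d \<rho>}\<rparr>"

text \<open>The degree of a representation is the value of its character at the identity.\<close>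

definition augmentation :: "('a, 'b) monoid_scheme \<Rightarrow> ('a \<Rightarrow> complex) \<Rightarrow> int" where
  "augmentation G f = (THE k. f \<one>\<^bsub>G\<^esub> = of_int k)"

definition augmentation_ideal :: "('a, 'b) monoid_scheme \<Rightarrow> ('a \<Rightarrow> complex) set" where
  "augmentation_ideal G = {f \<in> carrier (virtual_character_ring G). augmentation G f = 0}"

section \<open>The lambda operations and the gamma filtration\<close>

text \<open>The \<open>n\<close>-th exterior power of a square matrix, with respect to the basis of wedge products
  \<open>e\<^sub>S\<close> for \<open>n\<close>-element sets \<open>S\<close> of indices: the entries are the \<open>n \<times> n\<close> minors.\<close>

definition exterior_power_mat :: "nat \<Rightarrow> complex mat \<Rightarrow> complex mat" where
  "exterior_power_mat n A =
     (let L = map set (filter (\<lambda>xs. length xs = n) (subseqs [0..<dim_row A]))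
      in mat (length L) (length L) (\<lambda>(i, j). det (submatrix A (L ! i) (L ! j))))"

definition is_lambda_family ::
  "('a, 'b) monoid_scheme \<Rightarrow> (nat \<Rightarrow> ('a \<Rightarrow> complex) \<Rightarrow> ('a \<Rightarrow> complex)) \<Rightarrow> bool" where
  "is_lambda_family G l \<longleftrightarrow> (let R = virtual_character_ring G in
     (\<forall>n. l n \<in> carrier R \<rightarrow> carrier R) \<and>
     (\<forall>d \<rho> n. complex_representation G d \<rho> \<longrightarrow>
        l n (character G \<rho>) = character G (\<lambda>g. exterior_power_mat n (\<rho> g))) \<and>
     (\<forall>x\<in>carrier R. l 0 x = \<one>\<^bsub>R\<^esub>) \<and>
     (\<forall>n. \<forall>x\<in>carrier R. \<forall>y\<in>carrier R.
        l n (x \<oplus>\<^bsub>R\<^esub> y) = (\<Oplus>\<^bsub>R\<^esub>i\<in>{..n}. l i x \<otimes>\<^bsub>R\<^esub> l (n - i) y)))"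

text \<open>For a finite group \<open>G\<close> such a family exists, and its values on virtual characters are
  determined by its values on characters; the values elsewhere are irrelevant.\<close>

definition lambda_op ::
  "('a, 'b) monoid_scheme \<Rightarrow> nat \<Rightarrow> ('a \<Rightarrow> complex) \<Rightarrow> ('a \<Rightarrow> complex)" where
  "lambda_op G = (SOME l. is_lambda_family G l)"

definition gamma_op ::
  "('a, 'b) monoid_scheme \<Rightarrow> nat \<Rightarrow> ('a \<Rightarrow> complex) \<Rightarrow> ('a \<Rightarrow> complex)" where
  "gamma_op G n x = (let R = virtual_character_ring G in
     lambda_op G n (x \<oplus>\<^bsub>R\<^esub> add_pow R (int n - 1) \<one>\<^bsub>R\<^esub>))"

definition gamma_product ::
  "('a, 'b) monoid_scheme \<Rightarrow> (nat \<times> ('a \<Rightarrow> complex)) list \<Rightarrow> ('a \<Rightarrow> complex)" where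
  "gamma_product G ps = (let R = virtual_character_ring G in
     foldr (\<lambda>(i, x) z. gamma_op G i x \<otimes>\<^bsub>R\<^esub> z) ps \<one>\<^bsub>R\<^esub>)"

definition gamma_filtration :: "('a, 'b) monoid_scheme \<Rightarrow> nat \<Rightarrow> ('a \<Rightarrow> complex) set" where
  "gamma_filtration G n = generate (add_monoid (virtual_character_ring G))
     {gamma_product G ps | ps.
        (\<forall>(i, x)\<in>set ps. x \<in> augmentation_ideal G) \<and> sum_list (map fst ps) \<ge> n}"

section \<open>The graded character ring and Chern classes\<close>

definition graded_piece :: "('a, 'b) monoid_scheme \<Rightarrow> nat \<Rightarrow> ('a \<Rightarrow> complex) set monoid" where
  "graded_piece G n =
     (add_monoid (virtual_character_ring G))\<lparr>carrier := gamma_filtration G n\<rparr>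
       Mod gamma_filtration G (Suc n)"

text \<open>The direct sum is \<^const>\<open>sum_group\<close>, whose elements are the finitely supported
  sequences of cosets.  The product of cosets \<open>a + \<Gamma>\<^sup>i\<^sup>+\<^sup>1\<close> and \<open>b + \<Gamma>\<^sup>j\<^sup>+\<^sup>1\<close> is
  \<open>a b + \<Gamma>\<^sup>i\<^sup>+\<^sup>j\<^sup>+\<^sup>1\<close>, and the group operation of \<^const>\<open>graded_piece\<close> (written
  multiplicatively by the library) is addition of cosets.\<close>

definition graded_character_ring ::
  "('a, 'b) monoid_scheme \<Rightarrow> (nat \<Rightarrow> ('a \<Rightarrow> complex) set) ring" where
  "graded_character_ring G =
     (let R = virtual_character_ring G; S = sum_group UNIV (graded_piece G) in \<lparr>
     carrier = carrier S,
     monoid.mult = (\<lambda>u v n. \<Otimes>\<^bsub>graded_piece G n\<^esub>i\<in>{..n}.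
               rcoset_mult R (gamma_filtration G (Suc n)) (u i) (v (n - i))),
     one = \<one>\<^bsub>S\<^esub>(0 := gamma_filtration G 1 +>\<^bsub>R\<^esub> \<one>\<^bsub>R\<^esub>),
     zero = \<one>\<^bsub>S\<^esub>,
     add = monoid.mult S\<rparr>)"

definition chern_class ::
  "('a, 'b) monoid_scheme \<Rightarrow> nat \<Rightarrow> ('a \<Rightarrow> complex) \<Rightarrow> (nat \<Rightarrow> ('a \<Rightarrow> complex) set)" where
  "chern_class G n \<rho> = (let R = virtual_character_ring G in
     \<zero>\<^bsub>graded_character_ring G\<^esub>
       (n := gamma_filtration G (Suc n) +>\<^bsub>R\<^esub>
               gamma_op G n (\<rho> \<ominus>\<^bsub>R\<^esub> add_pow R (augmentation G \<rho>) \<one>\<^bsub>R\<^esub>)))"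

section \<open>Dihedral groups and the polynomial ring in two variables\<close>

text \<open>A group generated by \<open>\<tau>\<close> and \<open>\<sigma>\<close> satisfying the dihedral relations is a quotient of the
  group presented by them, which has order \<open>2 p\<close>; having that order makes it the dihedral group
  itself.\<close>

definition is_dihedral_group :: "('a, 'b) monoid_scheme \<Rightarrow> nat \<Rightarrow> 'a \<Rightarrow> 'a \<Rightarrow> bool" where
  "is_dihedral_group D p \<tau> \<sigma> \<longleftrightarrow> group D \<and> \<tau> \<in> carrier D \<and> \<sigma> \<in> carrier D \<and>
     generate D {\<tau>, \<sigma>} = carrier D \<and>
     \<tau> [^]\<^bsub>D\<^esub> (2::nat) = \<one>\<^bsub>D\<^esub> \<and> \<sigma> [^]\<^bsub>D\<^esub> p = \<one>\<^bsub>D\<^esub> \<and>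
     \<tau> \<otimes>\<^bsub>D\<^esub> \<sigma> \<otimes>\<^bsub>D\<^esub> \<tau> = inv\<^bsub>D\<^esub> \<sigma> \<and> Coset.order D = 2 * p"

text \<open>\<open>\<int>[x, y]\<close> is the iterated polynomial ring \<open>\<int>[x][y]\<close>.\<close>

abbreviation ZXY :: "int poly poly ring" where "ZXY \<equiv> class_ring"

definition var_X :: "int poly poly" where "var_X = [:[:0, 1:]:]"

definition var_Y :: "int poly poly" where "var_Y = [:0, 1:]"

end

theory Submission
  imports Defs "HOL-Library.Function_Algebras" "HOL-Computational_Algebra.Formal_Power_Series"
    "HOL-Computational_Algebra.Polynomial_FPS" "Jordan_Normal_Form.Schur_Decomposition"
    "Jordan_Normal_Form.Spectral_Radius"
begin

text \<open>
  Put \<open>\<epsilon> = det \<chi>\<^sub>1\<close>, \<open>X = \<epsilon> - 1\<close> and \<open>Y = 1 + \<epsilon> - \<chi>\<^sub>1\<close>, the values of \<open>\<gamma>\<^sup>1(\<epsilon> - 1)\<close> and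
  \<open>\<gamma>\<^sup>2(\<chi>\<^sub>1 - 2)\<close>.  They satisfy \<open>X\<^sup>2 = -2X\<close> and \<open>X Y = 0\<close>, and a Chebyshev recursion writes every
  \<open>1 + \<epsilon> - \<chi>\<^sub>k\<close> as \<open>k\<^sup>2 Y\<close> plus higher powers of \<open>Y\<close>; comparing \<open>k = (p - 1)/2\<close> with \<open>k = (p + 1)/2\<close>
  shows that \<open>p Y\<close> is a combination of higher powers of \<open>Y\<close>.  Hence \<open>\<Gamma>\<^sup>n\<close> is spanned by the monomials
  \<open>X\<^sup>i Y\<^sup>j\<close> with \<open>i + 2j \<ge> n\<close>, and the graded ring is a quotient of \<open>\<int>[x, y]/(2x, py, xy)\<close>.  There are
  no further relations: \<open>a X\<^sup>n + b Y\<^sup>r \<in> \<Gamma>\<^sup>n\<^sup>+\<^sup>1\<close> with \<open>n = 2r\<close> forces \<open>2 | a\<close> by evaluation at \<open>\<tau>\<close>; on rotations it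
  gives \<open>b = h\<close> away from the identity for some \<open>h\<close> in the span of positive powers of \<open>Y\<close>, and as the sum of
  a virtual character over the rotations is divisible by \<open>p\<close>, so is \<open>(p - 1) b\<close>.

  The operations \<open>\<lambda>\<^sup>n\<close> exist because \<open>\<lambda>\<^sub>t(f)(g) = exp (\<Sum>k\<ge>1. (-1)\<^sup>k\<^sup>-\<^sup>1 f(g\<^sup>k) t\<^sup>k / k)\<close> is additive-to-multiplicative
  in \<open>f\<close> and equals \<open>det (1 + t \<rho>(g))\<close> on characters.
\<close>

section \<open>The generating polynomial of the exterior powers\<close>

text \<open>Three obstacles shape the argument. \<open>lambda_op\<close> is a Hilbert choice, so
  nothing is known about it until some lambda family exists; the exponential formula supplies one,
  but its values must be shown to be virtual characters, which is done by knowing every irreducible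
  character of the group, whatever its dimension. Next, the generators of \<Gamma>^n involve
  \<open>gamma_op\<close> at all elements of the augmentation ideal, while it is computed by hand
  only on additive generators; differences are reached by dividing power series in t / (1 + t) whose
  n-th coefficient has weight n, a property that division preserves. Finally, in an even degree a
  power of x and a power of y meet; they can be tested separately because X vanishes on rotations
  and Y on reflections, which is also why X Y = 0. The relation 2 x = 0 is the identity 2 X = - X^2
  read one degree higher, and x is the class of X only modulo weight 2, since \<chi>_1 - 2 = X -
  Y.\<close>

lemma bij_betw_pick:
  assumes "finite S"
  shows "bij_betw (pick S) {0..<card S} S"
proof (rule bij_betwI')
  fix x y assume "x \<in> {0..<card S}" "y \<in> {0..<card S}"
  then show "(pick S x = pick S y) = (x = y)"
    by (metis card_pick_le atLeastLessThan_iff)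
next
  fix x assume "x \<in> {0..<card S}"
  then show "pick S x \<in> S" by (intro pick_in_set_le) simp
next
  fix y assume y: "y \<in> S"
  have "{a \<in> S. a < y} \<subset> S" using y by auto
  then have "card {a \<in> S. a < y} < card S" using assms by (simp add: psubset_card_mono)
  then show "\<exists>x\<in>{0..<card S}. y = pick S x"
    by (intro bexI[of _ "card {a \<in> S. a < y}"]) (simp_all only: pick_card_in_set[OF y] atLeastLessThan_iff le0 simp_thms)
qed

text \<open>Reindexing the Leibniz formula along the increasing enumeration \<open>pick S\<close>
  conjugates permutations and so preserves signs. In terms of the original indices, minors of
  different sizes can be summed together.\<close>

lemma det_principal_submatrix:
  fixes A :: "'b::comm_ring_1 mat"
  assumes A: "A \<in> carrier_mat n n" and S: "S \<subseteq> {0..<n}"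
  shows "det (submatrix A S S) = (\<Sum>q | q permutes S. signof q * (\<Prod>i\<in>S. A $$ (i, q i)))"
proof -
  define c where "c = card S"
  have fin: "finite S" using S finite_subset by blast
  have dims: "{i. i < n \<and> i \<in> S} = S" using S by auto
  have sub: "submatrix A S S \<in> carrier_mat c c"
    using A by (simp add: submatrix_def dims c_def)
  have ent: "submatrix A S S $$ (i, j) = A $$ (pick S i, pick S j)" if "i < c" "j < c" for i j
    using that A dims by (simp add: submatrix_def c_def)
  have bij: "bij_betw (pick S) {0..<c} S" unfolding c_def by (rule bij_betw_pick[OF fin])
  define \<Phi> where "\<Phi> = (\<lambda>q. map_permutation {0..<c} (pick S) q)"
  have \<Phi>bij: "bij_betw \<Phi> {q. q permutes {0..<c}} {q. q permutes S}"
  proof -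
    have "\<Phi> = (\<lambda>q x. if x \<in> S then pick S (q (inv_into {0..<c} (pick S) x)) else x)"
      using bij by (auto simp: \<Phi>_def map_permutation_def restrict_id_def fun_eq_iff bij_betw_def)
    then show ?thesis using bij_betw_permutations[OF bij] by simp
  qed
  have inj: "inj_on (pick S) {0..<c}" using bij by (simp add: bij_betw_def)
  have "det (submatrix A S S) = (\<Sum>q | q permutes {0..<c}. signof q * (\<Prod>i=0..<c. submatrix A S S $$ (i, q i)))"
    by (rule det_def'[OF sub])
  also have "\<dots> = (\<Sum>q | q permutes {0..<c}. signof (\<Phi> q) * (\<Prod>i\<in>S. A $$ (i, \<Phi> q i)))"
  proof (rule sum.cong[OF refl])
    fix q assume "q \<in> {q. q permutes {0..<c}}"
    then have q: "q permutes {0..<c}" by simp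
    have "(\<Prod>i\<in>S. A $$ (i, \<Phi> q i)) = (\<Prod>i=0..<c. A $$ (pick S i, \<Phi> q (pick S i)))"
      by (rule prod.reindex_bij_betw[OF bij, symmetric])
    also have "\<dots> = (\<Prod>i=0..<c. submatrix A S S $$ (i, q i))"
    proof (rule prod.cong[OF refl])
      fix i assume i: "i \<in> {0..<c}"
      then have "q i \<in> {0..<c}" using q by (simp add: permutes_in_image)
      then show "A $$ (pick S i, \<Phi> q (pick S i)) = submatrix A S S $$ (i, q i)"
        using i ent unfolding \<Phi>_def by (subst map_permutation_apply[OF inj]) auto
    qed
    finally show "signof q * (\<Prod>i=0..<c. submatrix A S S $$ (i, q i)) =
        signof (\<Phi> q) * (\<Prod>i\<in>S. A $$ (i, \<Phi> q i))"
      using sign_map_permutation[OF inj q] by (simp add: \<Phi>_def)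
  qed
  also have "\<dots> = (\<Sum>q | q permutes S. signof q * (\<Prod>i\<in>S. A $$ (i, q i)))"
    by (rule sum.reindex_bij_betw[OF \<Phi>bij])
  finally show ?thesis .
qed

text \<open>In the Leibniz expansion each factor offers either s A or a Kronecker delta. Choosing
  the delta outside \<open>S\<close> forces the permutation to fix every index there, and what is
  left is the Leibniz formula of a principal minor.\<close>

lemma det_one_plus_smult:
  fixes A :: "'b::comm_ring_1 mat"
  assumes A: "A \<in> carrier_mat n n"
  shows "det (1\<^sub>m n + s \<cdot>\<^sub>m A) = (\<Sum>S\<in>Pow {0..<n}. s ^ card S * det (submatrix A S S))"
proof -
  let ?N = "{0..<n}"
  have "1\<^sub>m n + s \<cdot>\<^sub>m A \<in> carrier_mat n n" using A by simp
  then have "det (1\<^sub>m n + s \<cdot>\<^sub>m A) =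
      (\<Sum>q | q permutes ?N. signof q * (\<Prod>i=0..<n. (1\<^sub>m n + s \<cdot>\<^sub>m A) $$ (i, q i)))"
    by (rule det_def')
  also have "\<dots> = (\<Sum>q | q permutes ?N. signof q *
      (\<Prod>i=0..<n. s * A $$ (i, q i) + (if q i = i then 1 else 0)))"
  proof (intro sum.cong refl arg_cong2[where f="(*)"] prod.cong)
    fix q i assume "q \<in> {q. q permutes ?N}" "i \<in> ?N"
    then have "i < n" "q i < n" using permutes_in_image[of q ?N i] by auto
    then show "(1\<^sub>m n + s \<cdot>\<^sub>m A) $$ (i, q i) = s * A $$ (i, q i) + (if q i = i then 1 else 0)"
      using A by (auto simp: add.commute)
  qed
  also have "\<dots> = (\<Sum>q | q permutes ?N. \<Sum>S\<in>Pow ?N. signof q *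
      ((\<Prod>i\<in>S. s * A $$ (i, q i)) * (\<Prod>i\<in>?N - S. if q i = i then 1 else 0)))"
    by (subst prod_add) (simp_all add: sum_distrib_left)
  also have "\<dots> = (\<Sum>S\<in>Pow ?N. \<Sum>q | q permutes ?N. signof q *
      ((\<Prod>i\<in>S. s * A $$ (i, q i)) * (\<Prod>i\<in>?N - S. if q i = i then 1 else 0)))"
    by (rule sum.swap)
  also have "\<dots> = (\<Sum>S\<in>Pow ?N. s ^ card S * det (submatrix A S S))"
  proof (rule sum.cong[OF refl])
    fix S assume "S \<in> Pow ?N"
    then have S: "S \<subseteq> ?N" by simp
    have fin: "finite S" using S finite_subset by blast
    have "(\<Sum>q | q permutes ?N. signof q *
      ((\<Prod>i\<in>S. s * A $$ (i, q i)) * (\<Prod>i\<in>?N - S. if q i = i then 1 else 0))) =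
      (\<Sum>q | q permutes S. signof q *
      ((\<Prod>i\<in>S. s * A $$ (i, q i)) * (\<Prod>i\<in>?N - S. if q i = i then 1 else 0)))"
    proof (rule sum.mono_neutral_right)
      show "finite {q. q permutes ?N}" by (rule finite_permutations) simp
      show "{q. q permutes S} \<subseteq> {q. q permutes ?N}" using S permutes_subset by blast
      show "\<forall>q\<in>{q. q permutes ?N} - {q. q permutes S}. signof q *
        ((\<Prod>i\<in>S. s * A $$ (i, q i)) * (\<Prod>i\<in>?N - S. if q i = i then 1 else 0)) = 0"
      proof
        fix q assume q: "q \<in> {q. q permutes ?N} - {q. q permutes S}"
        then have "\<exists>i\<in>?N - S. q i \<noteq> i"
          using permutes_superset[of q ?N S] by blast
        then have "(\<Prod>i\<in>?N - S. if q i = i then 1 else 0 :: 'b) = 0"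
          by (intro prod_zero) auto
        then show "signof q *
        ((\<Prod>i\<in>S. s * A $$ (i, q i)) * (\<Prod>i\<in>?N - S. if q i = i then 1 else 0)) = 0" by simp
      qed
    qed
    also have "\<dots> = (\<Sum>q | q permutes S. s ^ card S * (signof q * (\<Prod>i\<in>S. A $$ (i, q i))))"
    proof (rule sum.cong[OF refl])
      fix q assume "q \<in> {q. q permutes S}"
      then have "(\<Prod>i\<in>?N - S. if q i = i then 1 else 0 :: 'b) = 1"
        by (intro prod.neutral) (auto simp: permutes_not_in)
      then show "signof q * ((\<Prod>i\<in>S. s * A $$ (i, q i)) * (\<Prod>i\<in>?N - S. if q i = i then 1 else 0)) =
          s ^ card S * (signof q * (\<Prod>i\<in>S. A $$ (i, q i)))"
        by (simp add: prod.distrib algebra_simps)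
    qed
    also have "\<dots> = s ^ card S * det (submatrix A S S)"
      by (simp add: det_principal_submatrix[OF A S] sum_distrib_left)
    finally show "(\<Sum>q | q permutes ?N. signof q *
      ((\<Prod>i\<in>S. s * A $$ (i, q i)) * (\<Prod>i\<in>?N - S. if q i = i then 1 else 0))) =
      s ^ card S * det (submatrix A S S)" .
  qed
  finally show ?thesis .
qed

lemma mat_trace_exterior_power:
  assumes A: "A \<in> carrier_mat n n"
  shows "mat_trace (exterior_power_mat k A) = (\<Sum>S | S \<subseteq> {0..<n} \<and> card S = k. det (submatrix A S S))"
proof -
  define L where "L = map set (filter (\<lambda>xs. length xs = k) (subseqs [0..<n]))"
  have dL: "distinct L"
    unfolding L_def using distinct_set_subseqs[of "[0..<n]"]
    by (simp add: distinct_map distinct_filter inj_on_def)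
  have sL: "set L = {S. S \<subseteq> {0..<n} \<and> card S = k}"
  proof -
    have len: "length xs = card (set xs)" if "xs \<in> set (subseqs [0..<n])" for xs
      using subseqs_distinctD[OF that] by (simp add: distinct_card)
    have "set L = {S \<in> set ` set (subseqs [0..<n]). card S = k}"
      unfolding L_def using len by auto
    then show ?thesis by (auto simp: subseqs_powset)
  qed
  have "mat_trace (exterior_power_mat k A) = (\<Sum>i<length L. det (submatrix A (L ! i) (L ! i)))"
    using A by (simp add: mat_trace_def exterior_power_mat_def L_def Let_def)
  also have "\<dots> = (\<Sum>S\<leftarrow>L. det (submatrix A S S))"
    by (simp add: sum_list_sum_nth atLeast0LessThan)
  also have "\<dots> = (\<Sum>S\<in>set L. det (submatrix A S S))"
    by (simp add: dL sum_list_distinct_conv_sum_set)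
  finally show ?thesis by (simp add: sL)
qed

lemma det_one_plus_smult_exterior:
  assumes A: "A \<in> carrier_mat n n"
  shows "det (1\<^sub>m n + s \<cdot>\<^sub>m A) = (\<Sum>k\<le>n. s ^ k * mat_trace (exterior_power_mat k A))"
proof -
  have "det (1\<^sub>m n + s \<cdot>\<^sub>m A) = (\<Sum>S\<in>Pow {0..<n}. s ^ card S * det (submatrix A S S))"
    by (rule det_one_plus_smult[OF A])
  also have "\<dots> = (\<Sum>k\<le>n. \<Sum>S | S \<in> Pow {0..<n} \<and> card S = k. s ^ card S * det (submatrix A S S))"
    by (rule sum.group[symmetric]) (auto dest: subset_eq_atLeast0_lessThan_card)
  also have "\<dots> = (\<Sum>k\<le>n. s ^ k * mat_trace (exterior_power_mat k A))"
    by (simp add: mat_trace_exterior_power[OF A] sum_distrib_left)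
  finally show ?thesis .
qed

lemma mat_trace_exterior_power_eq_0:
  assumes A: "A \<in> carrier_mat n n" and k: "k > n"
  shows "mat_trace (exterior_power_mat k A) = 0"
proof -
  have "{S. S \<subseteq> {0..<n} \<and> card S = k} = {}"
    using k by (auto dest: subset_eq_atLeast0_lessThan_card)
  then show ?thesis by (simp only: mat_trace_exterior_power[OF A] sum.empty)
qed

section \<open>The lambda series of a sequence of power sums\<close>

unbundle fps_syntax
no_notation vec_index (infixl \<open>$\<close> 100)

text \<open>If \<open>a\<close> lists the power sums of numbers e_i, this is the logarithmic
  derivative of the product of the 1 + e_i t.\<close>

definition signed_power_sums :: "(nat \<Rightarrow> 'b::field_char_0) \<Rightarrow> 'b fps" where
  "signed_power_sums a = Abs_fps (\<lambda>k. (-1) ^ k * a (Suc k))"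

definition lambda_series :: "(nat \<Rightarrow> 'b::field_char_0) \<Rightarrow> 'b fps" where
  "lambda_series a = fps_exp 1 oo fps_integral0 (signed_power_sums a)"

lemma fps_integral0_nth_0 [simp]: "fps_integral0 a $ 0 = 0"
  by (simp add: fps_integral_def)

lemma lambda_series_0 [simp]: "lambda_series a $ 0 = 1"
  by (simp add: lambda_series_def)

lemma fps_deriv_lambda_series:
  "fps_deriv (lambda_series a) = lambda_series a * signed_power_sums a"
  by (simp add: lambda_series_def fps_compose_deriv fps_deriv_fps_integral)

text \<open>The equation determines (m + 1) f_(m+1) from f_0, ..., f_m, and characteristic zero
  allows the division. A lambda series is thereby recognised from its logarithmic
  derivative.\<close>

lemma fps_linear_ode_unique:
  fixes f g :: "'b::field_char_0 fps"
  assumes "f $ 0 = g $ 0" and "fps_deriv f = f * N" and "fps_deriv g = g * N"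
  shows "f = g"
proof (rule fps_ext)
  fix n
  show "f $ n = g $ n"
  proof (induction n rule: less_induct)
    case (less n)
    show ?case
    proof (cases n)
      case 0
      then show ?thesis using assms by simp
    next
      case (Suc m)
      have "of_nat (Suc m) * f $ Suc m = (f * N) $ m"
        using assms(2) by (metis fps_deriv_nth Suc_eq_plus1)
      also have "\<dots> = (g * N) $ m"
        unfolding fps_mult_nth by (intro sum.cong refl) (use less Suc in auto)
      also have "\<dots> = of_nat (Suc m) * g $ Suc m"
        using assms(3) by (metis fps_deriv_nth Suc_eq_plus1)
      finally show ?thesis using Suc by (simp del: of_nat_Suc)
    qed
  qed
qed

lemma lambda_series_add:
  "lambda_series (\<lambda>k. a k + b k) = lambda_series a * lambda_series b"
proof (rule fps_linear_ode_unique)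
  have "signed_power_sums (\<lambda>k. a k + b k) = signed_power_sums a + signed_power_sums b"
    by (simp add: signed_power_sums_def fps_eq_iff algebra_simps)
  then show "fps_deriv (lambda_series (\<lambda>k. a k + b k)) =
      lambda_series (\<lambda>k. a k + b k) * (signed_power_sums a + signed_power_sums b)"
    by (simp add: fps_deriv_lambda_series)
  show "fps_deriv (lambda_series a * lambda_series b) =
      lambda_series a * lambda_series b * (signed_power_sums a + signed_power_sums b)"
    by (simp add: fps_deriv_lambda_series algebra_simps)
qed simp

lemma lambda_series_zero [simp]: "lambda_series (\<lambda>k. 0) = 1"
  by (simp add: lambda_series_def signed_power_sums_def fps_integral0_zero fps_zero_def[symmetric])

lemma lambda_series_power:
  "lambda_series (\<lambda>k. e ^ k) = 1 + fps_const e * fps_X"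
proof (rule fps_linear_ode_unique)
  show "fps_deriv (1 + fps_const e * fps_X) = (1 + fps_const e * fps_X) * signed_power_sums (\<lambda>k. e ^ k)"
  proof (rule fps_ext)
    fix n show "fps_deriv (1 + fps_const e * fps_X) $ n =
      ((1 + fps_const e * fps_X) * signed_power_sums (\<lambda>k. e ^ k)) $ n"
      by (cases n) (simp_all add: signed_power_sums_def distrib_right mult.assoc)
  qed
qed (simp_all add: fps_deriv_lambda_series)

lemma lambda_series_sum_powers:
  assumes "finite I"
  shows "lambda_series (\<lambda>k. \<Sum>i\<in>I. e i ^ k) = (\<Prod>i\<in>I. 1 + fps_const (e i) * fps_X)"
  using assms by (induction I) (simp_all add: lambda_series_add lambda_series_power)

section \<open>Traces of powers and triangularisation\<close>

lemma upper_triangular_pow: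
  fixes B :: "'b::comm_semiring_1 mat"
  assumes B: "B \<in> carrier_mat n n" and ut: "upper_triangular B"
  shows "(\<forall>i<n. \<forall>j<i. (B ^\<^sub>m k) $$ (i, j) = 0) \<and> (\<forall>i<n. (B ^\<^sub>m k) $$ (i, i) = B $$ (i, i) ^ k)"
proof (induction k)
  case 0
  then show ?case using B by auto
next
  case (Suc k)
  have Bk: "B ^\<^sub>m k \<in> carrier_mat n n" using B by simp
  have ent: "(B ^\<^sub>m Suc k) $$ (i, j) = (\<Sum>l = 0..<n. (B ^\<^sub>m k) $$ (i, l) * B $$ (l, j))"
    if "i < n" "j < n" for i j
    using that B Bk by (simp add: scalar_prod_def)
  have u0: "B $$ (l, j) = 0" if "j < l" "l < n" for l j
    using ut that B by auto
  show ?case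
  proof (intro conjI allI impI)
    fix i j assume ij: "i < n" "j < i"
    show "(B ^\<^sub>m Suc k) $$ (i, j) = 0"
      unfolding ent[OF ij(1) order_less_trans[OF ij(2,1)]]
    proof (rule sum.neutral, rule ballI)
      fix l assume "l \<in> {0..<n}"
      then show "(B ^\<^sub>m k) $$ (i, l) * B $$ (l, j) = 0"
        using Suc ij u0[of j l] by (cases "l < i") auto
    qed
  next
    fix i assume i: "i < n"
    have "(\<Sum>l = 0..<n. (B ^\<^sub>m k) $$ (i, l) * B $$ (l, i)) = (\<Sum>l\<in>{i}. (B ^\<^sub>m k) $$ (i, l) * B $$ (l, i))"
    proof (rule sum.mono_neutral_right)
      show "\<forall>l\<in>{0..<n} - {i}. (B ^\<^sub>m k) $$ (i, l) * B $$ (l, i) = 0"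
      proof
        fix l assume "l \<in> {0..<n} - {i}"
        then show "(B ^\<^sub>m k) $$ (i, l) * B $$ (l, i) = 0"
          using Suc i u0[of i l] by (cases "l < i") auto
      qed
    qed (use i in auto)
    then show "(B ^\<^sub>m Suc k) $$ (i, i) = B $$ (i, i) ^ Suc k"
      using ent[OF i i] Suc i by (simp add: mult.commute)
  qed
qed

lemma mat_trace_carrier: "A \<in> carrier_mat n m \<Longrightarrow> mat_trace A = (\<Sum>i<n. A $$ (i, i))"
  by (simp add: mat_trace_def)

lemma mat_trace_comm:
  assumes P: "P \<in> carrier_mat n m" and Q: "Q \<in> carrier_mat m n"
  shows "mat_trace (P * Q) = mat_trace (Q * P)"
proof -
  have "mat_trace (P * Q) = (\<Sum>i<n. \<Sum>j<m. P $$ (i, j) * Q $$ (j, i))"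
    using P Q by (simp add: mat_trace_def scalar_prod_def atLeast0LessThan)
  also have "\<dots> = (\<Sum>j<m. \<Sum>i<n. Q $$ (j, i) * P $$ (i, j))"
    by (subst sum.swap) (simp add: mult.commute)
  also have "\<dots> = mat_trace (Q * P)"
    using P Q by (simp add: mat_trace_def scalar_prod_def atLeast0LessThan)
  finally show ?thesis .
qed

lemma mat_trace_similar:
  assumes A: "A \<in> carrier_mat n n" and sim: "similar_mat_wit A B P Q"
  shows "mat_trace A = mat_trace B"
proof -
  note w = similar_mat_witD2[OF A sim]
  have "mat_trace A = mat_trace (P * (B * Q))"
    using w by (simp add: assoc_mult_mat[of P n n B n Q n])
  also have "\<dots> = mat_trace (B * Q * P)"
    by (rule mat_trace_comm[of _ n n]) (use w in auto)
  also have "B * Q * P = B"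
    using w by (simp add: assoc_mult_mat[of B n n Q n P n])
  finally show ?thesis .
qed

lemma det_one_plus_similar:
  fixes A :: "complex mat"
  assumes A: "A \<in> carrier_mat n n" and sim: "similar_mat_wit A B P Q"
  shows "det (1\<^sub>m n + s \<cdot>\<^sub>m A) = det (1\<^sub>m n + s \<cdot>\<^sub>m B)"
proof (rule det_similar, rule similar_matI)
  note w = similar_mat_witD2[OF A sim]
  show "P * Q = 1\<^sub>m n" "Q * P = 1\<^sub>m n" by fact+
  show "{1\<^sub>m n + s \<cdot>\<^sub>m A, 1\<^sub>m n + s \<cdot>\<^sub>m B, P, Q} \<subseteq> carrier_mat n n" using w by auto
  have "P * (1\<^sub>m n + s \<cdot>\<^sub>m B) * Q = (P + s \<cdot>\<^sub>m (P * B)) * Q"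
    using w by (simp add: mult_add_distrib_mat[of P n n _ n] mult_smult_distrib[of P n n B n])
  also have "\<dots> = 1\<^sub>m n + s \<cdot>\<^sub>m A"
    using w by (subst add_mult_distrib_mat[of _ n n _ _ n])
      (auto simp: mult_smult_assoc_mat[of "P * B" n n Q n])
  finally show "1\<^sub>m n + s \<cdot>\<^sub>m A = P * (1\<^sub>m n + s \<cdot>\<^sub>m B) * Q" ..
qed

text \<open>After Schur triangularisation the power traces are the power sums of the eigenvalues
  e_i, so the series is the product of the 1 + e_i t, which is det (1 + t A). Consequently exterior
  traces depend on power traces alone.\<close>

lemma lambda_series_mat_trace:
  assumes A: "A \<in> carrier_mat n n"
  shows "lambda_series (\<lambda>k. mat_trace (A ^\<^sub>m k)) $ k = mat_trace (exterior_power_mat k A)"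
proof -
  obtain es where es: "char_poly A = (\<Prod>a\<leftarrow>es. [:- a, 1:])"
    using char_poly_factorized[OF A] by auto
  obtain B where B: "B \<in> carrier_mat n n" and ut: "upper_triangular B" and "similar_mat A B"
    using schur_decomposition_exists[OF A es] by auto
  then obtain P Q where wit: "similar_mat_wit A B P Q"
    unfolding similar_mat_def by auto
  define e where "e = (\<lambda>i. B $$ (i, i))"
  have tr: "mat_trace (A ^\<^sub>m k) = (\<Sum>i<n. e i ^ k)" for k
  proof -
    have "mat_trace (A ^\<^sub>m k) = mat_trace (B ^\<^sub>m k)"
      by (rule mat_trace_similar[OF _ similar_mat_wit_pow[OF wit]]) (use A in auto)
    then show ?thesis
      using upper_triangular_pow[OF B ut] mat_trace_carrier[of "B ^\<^sub>m k" n n] B by (simp add: e_def)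
  qed
  \<comment> \<open>\<open>q\<close> is det (1 + t A) factored over the eigenvalues,
    \<open>r\<close> the same determinant expanded in exterior traces.\<close>
  define q where "q = (\<Prod>i<n. [:1, e i:])"
  define r where "r = (\<Sum>k\<le>n. monom (mat_trace (exterior_power_mat k A)) k)"
  have "poly q s = poly r s" for s
  proof -
    have ut': "upper_triangular (1\<^sub>m n + s \<cdot>\<^sub>m B)" and c: "1\<^sub>m n + s \<cdot>\<^sub>m B \<in> carrier_mat n n"
      using upper_triangularD[OF ut] B by auto
    have "poly r s = det (1\<^sub>m n + s \<cdot>\<^sub>m B)"
      using det_one_plus_smult_exterior[OF A, of s] det_one_plus_similar[OF A wit, of s]
      by (simp add: r_def poly_sum poly_monom mult.commute)
    also have "\<dots> = (\<Prod>i<n. 1 + s * e i)"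
      using det_upper_triangular[OF ut' c] B
      by (simp add: diag_mat_def e_def interv_sum_list_conv_sum_set_nat prod.distinct_set_conv_list[symmetric] atLeast0LessThan)
    finally show ?thesis by (simp add: q_def poly_prod)
  qed
  then have "q = r" by (intro poly_eqI_degree[of UNIV] poly_ext) (auto intro: poly_ext)
  have "lambda_series (\<lambda>k. mat_trace (A ^\<^sub>m k)) = fps_of_poly q"
    by (simp add: tr lambda_series_sum_powers q_def fps_of_poly_prod fps_of_poly_linear')
  then have "lambda_series (\<lambda>k. mat_trace (A ^\<^sub>m k)) $ k = coeff r k"
    by (simp add: \<open>q = r\<close>)
  also have "\<dots> = mat_trace (exterior_power_mat k A)"
    using mat_trace_exterior_power_eq_0[OF A, of k]
    by (auto simp: r_def coeff_sum not_le if_distrib cong: if_cong)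
  finally show ?thesis .
qed

section \<open>Virtual characters and existence of the lambda operations\<close>

lemma sum_fun_apply: "(\<Sum>i\<in>I. f i) x = (\<Sum>i\<in>I. f i x)"
  by (induction I rule: infinite_finite_induct) (auto simp: zero_fun_def plus_fun_def)

text \<open>With subtraction as the sole operation, every induction over a span has just three
  cases; negatives and sums are derived.\<close>

inductive_set zspan :: "'b::ab_group_add set \<Rightarrow> 'b set" for S where
  zspan_zero: "0 \<in> zspan S"
| zspan_base: "s \<in> S \<Longrightarrow> s \<in> zspan S"
| zspan_diff: "x \<in> zspan S \<Longrightarrow> y \<in> zspan S \<Longrightarrow> x - y \<in> zspan S"

lemma zspan_uminus: "x \<in> zspan S \<Longrightarrow> - x \<in> zspan S"
  using zspan_diff[OF zspan_zero] by fastforce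

lemma zspan_add: "x \<in> zspan S \<Longrightarrow> y \<in> zspan S \<Longrightarrow> x + y \<in> zspan S"
  using zspan_diff[of x S "- y"] zspan_uminus[of y S] by simp

lemma zspan_sum: "(\<And>i. i \<in> I \<Longrightarrow> f i \<in> zspan S) \<Longrightarrow> (\<Sum>i\<in>I. f i) \<in> zspan S"
  by (induction I rule: infinite_finite_induct) (auto intro: zspan_zero zspan_add)

lemma zspan_of_nat_mult:
  fixes x :: "'b::ring_1" shows "x \<in> zspan S \<Longrightarrow> of_nat k * x \<in> zspan S"
  by (induction k) (auto intro: zspan_zero zspan_add simp: distrib_right)

lemma zspan_of_int_mult:
  fixes x :: "'b::ring_1" shows "x \<in> zspan S \<Longrightarrow> of_int k * x \<in> zspan S"
  by (cases k) (auto intro: zspan_of_nat_mult zspan_uminus zspan_diff simp: left_diff_distrib)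

lemma zspan_numeral_mult:
  fixes x :: "'b::ring_1" shows "x \<in> zspan S \<Longrightarrow> numeral k * x \<in> zspan S"
  using zspan_of_nat_mult[of x S "numeral k"] by simp

lemma zspan_least:
  assumes "S \<subseteq> zspan T" shows "zspan S \<subseteq> zspan T"
proof
  fix x assume "x \<in> zspan S"
  then show "x \<in> zspan T"
    by induction (use assms in \<open>auto intro: zspan_zero zspan_diff\<close>)
qed

lemma zspan_mono: "S \<subseteq> T \<Longrightarrow> zspan S \<subseteq> zspan T"
  by (intro zspan_least subset_trans[OF _ subsetI[OF zspan_base]])

lemma zspan_mult:
  fixes x y :: "'b::ring"
  assumes x: "x \<in> zspan S" and y: "y \<in> zspan T"
    and st: "\<And>s t. s \<in> S \<Longrightarrow> t \<in> T \<Longrightarrow> s * t \<in> zspan U"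
  shows "x * y \<in> zspan U"
  using x
proof induction
  case (zspan_base s)
  from y show ?case
    by induction (use zspan_base st in \<open>auto intro: zspan.intros simp: right_diff_distrib\<close>)
qed (auto intro: zspan.intros simp: left_diff_distrib)

lemma m_inv_add_monoid_eq_uminus:
  fixes R :: "('b::ab_group_add, 'm) ring_scheme"
  assumes "add R = (+)" "zero R = 0" "x \<in> carrier R" "- x \<in> carrier R"
  shows "m_inv (add_monoid R) x = - x"
  unfolding m_inv_def
  by (rule the_equality) (use assms in \<open>auto simp: eq_neg_iff_add_eq_0\<close>)

text \<open>Moves from the record-based generated subgroup to the type-class group, where pointwise
  arithmetic on functions is available.\<close>

lemma generate_add_monoid_eq_zspan:
  fixes R :: "('b::ab_group_add, 'm) ring_scheme"
  assumes R: "add R = (+)" "zero R = 0" and S: "S \<subseteq> carrier R"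
    and minus: "\<And>x. x \<in> carrier R \<Longrightarrow> - x \<in> carrier R"
  shows "generate (add_monoid R) S = zspan S"
proof
  have inv: "m_inv (add_monoid R) h = - h" if "h \<in> S" for h
    using m_inv_add_monoid_eq_uminus[OF R, of h] that S minus by auto
  show "generate (add_monoid R) S \<subseteq> zspan S"
  proof
    fix x assume "x \<in> generate (add_monoid R) S"
    then show "x \<in> zspan S"
    proof induction
      case (inv h)
      then show ?case unfolding \<open>\<And>h. h \<in> S \<Longrightarrow> m_inv (add_monoid R) h = - h\<close>[OF inv]
        by (intro zspan_uminus zspan_base)
    qed (auto simp: R intro: zspan_zero zspan_base zspan_add)
  qed
  have uminus: "- x \<in> generate (add_monoid R) S" if "x \<in> generate (add_monoid R) S" for x
    using that
  proof induction
    case one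
    then show ?case using generate.one[of "add_monoid R" S] by (simp add: R)
  next
    case (incl h)
    then show ?case using generate.inv[of h S "add_monoid R"] by (simp add: inv)
  next
    case (inv h)
    then show ?case
      using generate.incl[of h S "add_monoid R"] m_inv_add_monoid_eq_uminus[OF R, of h] S minus
      by auto
  next
    case (eng h1 h2)
    then show ?case
      using generate.eng[of "- h1" "add_monoid R" S "- h2"] by (simp add: R)
  qed
  show "zspan S \<subseteq> generate (add_monoid R) S"
  proof
    fix x assume "x \<in> zspan S"
    then show "x \<in> generate (add_monoid R) S"
    proof induction
      case zspan_zero
      then show ?case using generate.one[of "add_monoid R" S] by (simp add: R)
    next
      case (zspan_diff x y)
      then show ?case
        using generate.eng[of x "add_monoid R" S "- y"] uminus by (simp add: R)
    qed (rule generate.incl)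
  qed
qed

section \<open>The virtual character ring as a span of functions\<close>

definition irreducible_characters :: "('a, 'b) monoid_scheme \<Rightarrow> ('a \<Rightarrow> complex) set" where
  "irreducible_characters G = {character G \<rho> | d \<rho>. irreducible_complex_representation G d \<rho>}"

text \<open>This unit vanishes outside the carrier, so in general it is not the type-class constant
  1 on functions; factors restoring it recur below.\<close>

definition unit_function :: "('a, 'b) monoid_scheme \<Rightarrow> 'a \<Rightarrow> complex" where
  "unit_function G = (\<lambda>g. if g \<in> carrier G then 1 else 0)"

lemma virtual_character_ring_simps [simp]:
  "add (virtual_character_ring G) = (+)"
  "zero (virtual_character_ring G) = 0"
  "monoid.mult (virtual_character_ring G) = (*)"
  "one (virtual_character_ring G) = unit_function G"
  by (auto simp: virtual_character_ring_def function_ring_def fun_eq_iff unit_function_def)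

lemma carrier_virtual_character_ring:
  "carrier (virtual_character_ring G) = zspan (irreducible_characters G)"
proof -
  have "generate (add_monoid (function_ring G)) (irreducible_characters G) = zspan (irreducible_characters G)"
    by (rule generate_add_monoid_eq_zspan)
      (auto simp: function_ring_def irreducible_characters_def character_def fun_eq_iff)
  then show ?thesis
    by (simp add: virtual_character_ring_def irreducible_characters_def)
qed

lemma abelian_group_virtual_character_ring: "abelian_group (virtual_character_ring G)"
proof (rule abelian_groupI, goal_cases)
  case (6 x)
  then show ?case
    by (intro bexI[of _ "- x"]) (auto simp: carrier_virtual_character_ring zspan_uminus)
qed (auto simp: carrier_virtual_character_ring zspan_zero zspan_add add_ac)

lemma finsum_virtual_character_ring:
  assumes "finite I" and "\<And>i. i \<in> I \<Longrightarrow> f i \<in> carrier (virtual_character_ring G)"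
  shows "finsum (virtual_character_ring G) f I = (\<Sum>i\<in>I. f i)"
proof -
  interpret abelian_group "virtual_character_ring G"
    by (rule abelian_group_virtual_character_ring)
  show ?thesis
    using assms
  proof (induction I)
    case (insert i I)
    then show ?case
      by (subst finsum_insert) auto
  qed simp
qed

section \<open>Matrix representations and their characters\<close>

lemma complex_representationD:
  assumes "group G" and rep: "complex_representation G d \<rho>"
  shows "g \<in> carrier G \<Longrightarrow> \<rho> g \<in> carrier_mat d d"
    and "g \<in> carrier G \<Longrightarrow> h \<in> carrier G \<Longrightarrow> \<rho> (g \<otimes>\<^bsub>G\<^esub> h) = \<rho> g * \<rho> h"
    and "\<rho> \<one>\<^bsub>G\<^esub> = 1\<^sub>m d"
proof -
  interpret G: group G by fact
  let ?M = "ring_mat TYPE(complex) d ()"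
  interpret M: ring ?M by (rule ring_mat)
  interpret U: group "units_of ?M" by (rule M.units_group)
  have hom: "\<rho> \<in> hom G (units_of ?M)" using rep by (simp add: complex_representation_def)
  show "g \<in> carrier G \<Longrightarrow> \<rho> g \<in> carrier_mat d d"
    using hom by (auto simp: hom_def units_of_def Units_def ring_mat_simps)
  show "g \<in> carrier G \<Longrightarrow> h \<in> carrier G \<Longrightarrow> \<rho> (g \<otimes>\<^bsub>G\<^esub> h) = \<rho> g * \<rho> h"
    using hom by (auto simp: hom_def units_of_def ring_mat_simps)
  show "\<rho> \<one>\<^bsub>G\<^esub> = 1\<^sub>m d"
    using hom_one[OF hom G.group_axioms U.group_axioms] by (simp add: units_of_def ring_mat_simps)
qed

lemma complex_representationI:
  assumes "group G" and c: "\<And>g. g \<in> carrier G \<Longrightarrow> \<rho> g \<in> carrier_mat d d"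
    and m: "\<And>g h. g \<in> carrier G \<Longrightarrow> h \<in> carrier G \<Longrightarrow> \<rho> (g \<otimes>\<^bsub>G\<^esub> h) = \<rho> g * \<rho> h"
    and o: "\<rho> \<one>\<^bsub>G\<^esub> = 1\<^sub>m d"
  shows "complex_representation G d \<rho>"
proof -
  interpret G: group G by fact
  have "\<exists>y\<in>carrier_mat d d. y * \<rho> g = 1\<^sub>m d \<and> \<rho> g * y = 1\<^sub>m d" if g: "g \<in> carrier G" for g
    using c[of "inv\<^bsub>G\<^esub> g"] m[of g "inv\<^bsub>G\<^esub> g"] m[of "inv\<^bsub>G\<^esub> g" g] o g by auto
  then show ?thesis
    using c m by (auto simp: complex_representation_def hom_def units_of_def Units_def ring_mat_simps)
qed

lemma complex_representation_pow:
  assumes "group G" and rep: "complex_representation G d \<rho>" and g: "g \<in> carrier G"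
  shows "\<rho> (g [^]\<^bsub>G\<^esub> (k::nat)) = \<rho> g ^\<^sub>m k"
proof -
  interpret G: group G by fact
  note D = complex_representationD[OF \<open>group G\<close> rep]
  show ?thesis
    by (induction k) (use g D in \<open>auto simp: carrier_matD(1)[OF D(1)]\<close>)
qed

lemma character_pow:
  assumes "group G" and "complex_representation G d \<rho>" and "g \<in> carrier G"
  shows "character G \<rho> (g [^]\<^bsub>G\<^esub> (k::nat)) = mat_trace (\<rho> g ^\<^sub>m k)"
proof -
  interpret G: group G by fact
  show ?thesis using complex_representation_pow[OF assms] assms(3) by (simp add: character_def)
qed

text \<open>The candidate makes sense for every function, so the real issue is that it preserves
  virtual characters. The hypotheses reduce this to closure under products and to exterior powers of
  irreducible representations.\<close>

lemma ex_lambda_family: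
  assumes "group G"
    and one: "unit_function G \<in> carrier (virtual_character_ring G)"
    and mult: "\<And>x y. x \<in> carrier (virtual_character_ring G) \<Longrightarrow> y \<in> carrier (virtual_character_ring G) \<Longrightarrow>
      x * y \<in> carrier (virtual_character_ring G)"
    and ext: "\<And>d \<rho> n. irreducible_complex_representation G d \<rho> \<Longrightarrow>
      character G (\<lambda>g. exterior_power_mat n (\<rho> g)) \<in> carrier (virtual_character_ring G)"
  shows "\<exists>l. is_lambda_family G l"
proof -
  interpret G: group G by fact
  \<comment> \<open>The value f (g^k) is the k-th Adams operation of f at g; for a character it is
    the trace of the k-th power of the matrix of g.\<close>
  define l where "l = (\<lambda>n f g. if g \<in> carrier G
    then lambda_series (\<lambda>k. f (g [^]\<^bsub>G\<^esub> k) :: complex) $ n else 0)"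
  let ?R = "carrier (virtual_character_ring G)"
  note carr = carrier_virtual_character_ring
  have rep: "l n (character G \<rho>) = character G (\<lambda>g. exterior_power_mat n (\<rho> g))"
    if "complex_representation G d \<rho>" for d \<rho> n
  proof
    fix g
    show "l n (character G \<rho>) g = character G (\<lambda>g. exterior_power_mat n (\<rho> g)) g"
    proof (cases "g \<in> carrier G")
      case True
      then show ?thesis
        using lambda_series_mat_trace[OF complex_representationD(1)[OF \<open>group G\<close> that True]]
        by (simp add: l_def character_pow[OF \<open>group G\<close> that True]) (simp add: character_def)
    qed (simp add: l_def character_def)
  qed
  have l0: "l 0 x = unit_function G" for x
    by (simp add: l_def unit_function_def fun_eq_iff)
  have add: "l n (x + y) = (\<Sum>i\<le>n. l i x * l (n - i) y)" for n x y
  proof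
    fix g
    have "lambda_series (\<lambda>k. (x + y) (g [^]\<^bsub>G\<^esub> k)) =
      lambda_series (\<lambda>k. x (g [^]\<^bsub>G\<^esub> k)) * lambda_series (\<lambda>k. y (g [^]\<^bsub>G\<^esub> k))"
      using lambda_series_add by auto
    then show "l n (x + y) g = (\<Sum>i\<le>n. l i x * l (n - i) y) g"
      by (simp add: l_def sum_fun_apply fps_mult_nth atLeast0AtMost)
  qed
  have closed: "l n x \<in> ?R" if "x \<in> zspan (irreducible_characters G)" for n x
    using that
  proof (induction arbitrary: n)
    case zspan_zero
    have "l n 0 = (if n = 0 then unit_function G else 0)"
      by (auto simp: l_def fun_eq_iff unit_function_def)
    then show ?case unfolding \<open>l n 0 = _\<close> using one by (auto simp: carr intro: zspan.zspan_zero)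
  next
    case (zspan_base s)
    then obtain d \<rho> where s: "s = character G \<rho>" and irr: "irreducible_complex_representation G d \<rho>"
      by (auto simp: irreducible_characters_def)
    then show ?case
      using rep[of d \<rho> n] ext[OF irr] by (simp add: irreducible_complex_representation_def)
  next
    case (zspan_diff x y)
    show ?case
    proof (induction n rule: less_induct)
      case (less n)
      \<comment> \<open>The addition law for x = (x - y) + y, solved for its top term, expresses
        \<open>l n (x - y)\<close> through the lower \<open>l i (x - y)\<close>; hence the inner
        induction on \<open>n\<close>.\<close>
      have "l n x = (\<Sum>i\<le>n. l i (x - y) * l (n - i) y)"
        using add[of n "x - y" y] by simp
      also have "\<dots> = (\<Sum>i<n. l i (x - y) * l (n - i) y) + l n (x - y) * unit_function G"
        by (simp add: lessThan_Suc_atMost[symmetric] l0)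
      also have "l n (x - y) * unit_function G = l n (x - y)"
        by (auto simp: l_def unit_function_def fun_eq_iff)
      finally have "l n x = (\<Sum>i<n. l i (x - y) * l (n - i) y) + l n (x - y)" .
      then have "l n (x - y) = l n x - (\<Sum>i<n. l i (x - y) * l (n - i) y)"
        by (metis add_diff_cancel_left')
      moreover have "(\<Sum>i<n. l i (x - y) * l (n - i) y) \<in> zspan (irreducible_characters G)"
        by (intro zspan_sum mult[unfolded carr] less[unfolded carr] zspan_diff.IH(2)[unfolded carr]) simp
      ultimately show "l n (x - y) \<in> ?R"
        using zspan.zspan_diff[OF zspan_diff.IH(1)[of n, unfolded carr]] by (simp only: carr)
    qed
  qed
  have "is_lambda_family G l"
    unfolding is_lambda_family_def Let_def
  proof (intro conjI allI ballI impI)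
    show "l n \<in> ?R \<rightarrow> ?R" for n using closed by (auto simp: carr)
    show "l n (x \<oplus>\<^bsub>virtual_character_ring G\<^esub> y) =
        (\<Oplus>\<^bsub>virtual_character_ring G\<^esub>i\<in>{..n}. l i x \<otimes>\<^bsub>virtual_character_ring G\<^esub> l (n - i) y)"
      if "x \<in> ?R" "y \<in> ?R" for n x y
      using that closed mult by (subst finsum_virtual_character_ring) (auto simp: carr add)
  qed (use rep l0 in auto)
  then show ?thesis by blast
qed

section \<open>The dihedral representations\<close>

abbreviation (input) mat2 :: "'b \<Rightarrow> 'b \<Rightarrow> 'b \<Rightarrow> 'b \<Rightarrow> 'b mat" where
  "mat2 a b c d \<equiv> mat_of_rows_list 2 [[a, b], [c, d]]"

lemma sum_upto_2:
  fixes f :: "nat \<Rightarrow> 'b::comm_monoid_add"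
  shows "(\<Sum>i<2. f i) = f 0 + f (Suc 0)" "(\<Sum>i=0..<2. f i) = f 0 + f (Suc 0)"
  by (simp_all add: numeral_2_eq_2)

lemma mat2_carrier [simp]: "mat2 a b c d \<in> carrier_mat 2 2"
  by (rule carrier_matI) (simp_all add: mat_of_rows_list_def)

lemma mat2_index [simp]:
  "mat2 a b c d $$ (0, 0) = a" "mat2 a b c d $$ (0, Suc 0) = b"
  "mat2 a b c d $$ (Suc 0, 0) = c" "mat2 a b c d $$ (Suc 0, Suc 0) = d"
  "dim_row (mat2 a b c d) = 2" "dim_col (mat2 a b c d) = 2"
  by (simp_all add: mat_of_rows_list_def)

lemma mat2_eqI:
  assumes "A \<in> carrier_mat 2 2"
    and "A $$ (0, 0) = a" "A $$ (0, Suc 0) = b" "A $$ (Suc 0, 0) = c" "A $$ (Suc 0, Suc 0) = d"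
  shows "A = mat2 a b c d"
  using assms by (intro eq_matI) (auto dest!: less_2_cases)

lemma mat2_eq_iff [simp]:
  "mat2 a b c d = mat2 a' b' c' d' \<longleftrightarrow> a = a' \<and> b = b' \<and> c = c' \<and> d = d'"
  by (metis mat2_index(1-4))

lemma mat2_mult [simp]:
  fixes a :: "'b::comm_ring_1"
  shows "mat2 a b c d * mat2 a' b' c' d' =
    mat2 (a * a' + b * c') (a * b' + b * d') (c * a' + d * c') (c * b' + d * d')"
  by (rule mat2_eqI) (auto simp: scalar_prod_def sum_upto_2)

lemma det_mat2 [simp]:
  fixes a :: "'b::comm_ring_1"
  shows "det (mat2 a b c d) = a * d - b * c"
proof -
  have "det (mat2 a b c d) = (\<Sum>i<2. mat2 a b c d $$ (i, 0) * cofactor (mat2 a b c d) i 0)"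
    by (rule laplace_expansion_column) auto
  also have "\<dots> = a * d - b * c"
    by (simp add: sum_upto_2 cofactor_def det_single mat_delete_def algebra_simps)
  finally show ?thesis .
qed

lemma mat_trace_mat2 [simp]: "mat_trace (mat2 a b c d) = a + d"
  by (simp add: mat_trace_def sum_upto_2)

lemma map_mat_mat2 [simp]: "map_mat f (mat2 a b c d) = mat2 (f a) (f b) (f c) (f d)"
  by (rule mat2_eqI) auto

lemma one_mat2: "1\<^sub>m 2 = mat2 1 0 0 (1 :: 'b::comm_ring_1)"
  by (rule mat2_eqI) auto

lemma one_plus_smult_mat2 [simp]:
  fixes a :: "'b::comm_ring_1"
  shows "1\<^sub>m 2 + s \<cdot>\<^sub>m mat2 a b c d = mat2 (1 + s * a) (s * b) (s * c) (1 + s * d)"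
  by (rule mat2_eqI) auto

lemma carrier_mat2E:
  assumes "A \<in> carrier_mat 2 2"
  obtains a b c d where "A = mat2 a b c d"
  using mat2_eqI[OF assms refl refl refl refl] by blast

text \<open>The traces are read off the quadratic polynomial det (1 + s A) at s = 0, 1 and
  -1.\<close>

lemma mat_trace_exterior_power_2:
  assumes A: "A \<in> carrier_mat 2 2"
  shows "mat_trace (exterior_power_mat n A) =
    (if n = 0 then 1 else if n = 1 then mat_trace A else if n = 2 then det A else 0)"
proof -
  obtain a b c d where A2: "A = mat2 a b c d" using A by (rule carrier_mat2E)
  define t where "t = (\<lambda>k. mat_trace (exterior_power_mat k A))"
  have e: "det (1\<^sub>m 2 + s \<cdot>\<^sub>m A) = t 0 + s * t 1 + s ^ 2 * t 2" for s
    unfolding det_one_plus_smult_exterior[OF A] by (simp add: t_def numeral_2_eq_2)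
  have e': "(1 + s * a) * (1 + s * d) - s * b * (s * c) = t 0 + s * t 1 + s ^ 2 * t 2" for s
    using e[of s] by (simp add: A2)
  have t0: "t 0 = 1" using e'[of 0] by simp
  have s1: "t 1 + t 2 = a + d + a * d - b * c" using e'[of 1] t0 by (simp add: algebra_simps)
  have s2: "t 2 - t 1 = a * d - b * c - a - d" using e'[of "-1"] t0 by (simp add: algebra_simps)
  have "2 * t 2 = 2 * (a * d - b * c)" using arg_cong2[OF s1 s2, of "(+)"] by (simp add: algebra_simps)
  then have t2: "t 2 = a * d - b * c" by (simp only: mult_cancel_left) simp
  moreover have t1: "t 1 = a + d" using s1 t2 by (simp add: algebra_simps)
  moreover have "t n = 0" if "n > 2" using mat_trace_exterior_power_eq_0[OF A that] by (simp add: t_def)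
  ultimately show ?thesis using t0 by (auto simp: t_def A2)
qed

lemma mat_trace_exterior_power_1:
  assumes A: "A \<in> carrier_mat 1 1"
  shows "mat_trace (exterior_power_mat n A) =
    (if n = 0 then 1 else if n = 1 then mat_trace A else 0)"
proof -
  define t where "t = (\<lambda>k. mat_trace (exterior_power_mat k A))"
  have "det (1\<^sub>m 1 + s \<cdot>\<^sub>m A) = 1 + s * A $$ (0, 0)" for s
    using A by (subst det_single) auto
  then have e: "1 + s * A $$ (0, 0) = t 0 + s * t 1" for s
    using det_one_plus_smult_exterior[OF A, of s] by (simp add: t_def)
  have "t 0 = 1" using e[of 0] by simp
  moreover have "t 1 = A $$ (0, 0)" using e[of 1] \<open>t 0 = 1\<close> by simp
  moreover have "t n = 0" if "n > 1" using mat_trace_exterior_power_eq_0[OF A that] by (simp add: t_def)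
  ultimately show ?thesis using A by (auto simp: t_def mat_trace_def)
qed

lemma subspace_module_vecI:
  assumes "W \<subseteq> carrier_vec d" "0\<^sub>v d \<in> W" "\<And>v w. v \<in> W \<Longrightarrow> w \<in> W \<Longrightarrow> v + w \<in> W"
    "\<And>c v. v \<in> W \<Longrightarrow> c \<cdot>\<^sub>v v \<in> W"
  shows "VectorSpace.subspace class_ring W (module_vec TYPE(complex) d)"
  unfolding VectorSpace.subspace_def submodule_def
  using assms vec_vs[where 'a=complex, of d] vec_module[where 'a=complex, of d]
  by (auto simp: module_vec_simps)

lemma subspace_module_vecD:
  assumes "VectorSpace.subspace class_ring W (module_vec TYPE(complex) d)"
  shows "W \<subseteq> carrier_vec d" "0\<^sub>v d \<in> W" "\<And>v w. v \<in> W \<Longrightarrow> w \<in> W \<Longrightarrow> v + w \<in> W"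
    "\<And>c v. v \<in> W \<Longrightarrow> c \<cdot>\<^sub>v v \<in> W"
  using assms unfolding VectorSpace.subspace_def submodule_def
  by (auto simp: module_vec_simps)

lemma irreducible_one_dimensional:
  assumes "complex_representation G 1 \<rho>"
  shows "irreducible_complex_representation G 1 \<rho>"
  unfolding irreducible_complex_representation_def
proof (intro conjI allI impI assms)
  fix W assume W: "VectorSpace.subspace class_ring W (module_vec TYPE(complex) 1)"
  note WD = subspace_module_vecD[OF W]
  show "W = {0\<^sub>v 1} \<or> W = carrier_vec 1"
  proof (rule disjCI)
    assume "W \<noteq> carrier_vec 1"
    show "W = {0\<^sub>v 1}"
    proof (rule ccontr)
      assume "W \<noteq> {0\<^sub>v 1}"
      then obtain w where w: "w \<in> W" "w \<noteq> 0\<^sub>v 1" using WD(2) by auto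
      have w1: "w \<in> carrier_vec 1" using w WD(1) by auto
      have w0: "vec_index w 0 \<noteq> 0"
      proof
        assume "vec_index w 0 = 0"
        then have "w = 0\<^sub>v 1" using w1 by (intro eq_vecI) auto
        then show False using w by simp
      qed
      have "u \<in> W" if "u \<in> carrier_vec 1" for u
      proof -
        have "u = (vec_index u 0 / vec_index w 0) \<cdot>\<^sub>v w"
          using that w1 w0 by (intro eq_vecI) auto
        then show ?thesis using WD(4)[OF w(1)] by metis
      qed
      then show False using WD(1) \<open>W \<noteq> carrier_vec 1\<close> by auto
    qed
  qed
qed simp

text \<open>Character values at powers of g are power traces, and these determine the exterior
  traces. So exterior powers of an arbitrary irreducible representation can be computed on a model
  with the same character.\<close>

lemma character_exterior_power_cong:
  assumes "group G" and r1: "complex_representation G d \<rho>" and r2: "complex_representation G d' \<rho>'"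
    and eq: "character G \<rho> = character G \<rho>'"
  shows "character G (\<lambda>g. exterior_power_mat n (\<rho> g)) = character G (\<lambda>g. exterior_power_mat n (\<rho>' g))"
proof
  fix g
  have "mat_trace (exterior_power_mat n (\<rho> g)) = mat_trace (exterior_power_mat n (\<rho>' g))" if g: "g \<in> carrier G"
  proof -
    have "lambda_series (\<lambda>k. mat_trace (\<rho> g ^\<^sub>m k)) = lambda_series (\<lambda>k. mat_trace (\<rho>' g ^\<^sub>m k))"
      using character_pow[OF \<open>group G\<close> r1 g] character_pow[OF \<open>group G\<close> r2 g] eq by simp
    then show ?thesis
      using lambda_series_mat_trace[OF complex_representationD(1)[OF \<open>group G\<close> r1 g]]
        lambda_series_mat_trace[OF complex_representationD(1)[OF \<open>group G\<close> r2 g]] by metis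
  qed
  then show "character G (\<lambda>g. exterior_power_mat n (\<rho> g)) g = character G (\<lambda>g. exterior_power_mat n (\<rho>' g)) g"
    by (simp add: character_def)
qed

section \<open>The dihedral group and its elements\<close>

locale dihedral_character = group G for G (structure) +
  fixes p :: nat and \<tau> \<sigma> :: 'a and \<chi> :: "'a \<Rightarrow> complex mat"
  assumes prime_p: "prime p" and odd_p: "odd p"
    and tau_closed [simp]: "\<tau> \<in> carrier G" and sigma_closed [simp]: "\<sigma> \<in> carrier G"
    and generators: "generate G {\<tau>, \<sigma>} = carrier G"
    and tau_sq: "\<tau> \<otimes> \<tau> = \<one>" and sigma_p: "\<sigma> [^] p = \<one>"
    and tau_sigma_tau: "\<tau> \<otimes> \<sigma> \<otimes> \<tau> = inv \<sigma>"
    and rep: "complex_representation G 2 \<chi>"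
    and chi_sigma_exp: "\<And>j::nat. \<chi> (\<sigma> [^] j) = mat2
           (exp (2 * of_real pi * \<i> * of_nat j / of_nat p)) 0
            0 (exp (- (2 * of_real pi * \<i> * of_nat j / of_nat p)))"
    and chi_tau: "\<chi> \<tau> = mat2 0 1 1 0"
begin

lemma p_pos: "p > 0" using prime_p by (rule prime_gt_0_nat)

lemma inv_sigma: "inv \<sigma> = \<sigma> [^] (p - 1)"
proof -
  have "\<sigma> [^] (p - 1) \<otimes> \<sigma> = \<one>"
    using sigma_p p_pos by (metis Suc_pred' nat_pow_Suc)
  then show ?thesis by (simp add: inv_equality)
qed

lemma sigma_tau: "\<sigma> \<otimes> \<tau> = \<tau> \<otimes> \<sigma> [^] (p - 1)"
proof -
  have "\<tau> \<otimes> (\<tau> \<otimes> (\<sigma> \<otimes> \<tau>)) = \<tau> \<otimes> \<sigma> [^] (p - 1)"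
    using tau_sigma_tau inv_sigma by (simp add: m_assoc)
  moreover have "\<tau> \<otimes> (\<tau> \<otimes> (\<sigma> \<otimes> \<tau>)) = \<sigma> \<otimes> \<tau>"
    by (simp add: m_assoc[symmetric] tau_sq)
  ultimately show ?thesis by simp
qed

lemma sigma_pow_tau: "\<sigma> [^] (j::nat) \<otimes> \<tau> = \<tau> \<otimes> \<sigma> [^] ((p - 1) * j)"
proof (induction j)
  case (Suc j)
  have "\<sigma> [^] Suc j \<otimes> \<tau> = \<sigma> [^] j \<otimes> \<tau> \<otimes> \<sigma> [^] (p - 1)"
    by (simp add: m_assoc sigma_tau)
  also have "\<dots> = \<tau> \<otimes> \<sigma> [^] ((p - 1) * Suc j)"
    by (simp add: Suc m_assoc nat_pow_mult add.commute)
  finally show ?case .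
qed simp

text \<open>The normal forms contain the generators and are closed under products. Inverses are
  absorbed through \<sigma>^(-1) = \<sigma>^(p-1), which keeps all exponents natural
  numbers.\<close>

lemma carrier_cases:
  assumes "g \<in> carrier G"
  obtains j :: nat where "g = \<sigma> [^] j" | j :: nat where "g = \<tau> \<otimes> \<sigma> [^] j"
proof -
  define K where "K = range (\<lambda>j::nat. \<sigma> [^] j) \<union> range (\<lambda>j::nat. \<tau> \<otimes> \<sigma> [^] j)"
  have in1: "\<sigma> [^] (j::nat) \<in> K" and in2: "\<tau> \<otimes> \<sigma> [^] (j::nat) \<in> K" for j
    by (auto simp: K_def)
  have "g \<in> generate G {\<tau>, \<sigma>}" using assms generators by simp
  then have "g \<in> K"
  proof induction
    case one
    then show ?case using in1[of 0] by simp
  next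
    case (incl h)
    then show ?case using in1[of 1] in2[of 0] by auto
  next
    case (inv h)
    have "inv \<tau> = \<tau>" using tau_sq by (simp add: inv_equality)
    then show ?case using inv in1[of "p - 1"] in2[of 0] by (auto simp: inv_sigma)
  next
    case (eng h1 h2)
    have 1: "\<sigma> [^] i \<otimes> \<sigma> [^] j = \<sigma> [^] (i + j)" for i j :: nat by (simp add: nat_pow_mult)
    have 2: "\<sigma> [^] i \<otimes> (\<tau> \<otimes> \<sigma> [^] j) = \<tau> \<otimes> \<sigma> [^] ((p - 1) * i + j)" for i j :: nat
      by (simp add: m_assoc[symmetric] sigma_pow_tau) (simp add: m_assoc nat_pow_mult)
    have 3: "\<tau> \<otimes> \<sigma> [^] i \<otimes> \<sigma> [^] j = \<tau> \<otimes> \<sigma> [^] (i + j)" for i j :: nat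
      by (simp add: m_assoc nat_pow_mult)
    have 4: "\<tau> \<otimes> \<sigma> [^] i \<otimes> (\<tau> \<otimes> \<sigma> [^] j) = \<sigma> [^] ((p - 1) * i + j)" for i j :: nat
    proof -
      have "\<tau> \<otimes> \<sigma> [^] i \<otimes> (\<tau> \<otimes> \<sigma> [^] j) = \<tau> \<otimes> (\<sigma> [^] i \<otimes> (\<tau> \<otimes> \<sigma> [^] j))" by (simp add: m_assoc)
      also have "\<dots> = \<tau> \<otimes> \<tau> \<otimes> \<sigma> [^] ((p - 1) * i + j)" by (simp add: 2 m_assoc)
      finally show ?thesis by (simp add: tau_sq)
    qed
    from eng.IH obtain i j where "h1 = \<sigma> [^] (i::nat) \<or> h1 = \<tau> \<otimes> \<sigma> [^] (i::nat)"
      and "h2 = \<sigma> [^] (j::nat) \<or> h2 = \<tau> \<otimes> \<sigma> [^] (j::nat)"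
      unfolding K_def by auto
    then show ?case
      by (elim disjE; simp only: 1 2 3 4 in1 in2)
  qed
  then show ?thesis using that by (auto simp: K_def)
qed

section \<open>The p-th root of unity\<close>

definition zeta :: complex where "zeta = cis (2 * pi / real p)"

lemma zeta_pow: "zeta ^ j = cis (2 * pi * real j / real p)"
  by (simp add: zeta_def DeMoivre mult_ac)

lemma zeta_p [simp]: "zeta ^ p = 1"
  using p_pos by (simp add: zeta_pow)

lemma zeta_neq_0 [simp]: "zeta \<noteq> 0" by (simp add: zeta_def)

lemma zeta_pow_mod: "zeta ^ (j mod p) = zeta ^ j"
proof -
  have "zeta ^ j = zeta ^ (p * (j div p) + j mod p)" by simp
  also have "\<dots> = zeta ^ (j mod p)" by (simp only: power_add power_mult zeta_p power_one mult_1)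
  finally show ?thesis ..
qed

lemma zeta_pow_eq_1_iff: "zeta ^ j = 1 \<longleftrightarrow> p dvd j"
proof
  assume "zeta ^ j = 1"
  then have "zeta ^ (j mod p) = zeta ^ 0" by (simp add: zeta_pow_mod)
  moreover have "inj_on (\<lambda>k. zeta ^ k) {..<p}"
    using bij_betw_roots_unity[OF p_pos] by (simp add: zeta_pow bij_betw_def)
  ultimately have "j mod p = 0" using p_pos inj_onD[of "\<lambda>k. zeta ^ k" "{..<p}" "j mod p" 0] by auto
  then show "p dvd j" by auto
next
  assume "p dvd j"
  then show "zeta ^ j = 1" by (auto simp: power_mult)
qed

lemma root_of_unity_eq_zeta_pow:
  assumes "\<mu> ^ p = 1" obtains k where "k > 0" "\<mu> = zeta ^ k"
proof -
  obtain k where "\<mu> = zeta ^ k"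
    using bij_betw_roots_unity[OF p_pos] assms by (force simp: zeta_pow bij_betw_def)
  \<comment> \<open>Adding p makes the exponent positive. With exponent 0 the entrywise power in
    \<open>rho\<close> would turn the zero entries into 0^0 = 1.\<close>
  then have "\<mu> = zeta ^ (k + p)" by (simp add: power_add)
  then show ?thesis using that[of "k + p"] p_pos by simp
qed

lemma chi_sigma: "\<chi> (\<sigma> [^] (j::nat)) = mat2 (zeta ^ j) 0 0 (inverse zeta ^ j)"
proof -
  have "exp (2 * of_real pi * \<i> * of_nat j / of_nat p) = zeta ^ j"
    by (simp add: zeta_pow cis_conv_exp mult_ac)
  then show ?thesis by (simp add: chi_sigma_exp exp_minus power_inverse)
qed

lemma chi_tau_sigma: "\<chi> (\<tau> \<otimes> \<sigma> [^] (j::nat)) = mat2 0 (inverse zeta ^ j) (zeta ^ j) 0"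
  using complex_representationD(2)[OF is_group rep, of \<tau> "\<sigma> [^] j"] by (simp add: chi_tau chi_sigma)

section \<open>Class functions and the representations that realise them\<close>

definition one_fn :: "'a \<Rightarrow> complex" where "one_fn = unit_function G"

definition eps :: "'a \<Rightarrow> complex" where
  "eps = (\<lambda>g. if g \<in> carrier G then det (\<chi> g) else 0)"

definition chr :: "nat \<Rightarrow> 'a \<Rightarrow> complex" where
  "chr k = (\<lambda>g. if g \<in> carrier G \<and> \<chi> g $$ (0, 0) \<noteq> 0
    then \<chi> g $$ (0, 0) ^ k + \<chi> g $$ (Suc 0, Suc 0) ^ k else 0)"

lemma function_values [simp]:
  fixes j :: nat
  shows "one_fn (\<sigma> [^] j) = 1" "one_fn (\<tau> \<otimes> \<sigma> [^] j) = 1"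
    "eps (\<sigma> [^] j) = 1" "eps (\<tau> \<otimes> \<sigma> [^] j) = -1"
    "chr k (\<sigma> [^] j) = zeta ^ (j * k) + inverse zeta ^ (j * k)" "chr k (\<tau> \<otimes> \<sigma> [^] j) = 0"
    "g \<notin> carrier G \<Longrightarrow> one_fn g = 0" "g \<notin> carrier G \<Longrightarrow> eps g = 0" "g \<notin> carrier G \<Longrightarrow> chr k g = 0"
  by (simp_all add: one_fn_def unit_function_def eps_def chr_def chi_sigma chi_tau_sigma power_mult
      flip: power_mult_distrib)

lemma fun_eqI:
  assumes "\<And>g. g \<notin> carrier G \<Longrightarrow> f g = h g" "\<And>j::nat. f (\<sigma> [^] j) = h (\<sigma> [^] j)"
    "\<And>j::nat. f (\<tau> \<otimes> \<sigma> [^] j) = h (\<tau> \<otimes> \<sigma> [^] j)"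
  shows "f = h"
proof
  fix g show "f g = h g"
    using assms by (cases "g \<in> carrier G") (auto elim: carrier_cases)
qed

definition rho :: "nat \<Rightarrow> 'a \<Rightarrow> complex mat" where
  "rho k g = map_mat (\<lambda>x. x ^ k) (\<chi> g)"

lemma rho_sigma: "rho k (\<sigma> [^] (j::nat)) = mat2 (zeta ^ (j * k)) (0 ^ k) (0 ^ k) (inverse zeta ^ (j * k))"
  and rho_tau_sigma: "rho k (\<tau> \<otimes> \<sigma> [^] (j::nat)) = mat2 (0 ^ k) (inverse zeta ^ (j * k)) (zeta ^ (j * k)) (0 ^ k)"
  by (simp_all add: rho_def chi_sigma chi_tau_sigma power_mult)

text \<open>Every \<open>\<chi> g\<close> is a monomial matrix, so taking entrywise powers is multiplicative.\<close>

lemma monomial: "g \<in> carrier G \<Longrightarrow> (\<exists>a b. \<chi> g = mat2 a 0 0 b) \<or> (\<exists>a b. \<chi> g = mat2 0 a b 0)"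
  by (erule carrier_cases) (auto simp: chi_sigma chi_tau_sigma)

lemma rho_representation:
  assumes k: "k > 0"
  shows "complex_representation G 2 (rho k)"
proof (rule complex_representationI[OF is_group])
  show "rho k g \<in> carrier_mat 2 2" if "g \<in> carrier G" for g
    using complex_representationD(1)[OF is_group rep that] by (simp add: rho_def)
  show "rho k (g \<otimes> h) = rho k g * rho k h" if "g \<in> carrier G" "h \<in> carrier G" for g h
    using monomial[OF that(1)] monomial[OF that(2)] k
      complex_representationD(2)[OF is_group rep that]
    by (auto simp: rho_def power_mult_distrib zero_power)
  show "rho k \<one> = 1\<^sub>m 2"
    using k rho_sigma[of k 0] by (simp add: one_mat2)
qed

lemma character_rho: "k > 0 \<Longrightarrow> character G (rho k) = chr k"
  by (rule fun_eqI) (simp_all add: character_def rho_sigma rho_tau_sigma)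

lemma character_chi: "character G \<chi> = chr 1"
proof -
  have "rho 1 = \<chi>" by (auto simp: rho_def fun_eq_iff)
  then show ?thesis using character_rho[of 1] by simp
qed

definition rho_one :: "'a \<Rightarrow> complex mat" where "rho_one g = 1\<^sub>m 1"
definition rho_eps :: "'a \<Rightarrow> complex mat" where "rho_eps g = det (\<chi> g) \<cdot>\<^sub>m 1\<^sub>m 1"

lemma rho_one_representation: "complex_representation G 1 rho_one"
  by (rule complex_representationI[OF is_group]) (auto simp: rho_one_def)

lemma rho_eps_representation: "complex_representation G 1 rho_eps"
proof (rule complex_representationI[OF is_group])
  note R = complex_representationD[OF is_group rep]
  show "rho_eps (g \<otimes> h) = rho_eps g * rho_eps h" if "g \<in> carrier G" "h \<in> carrier G" for g h
    using R(2)[OF that] det_mult[OF R(1)[OF that(1)] R(1)[OF that(2)]]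
    by (intro eq_matI) (auto simp: rho_eps_def scalar_prod_def)
  show "rho_eps \<one> = 1\<^sub>m 1" by (rule eq_matI) (simp_all add: rho_eps_def R(3))
qed (simp add: rho_eps_def)

lemma character_rho_one: "character G rho_one = one_fn"
  by (auto simp: character_def rho_one_def one_fn_def unit_function_def mat_trace_def fun_eq_iff)

lemma character_rho_eps: "character G rho_eps = eps"
  by (auto simp: character_def rho_eps_def eps_def mat_trace_def fun_eq_iff)

end

section \<open>Classification of the irreducible characters\<close>

abbreviation (input) vec2 :: "'b \<Rightarrow> 'b \<Rightarrow> 'b vec" where
  "vec2 a b \<equiv> vec 2 (\<lambda>i. if i = 0 then a else b)"

lemma vec2_eqI:
  assumes "v \<in> carrier_vec 2" "vec_index v 0 = a" "vec_index v (Suc 0) = b"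
  shows "v = vec2 a b"
  using assms by (intro eq_vecI) (auto dest!: less_2_cases)

lemma carrier_vec2E:
  assumes "v \<in> carrier_vec 2" obtains a b where "v = vec2 a b"
  using vec2_eqI[OF assms refl refl] by blast

lemma mat2_mult_vec2:
  fixes a :: "'b::comm_ring_1"
  shows "mat2 a b c d *\<^sub>v vec2 x y = vec2 (a * x + b * y) (c * x + d * y)"
  by (rule vec2_eqI) (auto simp: scalar_prod_def sum_upto_2 mult_mat_vec_def)

context dihedral_character begin

text \<open>Since p is odd and does not divide k, the eigenvalues of \<sigma> are distinct. A
  non-zero invariant subspace therefore contains an eigenline, and \<tau> swaps the two
  eigenlines.\<close>

lemma rho_irreducible:
  assumes k: "k > 0" and pk: "\<not> p dvd k"
  shows "irreducible_complex_representation G 2 (rho k)"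
  unfolding irreducible_complex_representation_def
proof (intro conjI allI impI rho_representation[OF k])
  fix W assume W: "VectorSpace.subspace class_ring W (module_vec TYPE(complex) 2)"
    and inv: "\<forall>g\<in>carrier G. \<forall>w\<in>W. rho k g *\<^sub>v w \<in> W"
  note WD = subspace_module_vecD[OF W]
  define c where "c = zeta ^ k"
  define c' where "c' = inverse zeta ^ k"
  have S: "vec2 (c * a) (c' * b) \<in> W" if "vec2 a b \<in> W" for a b
  proof -
    have "rho k (\<sigma> [^] (1::nat)) *\<^sub>v vec2 a b \<in> W" using inv that by (metis nat_pow_closed sigma_closed)
    then show ?thesis
      by (simp only: rho_sigma mat2_mult_vec2 c_def c'_def zero_power[OF k] mult_zero_left
          add_0_right add_0_left mult_1)
  qed
  have T: "vec2 b a \<in> W" if "vec2 a b \<in> W" for a b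
  proof -
    have "rho k (\<tau> \<otimes> \<sigma> [^] (0::nat)) *\<^sub>v vec2 a b \<in> W" using inv that by simp
    then show ?thesis
      by (simp only: rho_tau_sigma mat2_mult_vec2 zero_power[OF k] mult_zero_left
          add_0_right add_0_left mult_1 power_0)
  qed
  have cc: "c \<noteq> c'"
  proof
    assume "c = c'"
    then have "zeta ^ (k + k) = c * c'" by (simp add: c_def power_add)
    also have "c * c' = 1" by (simp add: c_def c'_def power_inverse)
    finally have "zeta ^ (k + k) = 1" .
    then have "p dvd 2 * k" by (simp add: zeta_pow_eq_1_iff mult_2)
    then show False
      using pk prime_p odd_p prime_dvd_mult_nat[of p 2 k] primes_dvd_imp_eq[OF prime_p two_is_prime_nat] by auto
  qed
  show "W = {0\<^sub>v 2} \<or> W = carrier_vec 2"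
  proof (cases "W = {0\<^sub>v 2}")
    case False
    then obtain w where w: "w \<in> W" "w \<noteq> 0\<^sub>v 2" using WD(2) by auto
    then obtain a0 b0 where w0: "w = vec2 a0 b0" using WD(1) carrier_vec2E by blast
    have "a0 \<noteq> 0 \<or> b0 \<noteq> 0" using w(2) w0 by (auto intro: eq_vecI)
    then obtain a b where ab: "a \<noteq> 0" "vec2 a b \<in> W" using w(1) w0 T by blast
    \<comment> \<open>Subtracting c' times the vector from its image under \<sigma> kills the second
      coordinate; the scalar normalises the first.\<close>
    have "1 / ((c - c') * a) \<cdot>\<^sub>v (vec2 (c * a) (c' * b) + (- c') \<cdot>\<^sub>v vec2 a b) \<in> W"
      using ab S WD(3,4) by blast
    moreover have "1 / ((c - c') * a) \<cdot>\<^sub>v (vec2 (c * a) (c' * b) + (- c') \<cdot>\<^sub>v vec2 a b) = vec2 1 0"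
      using ab(1) cc by (intro eq_vecI) (auto simp: field_simps)
    ultimately have e1: "vec2 1 0 \<in> W" by simp
    have "x \<in> W" if x2: "x \<in> carrier_vec 2" for x
    proof -
      obtain s t where x: "x = vec2 s t" using x2 by (rule carrier_vec2E)
      have "x = s \<cdot>\<^sub>v vec2 1 0 + t \<cdot>\<^sub>v vec2 0 1" unfolding x by (intro eq_vecI) auto
      then show ?thesis using e1 T[OF e1] WD(3,4) by metis
    qed
    then have "W = carrier_vec 2" using WD(1) by auto
    then show ?thesis ..
  qed simp
qed simp

text \<open>Scalars commute, so the dihedral relation makes the value at \<sigma> its own inverse;
  as its p-th power is 1 with p odd, it is 1. Only the sign at \<tau> remains free.\<close>

lemma one_dimensional_character:
  assumes rep: "complex_representation G 1 \<rho>"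
  shows "character G \<rho> = one_fn \<or> character G \<rho> = eps"
proof -
  note R = complex_representationD[OF is_group rep]
  define c where "c = (\<lambda>g. \<rho> g $$ (0, 0))"
  have mult: "c (g \<otimes> h) = c g * c h" if "g \<in> carrier G" "h \<in> carrier G" for g h
    using R(1)[OF that(1)] R(1)[OF that(2)] R(2)[OF that] by (simp add: c_def scalar_prod_def)
  have one: "c \<one> = 1" using R(3) by (simp add: c_def)
  have pow: "c (\<sigma> [^] j) = c \<sigma> ^ j" for j :: nat
    by (induction j) (simp_all add: one mult mult.commute)
  have t2: "c \<tau> * c \<tau> = 1" using mult[of \<tau> \<tau>] one tau_sq by simp
  have "c (inv \<sigma>) = c \<tau> * c \<sigma> * c \<tau>" using tau_sigma_tau by (metis mult m_closed tau_closed sigma_closed)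
  then have "c (inv \<sigma>) = c \<sigma>" using t2 by (simp add: mult_ac)
  moreover have "c \<sigma> * c (inv \<sigma>) = 1" using mult[of \<sigma> "inv \<sigma>"] one by simp
  ultimately have s2: "c \<sigma> ^ 2 = 1" by (simp add: power2_eq_square)
  obtain m where "p = 2 * m + 1" using odd_p by (rule oddE)
  then have "c \<sigma> ^ p = c \<sigma>" using s2 by (simp add: power_mult)
  then have s: "c \<sigma> = 1" using pow[of p] sigma_p one by simp
  have char: "character G \<rho> g = (if g \<in> carrier G then c g else 0)" for g
    using R(1)[of g] mat_trace_carrier[of "\<rho> g" 1 1] by (simp add: character_def c_def)
  have "c \<tau> = 1 \<or> c \<tau> = -1" using t2 by (metis square_eq_1_iff)
  then show ?thesis
  proof
    assume "c \<tau> = 1"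
    then have "character G \<rho> = one_fn" by (intro fun_eqI) (simp_all add: char pow s mult)
    then show ?thesis ..
  next
    assume "c \<tau> = -1"
    then have "character G \<rho> = eps" by (intro fun_eqI) (simp_all add: char pow s mult)
    then show ?thesis ..
  qed
qed

text \<open>An eigenvector v of \<sigma> and w = \<tau> v span an invariant subspace, hence
  everything, and \<open>P\<close> has columns v and w. These may be dependent, when d = 1, so only
  a right inverse of \<open>P\<close> can be claimed.\<close>

lemma irreducible_character_intertwiner:
  assumes irr: "irreducible_complex_representation G d \<rho>"
  obtains k P Q where "k > 0" "P \<in> carrier_mat d 2" "Q \<in> carrier_mat 2 d" "P * Q = 1\<^sub>m d"
    "\<And>g. g \<in> carrier G \<Longrightarrow> \<rho> g * P = P * rho k g"
proof -
  have rep: "complex_representation G d \<rho>" and d: "d > 0"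
    using irr by (auto simp: irreducible_complex_representation_def)
  note R = complex_representationD[OF is_group rep]
  define S where "S = \<rho> \<sigma>"
  define T where "T = \<rho> \<tau>"
  have S: "S \<in> carrier_mat d d" and T: "T \<in> carrier_mat d d" using R(1) by (auto simp: S_def T_def)
  have Spow: "\<rho> (\<sigma> [^] j) = S ^\<^sub>m j" for j :: nat
    using complex_representation_pow[OF is_group rep sigma_closed] by (simp add: S_def)
  have TS: "\<rho> (\<tau> \<otimes> \<sigma> [^] j) = T * S ^\<^sub>m j" for j :: nat
    using R(2)[of \<tau> "\<sigma> [^] j"] by (simp add: T_def Spow)
  obtain \<mu> v where ev: "eigenvector S v \<mu>"
    using spectrum_non_empty[OF S d] by (auto simp: spectrum_def eigenvalue_def)
  have v: "v \<in> carrier_vec d" "v \<noteq> 0\<^sub>v d" "S *\<^sub>v v = \<mu> \<cdot>\<^sub>v v"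
    using ev S by (auto simp: eigenvector_def)
  obtain i0 where i0: "i0 < d" "vec_index v i0 \<noteq> 0"
    using v by (metis carrier_vecD eq_vecI index_zero_vec)
  have "S ^\<^sub>m p = 1\<^sub>m d" using Spow[of p] R(3) sigma_p by simp
  then have "v = \<mu> ^ p \<cdot>\<^sub>v v" using eigenvector_pow[OF S ev, of p] v by simp
  then have "vec_index v i0 = \<mu> ^ p * vec_index v i0" using i0 v(1)
    by (metis carrier_vecD index_smult_vec(1))
  then have "\<mu> ^ p = 1" using i0 by simp
  then obtain k where k: "k > 0" "\<mu> = zeta ^ k" by (rule root_of_unity_eq_zeta_pow)
  define w where "w = T *\<^sub>v v"
  have w: "w \<in> carrier_vec d" using T v by (simp add: w_def)
  have "T * T = 1\<^sub>m d" using R(2)[of \<tau> \<tau>] R(3) tau_sq by (simp add: T_def)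
  then have Tw: "T *\<^sub>v w = v"
    using T v by (simp add: w_def assoc_mult_mat_vec[of T d d T d v, symmetric])
  have w0: "w \<noteq> 0\<^sub>v d"
  proof
    assume "w = 0\<^sub>v d"
    then have "v = 0\<^sub>v d" using Tw T by (auto intro!: eq_vecI)
    then show False using v by simp
  qed
  \<comment> \<open>Moving \<sigma> past \<tau> inverts it, so w belongs to the inverse
    eigenvalue.\<close>
  have "S * T = T * S ^\<^sub>m (p - 1)"
    using R(2)[of \<sigma> \<tau>] TS[of "p - 1"] sigma_tau by (simp add: S_def T_def)
  then have "S *\<^sub>v w = T *\<^sub>v (S ^\<^sub>m (p - 1) *\<^sub>v v)"
    using S T v by (metis w_def assoc_mult_mat_vec pow_carrier_mat)
  also have "\<dots> = \<mu> ^ (p - 1) \<cdot>\<^sub>v w"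
    using T v by (simp add: eigenvector_pow[OF S ev] w_def mult_mat_vec[of T d d])
  also have "\<mu> ^ (p - 1) = inverse zeta ^ k"
  proof -
    have "\<mu> ^ (p - 1) * \<mu> = 1" using \<open>\<mu> ^ p = 1\<close> p_pos by (metis Suc_pred' power_Suc2)
    then show ?thesis by (simp add: k power_inverse inverse_unique[symmetric] mult.commute inverse_eq_divide field_simps)
  qed
  finally have "eigenvector S w (inverse zeta ^ k)"
    using w w0 S by (simp add: eigenvector_def)
  note Sw = eigenvector_pow[OF S this]
  have Sv: "S ^\<^sub>m j *\<^sub>v v = zeta ^ (j * k) \<cdot>\<^sub>v v" for j
    using eigenvector_pow[OF S ev, of j] k by (simp add: power_mult[symmetric] mult.commute)
  have Sw: "S ^\<^sub>m j *\<^sub>v w = inverse zeta ^ (j * k) \<cdot>\<^sub>v w" for j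
    using Sw[of j] by (simp only: power_mult[symmetric] mult.commute[of j k])
  have TSv: "(T * S ^\<^sub>m j) *\<^sub>v v = zeta ^ (j * k) \<cdot>\<^sub>v w" for j
    using T S v Sv[of j] by (simp add: assoc_mult_mat_vec[of T d d _ d v] mult_mat_vec[of T d d] w_def)
  have TSw: "(T * S ^\<^sub>m j) *\<^sub>v w = inverse zeta ^ (j * k) \<cdot>\<^sub>v v" for j
    using T S w Sw[of j] Tw by (simp add: assoc_mult_mat_vec[of T d d _ d w] mult_mat_vec[of T d d])
  define W where "W = {a \<cdot>\<^sub>v v + b \<cdot>\<^sub>v w | a b. True}"
  have WI: "a \<cdot>\<^sub>v v + b \<cdot>\<^sub>v w \<in> W" for a b by (auto simp: W_def)
  have act: "A *\<^sub>v (a \<cdot>\<^sub>v v + b \<cdot>\<^sub>v w) = a \<cdot>\<^sub>v (A *\<^sub>v v) + b \<cdot>\<^sub>v (A *\<^sub>v w)"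
    if "A \<in> carrier_mat d d" for A a b
    using that v w by (simp add: mult_add_distrib_mat_vec[of A d d] mult_mat_vec[of A d d])
  have sub: "VectorSpace.subspace class_ring W (module_vec TYPE(complex) d)"
  proof (rule subspace_module_vecI)
    show "W \<subseteq> carrier_vec d" using v w by (auto simp: W_def)
    have "0\<^sub>v d = 0 \<cdot>\<^sub>v v + 0 \<cdot>\<^sub>v w" using v w by (intro eq_vecI) auto
    then show "0\<^sub>v d \<in> W" using WI by metis
    show "x + y \<in> W" if xy: "x \<in> W" "y \<in> W" for x y
    proof -
      obtain a b a' b' where "x = a \<cdot>\<^sub>v v + b \<cdot>\<^sub>v w" "y = a' \<cdot>\<^sub>v v + b' \<cdot>\<^sub>v w"
        using xy by (auto simp: W_def)
      then have "x + y = (a + a') \<cdot>\<^sub>v v + (b + b') \<cdot>\<^sub>v w"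
        using v w by (intro eq_vecI) (auto simp: algebra_simps)
      then show ?thesis using WI by simp
    qed
    show "c \<cdot>\<^sub>v x \<in> W" if xW: "x \<in> W" for c x
    proof -
      obtain a b where "x = a \<cdot>\<^sub>v v + b \<cdot>\<^sub>v w" using xW by (auto simp: W_def)
      then have "c \<cdot>\<^sub>v x = (c * a) \<cdot>\<^sub>v v + (c * b) \<cdot>\<^sub>v w"
        using v w by (intro eq_vecI) (auto simp: algebra_simps)
      then show ?thesis using WI by simp
    qed
  qed
  have "\<rho> g *\<^sub>v x \<in> W" if g: "g \<in> carrier G" and x: "x \<in> W" for g x
  proof -
    obtain a b where x: "x = a \<cdot>\<^sub>v v + b \<cdot>\<^sub>v w" using x by (auto simp: W_def)
    show ?thesis
      using g
    proof (rule carrier_cases)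
      fix j :: nat assume "g = \<sigma> [^] j"
      then have "\<rho> g *\<^sub>v x = (a * zeta ^ (j * k)) \<cdot>\<^sub>v v + (b * inverse zeta ^ (j * k)) \<cdot>\<^sub>v w"
        using S v w by (simp add: x Spow act Sv Sw smult_smult_assoc)
      then show ?thesis using WI by simp
    next
      fix j :: nat assume "g = \<tau> \<otimes> \<sigma> [^] j"
      then have "\<rho> g *\<^sub>v x = (b * inverse zeta ^ (j * k)) \<cdot>\<^sub>v v + (a * zeta ^ (j * k)) \<cdot>\<^sub>v w"
        using S T v w
        by (simp add: x TS act[of "T * S ^\<^sub>m j"] TSv TSw smult_smult_assoc comm_add_vec[of _ d])
      then show ?thesis using WI by simp
    qed
  qed
  moreover have "v = 1 \<cdot>\<^sub>v v + 0 \<cdot>\<^sub>v w" using v w by (intro eq_vecI) auto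
  then have "v \<in> W" using WI by metis
  ultimately have "W = carrier_vec d"
    using irr sub v(2) unfolding irreducible_complex_representation_def by blast
  \<comment> \<open>The coordinates of the unit vectors with respect to v and w become the columns
    of the right inverse \<open>Q\<close>.\<close>
  then have "\<forall>i<d. \<exists>a b. unit_vec d i = a \<cdot>\<^sub>v v + b \<cdot>\<^sub>v w"
    using unit_vec_carrier[where n = d] by (auto simp: W_def set_eq_iff)
  then obtain a b where ab: "\<And>i. i < d \<Longrightarrow> unit_vec d i = a i \<cdot>\<^sub>v v + b i \<cdot>\<^sub>v w" by metis
  define P where "P = mat d 2 (\<lambda>(i, j). vec_index (if j = 0 then v else w) i)"
  define Q where "Q = mat 2 d (\<lambda>(j, i). if j = 0 then a i else b i)"
  have P: "P \<in> carrier_mat d 2" and Q: "Q \<in> carrier_mat 2 d" by (simp_all add: P_def Q_def)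
  have PQ: "P * Q = 1\<^sub>m d"
  proof (rule eq_matI)
    fix i j assume "i < dim_row (1\<^sub>m d)" "j < dim_col (1\<^sub>m d)"
    then have ij: "i < d" "j < d" by auto
    have "(P * Q) $$ (i, j) = vec_index v i * a j + vec_index w i * b j"
      using ij by (simp add: P_def Q_def scalar_prod_def sum_upto_2)
    also have "\<dots> = vec_index (unit_vec d j) i"
      unfolding ab[OF ij(2)] using ij v w by (simp add: mult.commute)
    finally show "(P * Q) $$ (i, j) = 1\<^sub>m d $$ (i, j)" using ij by simp
  qed (use P Q in auto)
  have col0: "col P 0 = v" and col1: "col P (Suc 0) = w"
    using v w by (auto simp: P_def intro!: eq_vecI)
  have inter: "\<rho> g * P = P * mat2 m00 m01 m10 m11"
    if "g \<in> carrier G" "\<rho> g *\<^sub>v v = m00 \<cdot>\<^sub>v v + m10 \<cdot>\<^sub>v w" "\<rho> g *\<^sub>v w = m01 \<cdot>\<^sub>v v + m11 \<cdot>\<^sub>v w"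
    for g m00 m01 m10 m11
  proof (rule eq_matI)
    note Rg = R(1)[OF that(1)]
    fix i j assume "i < dim_row (P * mat2 m00 m01 m10 m11)" "j < dim_col (P * mat2 m00 m01 m10 m11)"
    then have i: "i < d" and j: "j < 2" using P by auto
    have "(\<rho> g * P) $$ (i, j) = vec_index (\<rho> g *\<^sub>v col P j) i"
      using i j Rg P by simp
    also have "\<dots> = (P * mat2 m00 m01 m10 m11) $$ (i, j)"
      using j i v w that(2,3) P
      by (auto dest!: less_2_cases simp: col0 col1 scalar_prod_def sum_upto_2)
        (auto simp: P_def)
    finally show "(\<rho> g * P) $$ (i, j) = (P * mat2 m00 m01 m10 m11) $$ (i, j)" .
  qed (use P R(1)[OF that(1)] in auto)
  have "\<rho> g * P = P * rho k g" if g: "g \<in> carrier G" for g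
    using g
  proof (rule carrier_cases)
    fix j :: nat assume j: "g = \<sigma> [^] j"
    show ?thesis unfolding j rho_sigma
      by (rule inter) (use k v w in \<open>auto simp: Spow Sv Sw zero_power intro!: eq_vecI\<close>)
  next
    fix j :: nat assume j: "g = \<tau> \<otimes> \<sigma> [^] j"
    show ?thesis unfolding j rho_tau_sigma
      by (rule inter) (use k v w in \<open>auto simp: TS TSv TSw zero_power intro!: eq_vecI\<close>)
  qed
  then show ?thesis using that k(1) P Q PQ by blast
qed

text \<open>Idempotency makes each off-diagonal entry a zero of multiplication by the trace minus 1.
  A trace other than 1 thus leaves a diagonal matrix with entries 0 or 1, and a non-zero trace then
  forces both to be 1.\<close>

lemma idempotent_mat2_trace:
  fixes E :: "complex mat"
  assumes "E \<in> carrier_mat 2 2" and "E * E = E" and tr: "mat_trace E = of_nat d" and "d > 0" "d \<noteq> 1"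
  shows "E = 1\<^sub>m 2"
proof -
  obtain a b c e where E: "E = mat2 a b c e" using assms(1) by (rule carrier_mat2E)
  have eqs: "a * a + b * c = a" "a * b + b * e = b" "c * a + e * c = c" "c * b + e * e = e"
    using assms(2) by (auto simp: E)
  have t: "a + e = of_nat d" using tr by (simp add: E)
  have t1: "a + e \<noteq> 1" using t \<open>d \<noteq> 1\<close> by (metis of_nat_1 of_nat_eq_iff)
  have t0: "a + e \<noteq> 0" using t \<open>d > 0\<close> by (metis of_nat_0 of_nat_eq_iff less_irrefl)
  have "b * (a + e - 1) = 0" "c * (a + e - 1) = 0" using eqs by (simp_all add: algebra_simps)
  then have bc: "b = 0" "c = 0" using t1 by auto
  then have "a = 0 \<or> a = 1" "e = 0 \<or> e = 1" using eqs by auto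
  then show ?thesis using t0 t1 bc by (auto simp: E one_mat2)
qed

text \<open>With \<open>P Q = 1\<close> the matrix \<open>Q P\<close> is idempotent of trace \<open>d\<close>, which forces \<open>d \<le> 2\<close>.\<close>

lemma irreducible_character_cases:
  assumes irr: "irreducible_complex_representation G d \<rho>"
  shows "character G \<rho> = one_fn \<or> character G \<rho> = eps \<or> (\<exists>k>0. character G \<rho> = chr k)"
proof -
  have rep: "complex_representation G d \<rho>" and d: "d > 0"
    using irr by (auto simp: irreducible_complex_representation_def)
  show ?thesis
  proof (cases "d = 1")
    case True
    then show ?thesis using one_dimensional_character rep by blast
  next
    case False
    obtain k P Q where k: "k > 0" and P: "P \<in> carrier_mat d 2" and Q: "Q \<in> carrier_mat 2 d"
      and PQ: "P * Q = 1\<^sub>m d" and int: "\<And>g. g \<in> carrier G \<Longrightarrow> \<rho> g * P = P * rho k g"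
      using irreducible_character_intertwiner[OF irr] by metis
    have QP: "Q * P \<in> carrier_mat 2 2" using P Q by simp
    have "Q * P * (Q * P) = Q * (P * Q) * P"
      using P Q by (simp add: assoc_mult_mat[of _ 2 d _ 2 _ 2] assoc_mult_mat[of _ 2 d _ d _ 2]
          assoc_mult_mat[of _ d 2 _ d _ 2])
    then have "Q * P * (Q * P) = Q * P" using P Q by (simp add: PQ)
    moreover have "mat_trace (Q * P) = of_nat d"
      using mat_trace_comm[OF P Q] by (simp add: PQ mat_trace_def)
    ultimately have "Q * P = 1\<^sub>m 2"
      using QP d False by (intro idempotent_mat2_trace)
    have "mat_trace (\<rho> g) = mat_trace (rho k g)" if g: "g \<in> carrier G" for g
    proof -
      have r: "\<rho> g \<in> carrier_mat d d" "rho k g \<in> carrier_mat 2 2"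
        using g complex_representationD(1)[OF is_group] rep rho_representation[OF k] by blast+
      \<comment> \<open>Inserting P Q = 1 and cycling the trace until Q P = 1 appears exchanges the
        two representations.\<close>
      have "mat_trace (\<rho> g) = mat_trace (\<rho> g * P * Q)"
        using r P Q by (simp add: assoc_mult_mat[of _ d d _ 2 _ d] PQ)
      also have "\<dots> = mat_trace (P * (rho k g * Q))"
        using r P Q by (simp add: int[OF g] assoc_mult_mat[of _ d 2 _ 2 _ d])
      also have "\<dots> = mat_trace (rho k g * Q * P)"
        by (rule mat_trace_comm[OF P]) (use r Q in auto)
      also have "\<dots> = mat_trace (rho k g)"
        using r P Q by (simp add: assoc_mult_mat[of _ 2 2 _ d _ 2] \<open>Q * P = 1\<^sub>m 2\<close>)
      finally show ?thesis .
    qed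
    then have "character G \<rho> = chr k"
      unfolding character_rho[OF k, symmetric] by (auto simp: character_def)
    then show ?thesis using k by blast
  qed
qed

end

section \<open>The filtration by monomials in X and Y\<close>

context dihedral_character begin

lemma chr_eq_one_plus_eps: "p dvd k \<Longrightarrow> chr k = one_fn + eps"
proof (rule fun_eqI)
  fix j :: nat assume "p dvd k"
  then have "zeta ^ (j * k) = 1" by (simp add: zeta_pow_eq_1_iff)
  then show "chr k (\<sigma> [^] j) = (one_fn + eps) (\<sigma> [^] j)" by (simp add: power_inverse)
qed simp_all

text \<open>A spanning set with repetitions: \<open>chr k\<close> depends only on k modulo p and is
  \<open>one_fn + eps\<close> for multiples of p. Allowing all indices avoids reductions modulo p in
  the product rule.\<close>

definition basis_fns :: "('a \<Rightarrow> complex) set" where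
  "basis_fns = {one_fn, eps} \<union> range chr"

lemma carrier_eq_zspan_basis: "carrier (virtual_character_ring G) = zspan basis_fns"
proof -
  have "irreducible_characters G \<subseteq> zspan basis_fns"
    unfolding irreducible_characters_def using irreducible_character_cases
    by (fastforce simp: basis_fns_def intro: zspan_base)
  moreover have one: "one_fn \<in> irreducible_characters G"
    unfolding irreducible_characters_def character_rho_one[symmetric]
    using irreducible_one_dimensional[OF rho_one_representation] by blast
  moreover have eps: "eps \<in> irreducible_characters G"
    unfolding irreducible_characters_def character_rho_eps[symmetric]
    using irreducible_one_dimensional[OF rho_eps_representation] by blast
  moreover have "chr k \<in> zspan (irreducible_characters G)" for k
  proof (cases "p dvd k")
    case True
    then show ?thesis using one eps by (auto simp: chr_eq_one_plus_eps intro: zspan_add zspan_base)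
  next
    case False
    then have "k > 0" by (auto intro: Nat.gr0I)
    then have "chr k \<in> irreducible_characters G"
      unfolding irreducible_characters_def character_rho[OF \<open>k > 0\<close>, symmetric]
      using rho_irreducible[OF _ False] by blast
    then show ?thesis by (rule zspan_base)
  qed
  ultimately show ?thesis
    unfolding carrier_virtual_character_ring
    by (intro equalityI zspan_least) (auto simp: basis_fns_def intro: zspan_base)
qed

lemma fn_mult [simp]:
  "one_fn * one_fn = one_fn" "one_fn * eps = eps" "eps * one_fn = eps" "eps * eps = one_fn"
  "one_fn * chr k = chr k" "chr k * one_fn = chr k" "eps * chr k = chr k" "chr k * eps = chr k"
  by (rule fun_eqI; simp)+

lemma inverse_zeta_pow_mult: "zeta ^ m * inverse zeta ^ m = 1" "inverse zeta ^ m * zeta ^ m = 1"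
  by (simp_all add: power_inverse)

text \<open>The mixed terms collapse because the two eigenvalues are inverse to each other; the
  order on the indices keeps \<open>k - l\<close> from being truncated.\<close>

lemma chr_mult:
  assumes "l \<le> k"
  shows "chr k * chr l = chr (k + l) + chr (k - l)"
proof (rule fun_eqI)
  fix j :: nat
  obtain m where k: "k = l + m" using assms le_Suc_ex by blast
  define u v where "u = zeta ^ j" and "v = inverse zeta ^ j"
  have uv: "u ^ l * v ^ l = 1" using inverse_zeta_pow_mult by (simp add: u_def v_def power_mult[symmetric])
  have "(u ^ l * u ^ m + v ^ l * v ^ m) * (u ^ l + v ^ l) =
    u ^ l * u ^ m * u ^ l + v ^ l * v ^ m * v ^ l + (u ^ l * v ^ l) * u ^ m + (u ^ l * v ^ l) * v ^ m"
    by (simp add: algebra_simps)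
  then have "(u ^ l * u ^ m + v ^ l * v ^ m) * (u ^ l + v ^ l) =
    u ^ l * u ^ m * u ^ l + v ^ l * v ^ m * v ^ l + u ^ m + v ^ m"
    by (simp add: uv)
  then show "(chr k * chr l) (\<sigma> [^] j) = (chr (k + l) + chr (k - l)) (\<sigma> [^] j)"
    by (simp add: power_mult u_def[symmetric] v_def[symmetric] k power_add add_ac)
qed simp_all

lemma carrier_mult_closed:
  assumes "x \<in> carrier (virtual_character_ring G)" "y \<in> carrier (virtual_character_ring G)"
  shows "x * y \<in> carrier (virtual_character_ring G)"
  using assms unfolding carrier_eq_zspan_basis
proof (rule zspan_mult)
  have chr: "chr k \<in> zspan basis_fns" and one: "one_fn \<in> zspan basis_fns" and eps: "eps \<in> zspan basis_fns" for k
    by (auto simp: basis_fns_def intro: zspan_base)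
  have "chr k * chr l \<in> zspan basis_fns" for k l
  proof (cases "l \<le> k")
    case False
    then have "chr k * chr l = chr (l + k) + chr (l - k)" using chr_mult[of k l] by (simp add: mult.commute)
    then show ?thesis by (simp add: chr zspan_add)
  qed (simp add: chr_mult chr zspan_add)
  then show "s * t \<in> zspan basis_fns" if "s \<in> basis_fns" "t \<in> basis_fns" for s t
    using that one eps chr unfolding basis_fns_def by (auto simp only: Un_iff insert_iff empty_iff fn_mult)
qed

lemma basis_in_carrier:
  "one_fn \<in> carrier (virtual_character_ring G)" "eps \<in> carrier (virtual_character_ring G)"
  "chr k \<in> carrier (virtual_character_ring G)"
  by (auto simp: carrier_eq_zspan_basis basis_fns_def intro: zspan_base)

lemma exterior_power_rho_one:
  "character G (\<lambda>g. exterior_power_mat n (rho_one g)) = (if n \<le> 1 then one_fn else 0)"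
proof -
  have c: "rho_one g \<in> carrier_mat 1 1" for g by (simp add: rho_one_def)
  have "mat_trace (rho_one g) = 1" for g by (simp add: rho_one_def mat_trace_def)
  then show ?thesis
    by (auto simp: fun_eq_iff character_def mat_trace_exterior_power_1[OF c] one_fn_def unit_function_def)
qed

lemma exterior_power_rho_eps:
  "character G (\<lambda>g. exterior_power_mat n (rho_eps g)) =
    (if n = 0 then one_fn else if n = 1 then eps else 0)"
proof -
  have c: "rho_eps g \<in> carrier_mat 1 1" for g by (simp add: rho_eps_def)
  have "mat_trace (rho_eps g) = det (\<chi> g)" for g by (simp add: rho_eps_def mat_trace_def)
  then show ?thesis
    by (auto simp: fun_eq_iff mat_trace_exterior_power_1[OF c] character_def one_fn_def unit_function_def eps_def)
qed

lemma exterior_power_rho: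
  assumes k: "k > 0"
  shows "character G (\<lambda>g. exterior_power_mat n (rho k g)) =
    (if n = 0 then one_fn else if n = 1 then chr k else if n = 2 then eps else 0)"
proof (rule fun_eqI)
  have tr: "mat_trace (exterior_power_mat n (rho k g)) =
    (if n = 0 then 1 else if n = 1 then mat_trace (rho k g) else if n = 2 then det (rho k g) else 0)"
    if "g \<in> carrier G" for g
    using complex_representationD(1)[OF is_group rho_representation[OF k] that]
    by (rule mat_trace_exterior_power_2)
  show "character G (\<lambda>g. exterior_power_mat n (rho k g)) (\<sigma> [^] j) =
    (if n = 0 then one_fn else if n = 1 then chr k else if n = 2 then eps else 0) (\<sigma> [^] j)" for j :: nat
    by (simp add: character_def tr) (auto simp: rho_sigma inverse_zeta_pow_mult zero_power[OF k])
  show "character G (\<lambda>g. exterior_power_mat n (rho k g)) (\<tau> \<otimes> \<sigma> [^] j) =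
    (if n = 0 then one_fn else if n = 1 then chr k else if n = 2 then eps else 0) (\<tau> \<otimes> \<sigma> [^] j)" for j :: nat
    by (simp add: character_def tr) (auto simp: rho_tau_sigma inverse_zeta_pow_mult zero_power[OF k])
qed (simp add: character_def)

text \<open>The classification enters here: every irreducible character is that of an explicit
  model, whose exterior powers are known.\<close>

lemma lambda_family: "is_lambda_family G (lambda_op G)"
proof -
  have zero: "0 \<in> carrier (virtual_character_ring G)"
    unfolding carrier_eq_zspan_basis by (rule zspan_zero)
  have "\<exists>l. is_lambda_family G l"
  proof (rule ex_lambda_family[OF is_group])
    show "unit_function G \<in> carrier (virtual_character_ring G)"
      using basis_in_carrier(1) by (simp add: one_fn_def)
    show "x * y \<in> carrier (virtual_character_ring G)"
      if "x \<in> carrier (virtual_character_ring G)" "y \<in> carrier (virtual_character_ring G)" for x y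
      using that by (rule carrier_mult_closed)
    fix d \<rho> n assume irr: "irreducible_complex_representation G d \<rho>"
    then have rep: "complex_representation G d \<rho>" by (simp add: irreducible_complex_representation_def)
    note cong = character_exterior_power_cong[OF is_group rep]
    from irreducible_character_cases[OF irr]
    show "character G (\<lambda>g. exterior_power_mat n (\<rho> g)) \<in> carrier (virtual_character_ring G)"
    proof (elim disjE exE conjE)
      assume "character G \<rho> = one_fn"
      then show ?thesis
        using cong[OF rho_one_representation] basis_in_carrier zero
        by (simp add: character_rho_one exterior_power_rho_one)
    next
      assume "character G \<rho> = eps"
      then show ?thesis
        using cong[OF rho_eps_representation] basis_in_carrier zero
        by (simp add: character_rho_eps exterior_power_rho_eps)
    next
      fix k assume "k > 0" "character G \<rho> = chr k"
      then show ?thesis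
        using cong[OF rho_representation] basis_in_carrier zero
        by (simp add: character_rho exterior_power_rho)
    qed
  qed
  then show ?thesis unfolding lambda_op_def by (rule someI_ex)
qed

section \<open>The functions X and Y and the Chebyshev recursion\<close>

definition X :: "'a \<Rightarrow> complex" where "X = eps - one_fn"

definition Yk :: "nat \<Rightarrow> 'a \<Rightarrow> complex" where "Yk k = one_fn + eps - chr k"

definition Y :: "'a \<Rightarrow> complex" where "Y = Yk 1"

lemma X_Y_mult [simp]:
  "one_fn * X = X" "X * one_fn = X" "one_fn * Yk k = Yk k" "Yk k * one_fn = Yk k"
  "one_fn * Y = Y" "Y * one_fn = Y"
  "X * Yk k = 0" "Yk k * X = 0" "X * Y = 0" "Y * X = 0" "X * X = - (2 * X)"
  by (simp_all add: X_def Y_def Yk_def algebra_simps)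

lemma X_Y_values [simp]:
  fixes j :: nat
  shows "X (\<sigma> [^] j) = 0" "X (\<tau> \<otimes> \<sigma> [^] j) = -2"
    "Yk k (\<sigma> [^] j) = 2 - zeta ^ (j * k) - inverse zeta ^ (j * k)" "Yk k (\<tau> \<otimes> \<sigma> [^] j) = 0"
    "Y (\<sigma> [^] j) = 2 - zeta ^ j - inverse zeta ^ j" "Y (\<tau> \<otimes> \<sigma> [^] j) = 0"
    "g \<notin> carrier G \<Longrightarrow> X g = 0" "g \<notin> carrier G \<Longrightarrow> Yk k g = 0" "g \<notin> carrier G \<Longrightarrow> Y g = 0"
  by (simp_all add: X_def Y_def Yk_def)

lemma Yk_0: "Yk 0 = 0"
  by (rule fun_eqI) simp_all

lemma Yk_rec: "Yk (Suc (Suc k)) = 2 * Yk (Suc k) + 2 * Y - Y * Yk (Suc k) - Yk k"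
proof -
  have chr: "chr (Suc (Suc k)) = chr (Suc k) * chr 1 - chr k" by (simp add: chr_mult)
  have eq: "Y * Yk (Suc k) = 2 * one_fn + 2 * eps - 2 * chr 1 - 2 * chr (Suc k) + chr (Suc k) * chr 1"
    by (simp add: Y_def Yk_def algebra_simps)
  show ?thesis unfolding eq unfolding Y_def Yk_def chr by (simp add: algebra_simps)
qed

text \<open>The part of the filtration free of X. It is used for positive \<open>m\<close>, where
  its elements vanish on reflections and the constant 1, which is not supported on the carrier, does
  not occur.\<close>

definition Ypows :: "nat \<Rightarrow> ('a \<Rightarrow> complex) set" where
  "Ypows m = zspan {Y ^ j | j. j \<ge> m}"

lemma Ypows_antimono: "m \<le> n \<Longrightarrow> Ypows n \<subseteq> Ypows m"
  unfolding Ypows_def by (rule zspan_mono) auto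

lemma Ypows_power: "m \<le> j \<Longrightarrow> Y ^ j \<in> Ypows m"
  unfolding Ypows_def by (rule zspan_base) auto

lemma Ypows_mult:
  assumes "x \<in> Ypows m" shows "Y * x \<in> Ypows (Suc m)"
proof -
  have "Y \<in> zspan {Y}" by (rule zspan_base) simp
  then show ?thesis
    using assms unfolding Ypows_def
  proof (rule zspan_mult)
    fix s t assume "s \<in> {Y}" "t \<in> {Y ^ j | j. m \<le> j}"
    then obtain j where "s = Y" "t = Y ^ j" "m \<le> j" by auto
    then have "s * t = Y ^ Suc j" "Suc m \<le> Suc j" by auto
    then show "s * t \<in> zspan {Y ^ j | j. Suc m \<le> j}" by (intro zspan_base) blast
  qed
qed

text \<open>Modulo Y^2 the recursion for the coefficient of Y reads a(k+2) = 2 a(k+1) - a(k) + 2;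
  starting from 0 and 1 it has the solution k^2.\<close>

lemma Yk_mod_Ypows: "Yk k - of_nat (k ^ 2) * Y \<in> Ypows 2"
proof (induction k rule: induct_nat_012)
  case 0
  have "Yk 0 - of_nat (0 ^ 2) * Y = 0" by (simp add: Yk_0)
  then show ?case by (simp only: Ypows_def zspan_zero)
next
  case 1
  have "Yk (Suc 0) - of_nat ((Suc 0) ^ 2) * Y = 0" by (simp add: Y_def)
  then show ?case by (simp only: Ypows_def zspan_zero)
next
  case (ge2 k)
  define A where "A = Yk k - of_nat (k ^ 2) * Y"
  define B where "B = Yk (Suc k) - of_nat (Suc k ^ 2) * Y"
  have eq: "Yk (Suc (Suc k)) - of_nat (Suc (Suc k) ^ 2) * Y =
      2 * B - Y * B - of_nat (Suc k ^ 2) * Y ^ 2 - A"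
    unfolding Yk_rec A_def B_def by (simp add: algebra_simps power2_eq_square)
  have A: "A \<in> Ypows 2" and B: "B \<in> Ypows 2"
    unfolding A_def B_def by (rule ge2)+
  have "Y * B \<in> Ypows 2" using Ypows_mult[OF B] Ypows_antimono[of 2 "Suc 2"] by auto
  then show "Yk (Suc (Suc k)) - of_nat (Suc (Suc k) ^ 2) * Y \<in> Ypows 2"
    unfolding eq using A B Ypows_power[of 2 2] unfolding Ypows_def
    by (intro zspan_diff zspan_numeral_mult zspan_of_nat_mult) auto
qed

text \<open>With \<open>p = 2 m + 1\<close> one has \<open>\<chi>\<^sub>m = \<chi>\<^sub>m\<^sub>+\<^sub>1\<close>, and \<open>(m + 1)\<^sup>2 - m\<^sup>2 = p\<close>.\<close>

lemma p_Y_in_Ypows: "of_nat p * Y \<in> Ypows 2"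
proof -
  obtain m where p: "p = 2 * m + 1" using odd_p by (rule oddE)
  have "chr (Suc m) = chr m"
  proof (rule fun_eqI)
    fix j :: nat
    have "j * Suc m + j * m = p * j" by (simp add: p algebra_simps)
    then have "zeta ^ (j * Suc m) * zeta ^ (j * m) = (zeta ^ p) ^ j"
      by (simp only: power_add[symmetric] power_mult[symmetric])
    then have "zeta ^ (j * Suc m) * zeta ^ (j * m) = 1" by simp
    then have "inverse (zeta ^ (j * Suc m)) = zeta ^ (j * m)" "inverse (zeta ^ (j * m)) = zeta ^ (j * Suc m)"
      by (auto intro!: inverse_unique simp: mult.commute)
    then show "chr (Suc m) (\<sigma> [^] j) = chr m (\<sigma> [^] j)"
      by (simp only: function_values power_inverse add.commute)
  qed simp_all
  then have eq: "Yk (Suc m) = Yk m" by (simp add: Yk_def)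
  have "Suc m ^ 2 = m ^ 2 + p" by (subst p) (simp add: power2_eq_square)
  then have n: "of_nat (Suc m ^ 2) * Y = of_nat (m ^ 2) * Y + of_nat p * Y"
    by (simp only: of_nat_add distrib_right)
  have "of_nat p * Y = (Yk m - of_nat (m ^ 2) * Y) - (Yk (Suc m) - of_nat (Suc m ^ 2) * Y)"
    unfolding eq n by (rule fun_eqI) simp_all
  then show ?thesis
    using zspan_diff[OF Yk_mod_Ypows[of m, unfolded Ypows_def] Yk_mod_Ypows[of "Suc m", unfolded Ypows_def]]
    by (simp only: Ypows_def)
qed

text \<open>The weight filtration, with X of weight 1 and Y of weight 2. The factor
  \<open>one_fn\<close> takes effect only at i = j = 0, where it turns the type-class 1 into the
  unit of the character ring.\<close>

definition F :: "nat \<Rightarrow> ('a \<Rightarrow> complex) set" where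
  "F n = zspan {X ^ i * Y ^ j * one_fn | i j. i + 2 * j \<ge> n}"

lemma F_monomial: "n \<le> i + 2 * j \<Longrightarrow> X ^ i * Y ^ j * one_fn \<in> F n"
  unfolding F_def by (rule zspan_base) auto

lemma F_antimono: "m \<le> n \<Longrightarrow> F n \<subseteq> F m"
  unfolding F_def
proof (rule zspan_mono, rule subsetI)
  fix s assume "m \<le> n" "s \<in> {X ^ i * Y ^ j * one_fn | i j. i + 2 * j \<ge> n}"
  then obtain i j where "s = X ^ i * Y ^ j * one_fn" "i + 2 * j \<ge> m" by fastforce
  then show "s \<in> {X ^ i * Y ^ j * one_fn | i j. i + 2 * j \<ge> m}" by blast
qed

lemma F_mult: "x \<in> F m \<Longrightarrow> y \<in> F n \<Longrightarrow> x * y \<in> F (m + n)"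
  unfolding F_def
proof (erule (1) zspan_mult)
  fix s t assume "s \<in> {X ^ i * Y ^ j * one_fn | i j. i + 2 * j \<ge> m}" "t \<in> {X ^ i * Y ^ j * one_fn | i j. i + 2 * j \<ge> n}"
  then obtain i j i' j' where *: "s = X ^ i * Y ^ j * one_fn" "t = X ^ i' * Y ^ j' * one_fn"
    "i + 2 * j \<ge> m" "i' + 2 * j' \<ge> n" by auto
  have "s * t = X ^ (i + i') * Y ^ (j + j') * (one_fn * one_fn)"
    unfolding * power_add by (simp only: mult_ac)
  then have "s * t = X ^ (i + i') * Y ^ (j + j') * one_fn" by simp
  moreover have "m + n \<le> (i + i') + 2 * (j + j')" using * by simp
  ultimately show "s * t \<in> zspan {X ^ i * Y ^ j * one_fn | i j. i + 2 * j \<ge> m + n}"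
    by (intro zspan_base) blast
qed

lemma F_zero: "0 \<in> F n" and F_add: "x \<in> F n \<Longrightarrow> y \<in> F n \<Longrightarrow> x + y \<in> F n"
  and F_diff: "x \<in> F n \<Longrightarrow> y \<in> F n \<Longrightarrow> x - y \<in> F n" and F_uminus: "x \<in> F n \<Longrightarrow> - x \<in> F n"
  and F_of_int: "x \<in> F n \<Longrightarrow> of_int c * x \<in> F n"
  and F_of_nat: "x \<in> F n \<Longrightarrow> of_nat b * x \<in> F n"
  and F_sum: "(\<And>i. i \<in> I \<Longrightarrow> f i \<in> F n) \<Longrightarrow> sum f I \<in> F n"
  unfolding F_def
  by (auto intro: zspan_zero zspan_add zspan_diff zspan_uminus zspan_of_int_mult zspan_of_nat_mult zspan_sum)

lemma one_fn_F: "one_fn \<in> F 0" using F_monomial[of 0 0 0] by simp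

lemma X_F: "X \<in> F 1" using F_monomial[of 1 1 0] by simp

lemma Y_pow_one_fn: "j > 0 \<Longrightarrow> Y ^ j * one_fn = Y ^ j"
  by (cases j) (simp_all add: power_Suc2 mult.assoc del: power_Suc)

lemma Ypows_F: "m > 0 \<Longrightarrow> Ypows m \<subseteq> F (2 * m)"
  unfolding Ypows_def F_def
proof (rule zspan_mono)
  assume m: "m > 0"
  show "{Y ^ j |j. m \<le> j} \<subseteq> {X ^ i * Y ^ j * one_fn |i j. 2 * m \<le> i + 2 * j}"
  proof
    fix s assume "s \<in> {Y ^ j |j. m \<le> j}"
    then obtain j where "s = Y ^ j" "m \<le> j" by auto
    then have "s = X ^ 0 * Y ^ j * one_fn" "2 * m \<le> 0 + 2 * j" using Y_pow_one_fn[of j] m by simp_all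
    then show "s \<in> {X ^ i * Y ^ j * one_fn |i j. 2 * m \<le> i + 2 * j}" by blast
  qed
qed

lemma Yk_F: "Yk k \<in> F 2"
proof -
  have "Yk k = (Yk k - of_nat (k ^ 2) * Y) + of_nat (k ^ 2) * Y" by simp
  moreover have "Yk k - of_nat (k ^ 2) * Y \<in> F 2"
    using Yk_mod_Ypows Ypows_F[of 2] F_antimono[of 2 4] by auto
  moreover have "Y \<in> F 2" using Ypows_F[of 1] Ypows_power[of 1 1] by auto
  ultimately show ?thesis by (metis F_add F_of_nat)
qed

lemma carrier_eq_F0: "carrier (virtual_character_ring G) = F 0"
proof
  have eps: "eps = X + one_fn" by (simp add: X_def)
  have chr: "chr k = one_fn + eps - Yk k" for k by (simp add: Yk_def)
  have "eps \<in> F 0" unfolding eps using X_F one_fn_F F_antimono[of 0 1] by (auto intro: F_add)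
  moreover from this have "chr k \<in> F 0" for k
    unfolding chr using Yk_F one_fn_F F_antimono[of 0 2] by (auto intro!: F_add F_diff)
  ultimately have "basis_fns \<subseteq> F 0" using one_fn_F by (auto simp: basis_fns_def)
  then show "carrier (virtual_character_ring G) \<subseteq> F 0"
    unfolding carrier_eq_zspan_basis F_def by (rule zspan_least)
next
  let ?R = "carrier (virtual_character_ring G)"
  have X: "X \<in> ?R" and Y: "Y \<in> ?R"
    using basis_in_carrier unfolding carrier_eq_zspan_basis X_def Y_def Yk_def
    by (auto intro!: zspan_diff zspan_add)
  have Ypow: "Y ^ j * one_fn \<in> ?R" for j
  proof (induction j)
    case (Suc j)
    from carrier_mult_closed[OF Y this] show ?case by (simp only: power_Suc mult.assoc)
  qed (use basis_in_carrier in simp)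
  have "X ^ i * Y ^ j * one_fn \<in> ?R" for i j
  proof (induction i)
    case (Suc i)
    from carrier_mult_closed[OF X this] show ?case by (simp only: power_Suc mult.assoc)
  next
    case 0
    show "X ^ 0 * Y ^ j * one_fn \<in> ?R" using Ypow by simp
  qed
  then have "{X ^ i * Y ^ j * one_fn | i j. i + 2 * j \<ge> 0} \<subseteq> zspan basis_fns"
    by (auto simp: carrier_eq_zspan_basis)
  then show "F 0 \<subseteq> ?R"
    unfolding carrier_eq_zspan_basis F_def by (rule zspan_least)
qed

section \<open>Detecting coefficients by evaluation\<close>

lemma power_fun_apply: "(f ^ n) x = f x ^ n" for f :: "'a \<Rightarrow> complex"
  by (induction n) simp_all

text \<open>Y vanishes at \<tau> and X equals -2 there, so only powers X^i with i at least n
  contribute.\<close>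

lemma F_at_tau:
  assumes "f \<in> F n" shows "\<exists>c::int. f \<tau> = of_int (2 ^ n * c)"
  using assms unfolding F_def
proof induction
  case (zspan_base s)
  then obtain i j where s: "s = X ^ i * Y ^ j * one_fn" "i + 2 * j \<ge> n" by auto
  have val: "X \<tau> = -2" "Y \<tau> = 0" "one_fn \<tau> = 1"
    using X_Y_values(2)[of 0] X_Y_values(6)[of 0] function_values(2)[of 0] by auto
  show ?case
  proof (cases "j = 0")
    case True
    have "(2::int) ^ n dvd 2 ^ i" using True s(2) by (intro le_imp_power_dvd) simp
    then have "2 ^ n dvd (-2 :: int) ^ i" by (simp add: power_minus[of 2])
    then obtain c where c: "(-2 :: int) ^ i = 2 ^ n * c" by (rule dvdE)
    have "s \<tau> = of_int ((-2) ^ i)" using True s(1) val by (simp add: power_fun_apply)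
    then show ?thesis unfolding c by blast
  next
    case False
    then show ?thesis using s val by (intro exI[of _ 0]) (simp add: power_fun_apply)
  qed
next
  case (zspan_diff x y)
  then obtain a b :: int where "x \<tau> = of_int (2 ^ n * a)" "y \<tau> = of_int (2 ^ n * b)" by auto
  then have "(x - y) \<tau> = of_int (2 ^ n * (a - b))" by (simp add: algebra_simps)
  then show ?case by blast
qed (auto intro: exI[of _ 0])

text \<open>X vanishes on rotations, which leaves the powers Y^l with 2 l at least n, that is, l at
  least n / 2 rounded up.\<close>

lemma F_at_rotations:
  assumes "f \<in> F n" and "n > 0"
  shows "\<exists>h\<in>Ypows ((n + 1) div 2). \<forall>j::nat. f (\<sigma> [^] j) = h (\<sigma> [^] j)"
  using assms(1) unfolding F_def
proof induction
  case zspan_zero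
  then show ?case by (intro bexI[of _ 0]) (auto simp: Ypows_def intro: zspan.zspan_zero)
next
  case (zspan_base s)
  then obtain i l where s: "s = X ^ i * Y ^ l * one_fn" "i + 2 * l \<ge> n" by auto
  show ?case
  proof (cases "i = 0")
    case True
    then have l: "l \<ge> (n + 1) div 2" using s by simp
    show ?thesis using True s
      by (intro bexI[OF _ Ypows_power[OF l]]) (simp add: power_fun_apply)
  next
    case False
    then show ?thesis using s
      by (intro bexI[of _ 0]) (auto simp: Ypows_def power_fun_apply intro: zspan.zspan_zero)
  qed
next
  case (zspan_diff x y)
  then obtain h k where "h \<in> Ypows ((n + 1) div 2)" "k \<in> Ypows ((n + 1) div 2)"
    "\<forall>j::nat. x (\<sigma> [^] j) = h (\<sigma> [^] j)" "\<forall>j::nat. y (\<sigma> [^] j) = k (\<sigma> [^] j)" by blast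
  then show ?case
    by (intro bexI[of _ "h - k"]) (auto simp: Ypows_def intro: zspan.zspan_diff)
qed

lemma Ypows_factor:
  assumes "f \<in> Ypows (r + 1)" shows "\<exists>h\<in>Ypows 1. f = Y ^ r * h"
  using assms unfolding Ypows_def
proof induction
  case zspan_zero
  then show ?case by (intro bexI[of _ 0]) (auto intro: zspan.zspan_zero)
next
  case (zspan_base s)
  then obtain j where "s = Y ^ j" "j \<ge> r + 1" by auto
  then show ?case
    by (intro bexI[of _ "Y ^ (j - r)"] zspan.zspan_base)
      (auto simp: power_add[symmetric] intro!: exI[of _ "j - r"])
next
  case (zspan_diff x y)
  then obtain h k where "h \<in> zspan {Y ^ j |j. 1 \<le> j}" "k \<in> zspan {Y ^ j |j. 1 \<le> j}"
    "x = Y ^ r * h" "y = Y ^ r * k" by blast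
  then show ?case
    by (intro bexI[of _ "h - k"]) (auto simp: right_diff_distrib intro: zspan.zspan_diff)
qed

lemma sum_zeta_pow: "(\<Sum>j<p. x ^ j) = (if x = 1 then of_nat p else 0)" if "x ^ p = 1" for x :: complex
  using that by (simp add: geometric_sum)

text \<open>The sum over the rotations is \<open>p\<close> times a multiplicity.\<close>

lemma sum_rotations:
  assumes "f \<in> carrier (virtual_character_ring G)"
  shows "\<exists>c::int. (\<Sum>j<p. f (\<sigma> [^] j)) = of_int (int p * c)"
  using assms unfolding carrier_eq_zspan_basis
proof induction
  case (zspan_base s)
  have "\<exists>c::int. (\<Sum>j<p. chr k (\<sigma> [^] j)) = of_int (int p * c)" for k
  proof -
    have "(\<Sum>j<p. chr k (\<sigma> [^] j)) = (\<Sum>j<p. (zeta ^ k) ^ j) + (\<Sum>j<p. (inverse zeta ^ k) ^ j)"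
      by (simp add: sum.distrib power_mult[symmetric] mult.commute)
    also have "(zeta ^ k) ^ p = 1" "(inverse zeta ^ k) ^ p = 1"
      by (simp_all add: power_mult[symmetric] power_inverse) (simp_all add: power_mult mult.commute[of k])
    then have "(\<Sum>j<p. (zeta ^ k) ^ j) + (\<Sum>j<p. (inverse zeta ^ k) ^ j) =
        (if zeta ^ k = 1 then of_nat p else 0) + (if inverse zeta ^ k = 1 then of_nat p else 0)"
      by (simp only: sum_zeta_pow)
    also have "\<dots> = of_int (int p * ((if zeta ^ k = 1 then 1 else 0) + (if inverse zeta ^ k = 1 then 1 else 0)))"
      by simp
    finally show ?thesis by blast
  qed
  then show "\<exists>c::int. (\<Sum>j<p. s (\<sigma> [^] j)) = of_int (int p * c)"
    using zspan_base by (auto simp: basis_fns_def intro: exI[of _ 1])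
next
  case (zspan_diff x y)
  then obtain a b where "(\<Sum>j<p. x (\<sigma> [^] j)) = of_int (int p * a)" "(\<Sum>j<p. y (\<sigma> [^] j)) = of_int (int p * b)"
    by blast
  then have "(\<Sum>j<p. (x - y) (\<sigma> [^] j)) = of_int (int p * (a - b))"
    by (simp add: sum_subtractf algebra_simps)
  then show ?case by blast
qed (auto intro: exI[of _ 0])

lemma Y_rotation_neq_0: "0 < j \<Longrightarrow> j < p \<Longrightarrow> Y (\<sigma> [^] j) \<noteq> 0"
proof
  assume j: "0 < j" "j < p" and 0: "Y (\<sigma> [^] j) = 0"
  define u where "u = zeta ^ j"
  have u: "u \<noteq> 1" using j zeta_pow_eq_1_iff[of j] by (auto simp: u_def dest: dvd_imp_le)
  have u0: "u \<noteq> 0" by (simp add: u_def)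
  have "2 - u - inverse u = 0" using 0 by (simp add: u_def power_inverse)
  then have "(u - 1) * (u - 1) = 0" using u0 by (simp add: field_simps)
  then show False using u by simp
qed

text \<open>Elements of weight n + 1 are divisible by 2^(n+1) at \<tau>, while X^n contributes only
  the factor (-2)^n.\<close>

lemma even_X_coefficient:
  assumes "f \<in> F (Suc n)" and "f \<tau> = of_int a * (-2) ^ n"
  shows "even a"
proof -
  obtain c where "f \<tau> = of_int (2 ^ Suc n * c)" using F_at_tau[OF assms(1)] by blast
  then have "(of_int (a * (-2) ^ n) :: complex) = of_int (2 ^ Suc n * c)" using assms(2) by simp
  then have "a * (-2) ^ n = 2 ^ Suc n * c" by (simp only: of_int_eq_iff)
  then have "2 ^ n * (a * (-1) ^ n) = 2 ^ n * (2 * c)" by (simp add: power_minus[of 2] mult_ac)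
  then have "a * (-1) ^ n = 2 * c" by (simp only: mult_cancel_left) simp
  then show ?thesis by (metis dvd_triv_left even_mult_iff even_minus even_power odd_one)
qed

lemma p_dvd_Y_coefficient:
  assumes f: "f \<in> F (Suc (2 * r))" and val: "\<And>j::nat. f (\<sigma> [^] j) = of_int b * Y (\<sigma> [^] j) ^ r"
  shows "int p dvd b"
proof -
  \<comment> \<open>Weight 2 r + 1 rounds up to the exponent r + 1, so a factor Y survives division
    by Y^r and the quotient \<open>k\<close> vanishes at the identity.\<close>
  obtain h where h: "h \<in> Ypows (r + 1)" "\<And>j::nat. f (\<sigma> [^] j) = h (\<sigma> [^] j)"
    using F_at_rotations[OF f] by auto
  obtain k where k: "k \<in> Ypows 1" "h = Y ^ r * k" using Ypows_factor[OF h(1)] by blast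
  have kR: "k \<in> carrier (virtual_character_ring G)"
    using k(1) Ypows_F[of 1] F_antimono[of 0 2] by (auto simp: carrier_eq_F0)
  have "k (\<sigma> [^] (0::nat)) = 0"
    using k(1) unfolding Ypows_def
    by induction (auto simp: power_fun_apply X_Y_values(5)[of 0, simplified])
  \<comment> \<open>Y has no zero among the other rotations, so Y^r can be cancelled there.\<close>
  moreover have "k (\<sigma> [^] j) = of_int b" if "0 < j" "j < p" for j
    using h(2)[of j] val[of j] Y_rotation_neq_0[OF that] k(2) by (simp add: power_fun_apply del: X_Y_values)
  ultimately have "(\<Sum>j<p. k (\<sigma> [^] j)) = (\<Sum>j<p. if j = 0 then 0 else of_int b)"
    by (intro sum.cong) auto
  also have "\<dots> = (\<Sum>j\<in>{..<p} - {0}. of_int b)"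
    by (rule sum.mono_neutral_cong_right) auto
  also have "\<dots> = of_int (int (p - 1) * b)"
    using p_pos by (simp add: card_Diff_singleton)
  finally obtain c where "(of_int (int (p - 1) * b) :: complex) = of_int (int p * c)"
    using sum_rotations[OF kR] by auto
  then have "int (p - 1) * b = int p * c" by (simp only: of_int_eq_iff)
  then have "b = int p * (b - c)" using p_pos by (simp add: algebra_simps of_nat_diff)
  then show ?thesis by (metis dvd_triv_left)
qed

lemma F1_at_one: "f \<in> F 1 \<Longrightarrow> f \<one> = 0"
  unfolding F_def
proof (induction rule: zspan.induct)
  case (zspan_base s)
  have "X \<one> = 0" "Y \<one> = 0" using X_Y_values(1)[of 0] X_Y_values(5)[of 0] by auto
  then show ?case using zspan_base by (auto simp: power_fun_apply)
qed auto

end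

section \<open>The gamma operations\<close>

text \<open>Without constant term, b^i starts in degree i or later, so every inner sum extends to
  the common range up to n before the sums are swapped.\<close>

lemma fps_compose_mult_nth:
  fixes a b v :: "'b::comm_ring_1 fps"
  assumes b0: "b $ 0 = 0"
  shows "((a oo b) * v) $ n = (\<Sum>i\<le>n. a $ i * (b ^ i * v) $ n)"
proof -
  have "((a oo b) * v) $ n = (\<Sum>k\<le>n. \<Sum>i\<le>n. a $ i * (b ^ i) $ k * v $ (n - k))"
    unfolding fps_mult_nth atLeast0AtMost
  proof (rule sum.cong[OF refl])
    fix k assume k: "k \<in> {..n}"
    have "(a oo b) $ k = (\<Sum>i\<le>n. a $ i * (b ^ i) $ k)"
      unfolding fps_compose_nth
      by (rule sum.mono_neutral_left) (use k startsby_zero_power_prefix[OF b0] in auto)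
    then show "(a oo b) $ k * v $ (n - k) = (\<Sum>i\<le>n. a $ i * (b ^ i) $ k * v $ (n - k))"
      by (simp add: sum_distrib_right)
  qed
  also have "\<dots> = (\<Sum>i\<le>n. \<Sum>k\<le>n. a $ i * (b ^ i) $ k * v $ (n - k))" by (rule sum.swap)
  also have "\<dots> = (\<Sum>i\<le>n. a $ i * (b ^ i * v) $ n)"
    by (simp add: fps_mult_nth atLeast0AtMost sum_distrib_left mult.assoc)
  finally show ?thesis .
qed

definition fps_u :: "complex fps" where "fps_u = fps_X * inverse (1 + fps_X)"

lemma fps_u_0 [simp]: "fps_u $ 0 = 0" by (simp add: fps_u_def)

lemma one_plus_X_neq_0 [simp]: "1 + fps_X \<noteq> (0 :: complex fps)"
proof
  assume "1 + fps_X = (0 :: complex fps)"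
  then have "(1 + fps_X :: complex fps) $ 0 = 0" by simp
  then show False by simp
qed

lemma inverse_one_plus_X_mult: "inverse (1 + fps_X) * (1 + fps_X) = (1 :: complex fps)"
  by (rule inverse_mult_eq_1) simp

lemma fps_u_mult: "fps_u * (1 + fps_X) = fps_X"
  by (simp add: fps_u_def mult.assoc inverse_one_plus_X_mult)

text \<open>This is why \<open>\<gamma>\<^sup>n\<close> is built from \<open>x + n - 1\<close>: it reads off the coefficients of \<open>\<lambda>\<^sub>t(x)\<close>
  with respect to powers of \<open>t / (1 + t)\<close>.\<close>

lemma fps_compose_u_nth:
  assumes "n > 0"
  shows "((W oo fps_u) * (1 + fps_X) ^ (n - 1)) $ n = W $ n"
proof -
  have "(fps_u ^ i * (1 + fps_X) ^ (n - 1)) $ n = (if i = n then 1 else 0)" if "i \<le> n" for i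
  proof (cases "i = n")
    case True
    have "fps_u ^ n * (1 + fps_X) ^ (n - 1) = fps_u * (fps_u * (1 + fps_X)) ^ (n - 1)"
      using assms by (cases n) (simp_all add: power_mult_distrib mult_ac)
    also have "\<dots> = fps_u * fps_X ^ (n - 1)" by (simp only: fps_u_mult)
    also have "\<dots> = fps_X ^ n * inverse (1 + fps_X)"
      using assms by (cases n) (simp_all add: fps_u_def mult_ac)
    finally show ?thesis using True by (simp add: fps_X_power_mult_nth)
  next
    case False
    \<comment> \<open>For i < n the product is t^i (1 + t)^(n-1-i), of degree n - 1, and has no term
      in t^n.\<close>
    then have "n - 1 = i + (n - 1 - i)" using that by simp
    then have "(1 + fps_X :: complex fps) ^ (n - 1) = (1 + fps_X) ^ i * (1 + fps_X) ^ (n - 1 - i)"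
      by (metis power_add)
    then have "fps_u ^ i * (1 + fps_X) ^ (n - 1) = (fps_u * (1 + fps_X)) ^ i * (1 + fps_X) ^ (n - 1 - i)"
      by (simp add: power_mult_distrib mult.assoc)
    also have "\<dots> = fps_X ^ i * fps_of_poly ([:1, 1:] ^ (n - 1 - i))"
      by (simp add: fps_u_mult fps_of_poly_power fps_of_poly_linear')
    finally have "(fps_u ^ i * (1 + fps_X) ^ (n - 1)) $ n = coeff ([:1, 1 :: complex:] ^ (n - 1 - i)) (n - i)"
      using that by (simp add: fps_X_power_mult_nth)
    also have "\<dots> = 0"
      by (rule coeff_eq_0) (use False that in \<open>simp add: degree_linear_power\<close>)
    finally show ?thesis using False by simp
  qed
  then have "((W oo fps_u) * (1 + fps_X) ^ (n - 1)) $ n = (\<Sum>i\<le>n. W $ i * (if i = n then 1 else 0))"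
    by (simp add: fps_compose_mult_nth)
  then show ?thesis by (simp add: mult_delta_right)
qed

context dihedral_character begin

lemma F_outside: "f \<in> F n \<Longrightarrow> g \<notin> carrier G \<Longrightarrow> f g = 0"
  unfolding F_def by (induction rule: zspan.induct) auto

lemma F_le_carrier: "F n \<subseteq> carrier (virtual_character_ring G)"
  unfolding carrier_eq_F0 by (rule F_antimono) simp

lemma carrier_uminus: "x \<in> carrier (virtual_character_ring G) \<Longrightarrow> - x \<in> carrier (virtual_character_ring G)"
  unfolding carrier_virtual_character_ring by (rule zspan_uminus)

lemma add_pow_nat:
  "pow (add_monoid (virtual_character_ring G)) x (n::nat) = of_nat n * x"
  by (induction n) (auto simp: distrib_right add.commute)

lemma add_pow_int:
  assumes "x \<in> carrier (virtual_character_ring G)"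
  shows "add_pow (virtual_character_ring G) (k::int) x = of_int k * x"
proof -
  have "of_nat n * x \<in> carrier (virtual_character_ring G)" for n
    using assms unfolding carrier_virtual_character_ring by (rule zspan_of_nat_mult)
  then have inv: "m_inv (add_monoid (virtual_character_ring G)) (of_nat n * x) = - (of_nat n * x)" for n
    by (intro m_inv_add_monoid_eq_uminus carrier_uminus) simp_all
  show ?thesis
    unfolding add_pow_def int_pow_def2 add_pow_nat inv by simp
qed

lemma a_inv_eq: "x \<in> carrier (virtual_character_ring G) \<Longrightarrow> a_inv (virtual_character_ring G) x = - x"
  unfolding a_inv_def by (intro m_inv_add_monoid_eq_uminus carrier_uminus) simp_all

text \<open>This is \<open>chr k\<close> minus 2, written so that its class modulo weight 2 is
  visibly that of X.\<close>

definition Zk :: "nat \<Rightarrow> 'a \<Rightarrow> complex" where "Zk k = X - Yk k"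

text \<open>Positive indices are those for which \<open>rho k\<close> is a representation and
  supplies the exterior powers; index 0 would give X again.\<close>

definition I_gens :: "('a \<Rightarrow> complex) set" where "I_gens = insert X (Zk ` {0<..})"

lemma carrier_decomposition:
  assumes "f \<in> carrier (virtual_character_ring G)"
  shows "\<exists>k z. f = of_int k * one_fn + z \<and> z \<in> zspan I_gens"
  using assms unfolding carrier_eq_zspan_basis
proof induction
  case zspan_zero
  have "0 = of_int 0 * one_fn + 0 \<and> 0 \<in> zspan I_gens" by (simp add: zspan.zspan_zero)
  then show "\<exists>k z. 0 = of_int k * one_fn + z \<and> z \<in> zspan I_gens" by blast
next
  case (zspan_base s)
  have X: "X \<in> zspan I_gens" by (rule zspan.zspan_base) (simp add: I_gens_def)
  have eps: "eps = of_int 1 * one_fn + X" by (simp add: X_def)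
  have "\<exists>z. chr k = of_int 2 * one_fn + z \<and> z \<in> zspan I_gens" for k
  proof (cases "k > 0")
    case True
    have "chr k = of_int 2 * one_fn + Zk k" by (simp add: Zk_def Yk_def X_def)
    moreover have "Zk k \<in> zspan I_gens" using True by (intro zspan.zspan_base) (simp add: I_gens_def)
    ultimately show ?thesis by blast
  next
    case False
    then have "chr k = of_int 2 * one_fn + X" by (simp add: X_def chr_eq_one_plus_eps)
    then show ?thesis using X by blast
  qed
  moreover have "one_fn = of_int 1 * one_fn + 0" by simp
  ultimately show ?case
    using zspan_base X eps zspan.zspan_zero[of I_gens] unfolding basis_fns_def by blast
next
  case (zspan_diff x y)
  then obtain k z l w where "x = of_int k * one_fn + z" "z \<in> zspan I_gens"
    "y = of_int l * one_fn + w" "w \<in> zspan I_gens" by blast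
  then have "x - y = of_int (k - l) * one_fn + (z - w) \<and> z - w \<in> zspan I_gens"
    by (auto simp: left_diff_distrib intro: zspan.zspan_diff)
  then show ?case by blast
qed

lemma I_gens_at_one: "z \<in> zspan I_gens \<Longrightarrow> z \<one> = 0"
proof (induction rule: zspan.induct)
  case (zspan_base s)
  have "X \<one> = 0" using X_Y_values(1)[of 0] by simp
  moreover have "Yk k \<one> = 0" for k using X_Y_values(3)[of k 0] by simp
  ultimately show ?case using zspan_base by (auto simp: I_gens_def Zk_def)
qed auto

lemma of_int_fun_apply: "(of_int k :: 'a \<Rightarrow> complex) g = of_int k"
  by (cases k) (auto simp: minus_apply)

lemma one_fn_at_one [simp]: "one_fn \<one> = 1"
  by (simp add: one_fn_def unit_function_def)

lemma augmentation_eq: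
  assumes "z \<in> zspan I_gens"
  shows "augmentation G (of_int k * one_fn + z) = k"
  unfolding augmentation_def using I_gens_at_one[OF assms] by (simp add: of_int_fun_apply)

lemma I_gens_in_F: "zspan I_gens \<subseteq> F 1"
  unfolding F_def
proof (rule zspan_least)
  show "I_gens \<subseteq> zspan {X ^ i * Y ^ j * one_fn | i j. i + 2 * j \<ge> 1}"
    using X_F Yk_F F_antimono[of 1 2] F_diff[of X 1] unfolding F_def[symmetric] I_gens_def Zk_def by auto
qed

lemma augmentation_ideal_eq: "augmentation_ideal G = zspan I_gens"
proof (intro equalityI subsetI)
  fix f assume "f \<in> augmentation_ideal G"
  then have f: "f \<in> carrier (virtual_character_ring G)" "augmentation G f = 0"
    by (auto simp: augmentation_ideal_def)
  then obtain k z where kz: "f = of_int k * one_fn + z" "z \<in> zspan I_gens"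
    using carrier_decomposition by blast
  then show "f \<in> zspan I_gens" using f(2) augmentation_eq[OF kz(2)] by simp
next
  fix f assume f: "f \<in> zspan I_gens"
  then show "f \<in> augmentation_ideal G"
    using I_gens_in_F F_le_carrier[of 1] augmentation_eq[OF f, of 0] by (auto simp: augmentation_ideal_def)
qed

section \<open>Lambda series at a group element\<close>

abbreviation L :: "nat \<Rightarrow> ('a \<Rightarrow> complex) \<Rightarrow> 'a \<Rightarrow> complex" where "L \<equiv> lambda_op G"

lemma L_closed: "x \<in> carrier (virtual_character_ring G) \<Longrightarrow> L n x \<in> carrier (virtual_character_ring G)"
  and L_character: "complex_representation G d \<rho> \<Longrightarrow>
    L n (character G \<rho>) = character G (\<lambda>g. exterior_power_mat n (\<rho> g))"
  and L_0: "x \<in> carrier (virtual_character_ring G) \<Longrightarrow> L 0 x = one_fn"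
  using lambda_family unfolding is_lambda_family_def Let_def one_fn_def by auto

lemma L_add:
  assumes "x \<in> carrier (virtual_character_ring G)" "y \<in> carrier (virtual_character_ring G)"
  shows "L n (x + y) = (\<Sum>i\<le>n. L i x * L (n - i) y)"
proof -
  have "L n (x + y) = finsum (virtual_character_ring G) (\<lambda>i. L i x * L (n - i) y) {..n}"
    using lambda_family assms unfolding is_lambda_family_def Let_def by simp
  then show ?thesis
    by (subst (asm) finsum_virtual_character_ring) (auto intro!: carrier_mult_closed L_closed assms)
qed

text \<open>At a fixed g the operations form an ordinary complex power series: the addition law
  becomes multiplication, and differences become quotients.\<close>

definition Ls :: "('a \<Rightarrow> complex) \<Rightarrow> 'a \<Rightarrow> complex fps" where
  "Ls x g = Abs_fps (\<lambda>n. L n x g)"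

lemma Ls_add:
  assumes "x \<in> carrier (virtual_character_ring G)" "y \<in> carrier (virtual_character_ring G)"
  shows "Ls (x + y) g = Ls x g * Ls y g"
  by (rule fps_ext) (simp add: Ls_def fps_mult_nth atLeast0AtMost L_add[OF assms] sum_fun_apply)

lemma Ls_0: "x \<in> carrier (virtual_character_ring G) \<Longrightarrow> g \<in> carrier G \<Longrightarrow> Ls x g $ 0 = 1"
  by (simp add: Ls_def L_0 one_fn_def unit_function_def)

lemma Ls_neq_0: "x \<in> carrier (virtual_character_ring G) \<Longrightarrow> g \<in> carrier G \<Longrightarrow> Ls x g \<noteq> 0"
  using Ls_0 by fastforce

lemma Ls_one_fn: "g \<in> carrier G \<Longrightarrow> Ls one_fn g = 1 + fps_X"
  using L_character[OF rho_one_representation]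
  by (intro fps_ext) (auto simp: Ls_def character_rho_one exterior_power_rho_one one_fn_def unit_function_def fps_X_def)

lemma Ls_eps: "g \<in> carrier G \<Longrightarrow> Ls eps g = 1 + fps_const (eps g) * fps_X"
  using L_character[OF rho_eps_representation]
  by (intro fps_ext) (auto simp: Ls_def character_rho_eps exterior_power_rho_eps one_fn_def unit_function_def fps_X_def)

lemma Ls_chr: "k > 0 \<Longrightarrow> g \<in> carrier G \<Longrightarrow>
    Ls (chr k) g = 1 + fps_const (chr k g) * fps_X + fps_const (eps g) * fps_X ^ 2"
  using L_character[OF rho_representation[of k]]
  by (intro fps_ext) (auto simp: Ls_def character_rho exterior_power_rho one_fn_def unit_function_def fps_X_power_nth)

lemma Ls_of_nat: "g \<in> carrier G \<Longrightarrow> Ls (of_nat n * one_fn) g = (1 + fps_X) ^ n"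
proof (induction n)
  case 0
  have z: "0 \<in> carrier (virtual_character_ring G)" unfolding carrier_eq_F0 by (rule F_zero)
  \<comment> \<open>The series of 0 equals its own square and is non-zero, so it is 1.\<close>
  have "Ls (0 + 0) g = Ls 0 g * Ls 0 g" using z by (rule Ls_add) (rule z)
  then have "Ls 0 g = 1" using Ls_neq_0[OF z 0] by simp
  then show "Ls (of_nat 0 * one_fn) g = (1 + fps_X) ^ 0" by simp
next
  case (Suc n)
  have n: "of_nat n * one_fn \<in> carrier (virtual_character_ring G)"
    unfolding carrier_eq_F0 by (intro F_of_nat one_fn_F)
  have "Ls (of_nat (Suc n) * one_fn) g = Ls (one_fn + of_nat n * one_fn) g" by (simp add: distrib_right)
  also have "\<dots> = (1 + fps_X) ^ Suc n"
    by (simp only: Ls_add[OF basis_in_carrier(1) n] Ls_one_fn[OF Suc.prems] Suc.IH[OF Suc.prems] power_Suc)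
  finally show "Ls (of_nat (Suc n) * one_fn) g = (1 + fps_X) ^ Suc n" .
qed

text \<open>\<open>u_expansion x w\<close> says \<open>\<lambda>\<^sub>t(x) = \<Sum> w\<^sub>n (t / (1 + t))\<^sup>n\<close>.\<close>

definition u_expansion :: "('a \<Rightarrow> complex) \<Rightarrow> (nat \<Rightarrow> 'a \<Rightarrow> complex) \<Rightarrow> bool" where
  "u_expansion x w \<longleftrightarrow> x \<in> carrier (virtual_character_ring G) \<and> (\<forall>n. w n \<in> F n) \<and> w 0 = one_fn \<and>
     (\<forall>g\<in>carrier G. Ls x g = Abs_fps (\<lambda>n. w n g) oo fps_u)"

text \<open>For positive n, adding n - 1 multiplies the lambda series by (1 + t)^(n-1), and the t^n
  coefficient is then the n-th coefficient in powers of t / (1 + t).\<close>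

lemma gamma_op_eq:
  assumes "u_expansion x w"
  shows "gamma_op G n x = w n"
proof -
  have x: "x \<in> carrier (virtual_character_ring G)" using assms by (simp add: u_expansion_def)
  have g: "gamma_op G n x = L n (x + of_int (int n - 1) * one_fn)"
    by (simp add: gamma_op_def Let_def add_pow_int[OF basis_in_carrier(1)] one_fn_def[symmetric])
  show ?thesis
  proof (cases "n = 0")
    case True
    \<comment> \<open>For n = 0 the shift is by -1, and \<lambda>^0 = 1 gives the value
      directly.\<close>
    have "x + of_int (int n - 1) * one_fn \<in> carrier (virtual_character_ring G)"
      using x one_fn_F unfolding carrier_eq_F0 by (intro F_add F_of_int)
    then show ?thesis using assms True L_0 unfolding g u_expansion_def by metis
  next
    case False
    then have n: "of_int (int n - 1) = (of_nat (n - 1) :: 'a \<Rightarrow> complex)"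
      by (metis One_nat_def Suc_leI bot_nat_0.not_eq_extremum int_ops(2) of_int_of_nat_eq of_nat_diff)
    have c: "of_nat (n - 1) * one_fn \<in> carrier (virtual_character_ring G)"
      unfolding carrier_eq_F0 by (intro F_of_nat one_fn_F)
    show ?thesis
    proof
      fix h
      show "gamma_op G n x h = w n h"
      proof (cases "h \<in> carrier G")
        case True
        have "gamma_op G n x h = Ls (x + of_nat (n - 1) * one_fn) h $ n"
          by (simp only: g n Ls_def fps_nth_Abs_fps)
        also have "Ls x h = Abs_fps (\<lambda>n. w n h) oo fps_u"
          using assms True by (simp add: u_expansion_def)
        then have "Ls (x + of_nat (n - 1) * one_fn) h $ n = w n h"
          using \<open>n \<noteq> 0\<close>
          by (simp only: Ls_add[OF x c] Ls_of_nat[OF True] fps_compose_u_nth neq0_conv fps_nth_Abs_fps)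
        finally show ?thesis .
      next
        case False
        have "gamma_op G n x \<in> F 0" "w n \<in> F n"
          using L_closed[of "x + of_nat (n - 1) * one_fn" n] x c assms
          unfolding g n carrier_eq_F0 u_expansion_def by (auto intro: F_add)
        then show ?thesis using False F_outside by metis
      qed
    qed
  qed
qed

lemma fps_deg2_compose_u:
  fixes w :: "nat \<Rightarrow> complex"
  assumes "w 0 = 1" "\<And>n. n > 2 \<Longrightarrow> w n = 0"
  shows "Abs_fps w oo fps_u = 1 + fps_const (w 1) * fps_u + fps_const (w 2) * fps_u ^ 2"
proof -
  have "Abs_fps w = 1 + fps_const (w 1) * fps_X + fps_const (w 2) * fps_X ^ 2"
  proof (rule fps_ext)
    fix n :: nat
    consider "n = 0" | "n = 1" | "n = 2" | "n > 2" by linarith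
    then show "Abs_fps w $ n = (1 + fps_const (w 1) * fps_X + fps_const (w 2) * fps_X ^ 2) $ n"
      by cases (use assms in \<open>auto simp: fps_X_power_nth fps_X_nth\<close>)
  qed
  then show ?thesis
    by (simp add: fps_compose_add_distrib fps_compose_mult_distrib fps_compose_power[symmetric])
qed

text \<open>Writing u = t / (1 + t), the quotient (1 + \<epsilon> t) / (1 + t) equals 1 + X
  u.\<close>

lemma u_expansion_X: "u_expansion X (\<lambda>n. if n = 0 then one_fn else if n = 1 then X else 0)"
  unfolding u_expansion_def
proof (intro conjI ballI allI)
  show XR: "X \<in> carrier (virtual_character_ring G)" using X_F F_le_carrier by blast
  show "(if n = 0 then one_fn else if n = 1 then X else 0) \<in> F n" for n
    using one_fn_F X_F F_zero by simp
  fix g assume g: "g \<in> carrier G"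
  define c where "c = fps_const (X g)"
  have one: "one_fn g = 1" using g by (simp add: one_fn_def unit_function_def)
  have e: "fps_const (eps g) = 1 + c" by (simp add: c_def X_def one fps_const_add[symmetric])
  have "Ls X g * Ls one_fn g = Ls eps g"
    using Ls_add[OF XR basis_in_carrier(1), of g] by (simp add: X_def)
  then have "Ls X g * (1 + fps_X) = 1 + (1 + c) * fps_X"
    using g by (simp add: Ls_one_fn Ls_eps e)
  also have "\<dots> = (1 + fps_X) + c * (fps_u * (1 + fps_X))"
    by (simp only: fps_u_mult) (simp add: algebra_simps)
  also have "\<dots> = (1 + c * fps_u) * (1 + fps_X)" by (simp add: algebra_simps)
  finally have "Ls X g = 1 + c * fps_u" by simp
  then show "Ls X g = Abs_fps (\<lambda>n. (if n = 0 then one_fn else if n = 1 then X else 0) g) oo fps_u"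
    by (subst fps_deg2_compose_u) (auto simp: one c_def)
qed auto

text \<open>The quotient (1 + chr_k t + \<epsilon> t^2) / (1 + t)^2 equals 1 + Z_k u + Y_k u^2 for u
  = t / (1 + t). This is where Y_k appears as a value of \<gamma>^2.\<close>

lemma u_expansion_Zk:
  assumes k: "k > 0"
  shows "u_expansion (Zk k) (\<lambda>n. if n = 0 then one_fn else if n = 1 then Zk k else if n = 2 then Yk k else 0)"
  unfolding u_expansion_def
proof (intro conjI ballI allI)
  have ZF: "Zk k \<in> F 1" using X_F Yk_F F_antimono[of 1 2] unfolding Zk_def by (auto intro: F_diff)
  show ZR: "Zk k \<in> carrier (virtual_character_ring G)" using ZF F_le_carrier by blast
  show "(if n = 0 then one_fn else if n = 1 then Zk k else if n = 2 then Yk k else 0) \<in> F n" for n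
    using one_fn_F ZF Yk_F F_zero by simp
  fix g assume g: "g \<in> carrier G"
  define c where "c = fps_const (Zk k g)"
  define d where "d = fps_const (Yk k g)"
  have one: "one_fn g = 1" using g by (simp add: one_fn_def unit_function_def)
  have ch: "chr k g = 2 + Zk k g" by (simp add: Zk_def X_def Yk_def one)
  have ep: "eps g = 1 + Zk k g + Yk k g" by (simp add: Zk_def X_def one)
  have e: "fps_const (chr k g) = 2 + c" "fps_const (eps g) = 1 + c + d"
    unfolding ch ep c_def d_def by (simp_all add: numeral_fps_const)
  have "Ls (Zk k) g * (Ls one_fn g * Ls one_fn g) = Ls (chr k) g"
  proof -
    have 2: "one_fn + one_fn \<in> carrier (virtual_character_ring G)"
      using one_fn_F unfolding carrier_eq_F0 by (intro F_add)
    have "Zk k + (one_fn + one_fn) = chr k" by (simp add: Zk_def X_def Yk_def)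
    then show ?thesis
      using Ls_add[OF ZR 2, of g] Ls_add[OF basis_in_carrier(1) basis_in_carrier(1), of g] by simp
  qed
  then have "Ls (Zk k) g * ((1 + fps_X) * (1 + fps_X)) = 1 + (2 + c) * fps_X + (1 + c + d) * fps_X ^ 2"
    using g by (simp add: Ls_one_fn Ls_chr[OF k] e)
  also have "\<dots> = (1 + fps_X) * (1 + fps_X) + c * (fps_u * (1 + fps_X)) * (1 + fps_X) +
      d * (fps_u * (1 + fps_X)) * (fps_u * (1 + fps_X))"
    by (simp only: fps_u_mult) (simp add: algebra_simps power2_eq_square)
  also have "\<dots> = (1 + c * fps_u + d * fps_u ^ 2) * ((1 + fps_X) * (1 + fps_X))"
    by (simp add: algebra_simps power2_eq_square)
  finally have "Ls (Zk k) g = 1 + c * fps_u + d * fps_u ^ 2" by simp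
  then show "Ls (Zk k) g = Abs_fps (\<lambda>n. (if n = 0 then one_fn else if n = 1 then Zk k else if n = 2 then Yk k else 0) g) oo fps_u"
    by (subst fps_deg2_compose_u) (auto simp: one c_def d_def)
qed auto

text \<open>Differences give quotients of series. As \<open>v 0\<close> is the unit, each
  coefficient of the quotient is \<open>w n\<close> minus products of weights i and n - i, so the
  weights persist. No formula for the coefficients is asked for.\<close>

lemma u_expansion_diff:
  assumes x: "u_expansion x w" and y: "u_expansion y v"
  shows "\<exists>t. u_expansion (x - y) t"
proof -
  note xD = x[unfolded u_expansion_def] and yD = y[unfolded u_expansion_def]
  define A where "A = (\<lambda>g. Abs_fps (\<lambda>n. w n g))"
  define B where "B = (\<lambda>g. Abs_fps (\<lambda>n. v n g))"
  \<comment> \<open>Pointwise division yields only a sequence of functions; that \<open>t n\<close>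
    is a virtual character of weight n comes from the recursion \<open>rec\<close>.\<close>
  define t where "t = (\<lambda>n g. if g \<in> carrier G then (A g * inverse (B g)) $ n else 0)"
  have one: "one_fn g = 1" if "g \<in> carrier G" for g using that by (simp add: one_fn_def unit_function_def)
  have B0: "B g $ 0 = 1" if "g \<in> carrier G" for g using yD one[OF that] by (simp add: B_def)
  have rec: "w n = (\<Sum>i<n. t i * v (n - i)) + t n" for n
  proof
    fix g
    show "w n g = ((\<Sum>i<n. t i * v (n - i)) + t n) g"
    proof (cases "g \<in> carrier G")
      case True
      have "A g = (A g * inverse (B g)) * B g"
        using inverse_mult_eq_1[of "B g"] B0[OF True] by (simp add: mult.assoc)
      then have "w n g = ((A g * inverse (B g)) * B g) $ n" by (metis A_def fps_nth_Abs_fps)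
      also have "\<dots> = (\<Sum>i\<le>n. t i g * v (n - i) g)"
        unfolding fps_mult_nth[of "A g * inverse (B g)" "B g"] atLeast0AtMost
        using True by (intro sum.cong refl) (simp add: t_def, simp add: B_def)
      also have "\<dots> = (\<Sum>i<n. t i g * v (n - i) g) + t n g"
        using yD one[OF True] by (simp add: lessThan_Suc_atMost[symmetric])
      finally show ?thesis by (simp add: sum_fun_apply)
    next
      case False
      then show ?thesis using F_outside xD by (simp add: sum_fun_apply t_def) blast
    qed
  qed
  have tF: "t n \<in> F n" for n
  proof (induction n rule: less_induct)
    case (less n)
    have eq: "w n - (\<Sum>i<n. t i * v (n - i)) = t n" by (subst rec[of n]) (rule add_diff_cancel_left')
    have "t i * v (n - i) \<in> F n" if "i < n" for i
      using F_mult[OF less[OF that], of "v (n - i)" "n - i"] yD that by simp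
    then have "(\<Sum>i<n. t i * v (n - i)) \<in> F n" by (intro F_sum) simp
    moreover have "w n \<in> F n" using xD by blast
    ultimately show "t n \<in> F n" using F_diff unfolding eq[symmetric] by blast
  qed
  have "t 0 = w 0" using rec[of 0] by simp
  moreover have xy: "x - y \<in> carrier (virtual_character_ring G)"
    using xD yD unfolding carrier_eq_F0 by (intro F_diff) auto
  moreover have "Ls (x - y) g = Abs_fps (\<lambda>n. t n g) oo fps_u" if g: "g \<in> carrier G" for g
  proof -
    have "Ls (x - y) g * Ls y g = Ls x g" using Ls_add[OF xy, of y g] yD by simp
    moreover have "Ls x g = A g oo fps_u" "Ls y g = B g oo fps_u" using xD yD g by (auto simp: A_def B_def)
    moreover have "A g = Abs_fps (\<lambda>n. t n g) * B g"
    proof -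
      have "Abs_fps (\<lambda>n. t n g) = A g * inverse (B g)" using g by (intro fps_ext) (simp add: t_def)
      then show ?thesis using inverse_mult_eq_1[of "B g"] B0[OF g] by (simp add: mult.assoc)
    qed
    ultimately have "Ls (x - y) g * Ls y g = (Abs_fps (\<lambda>n. t n g) oo fps_u) * Ls y g"
      by (simp add: fps_compose_mult_distrib)
    then show ?thesis using Ls_neq_0[of y g] yD g by simp
  qed
  ultimately show ?thesis using xD tF unfolding u_expansion_def by metis
qed

lemma ex_u_expansion: "x \<in> zspan I_gens \<Longrightarrow> \<exists>w. u_expansion x w"
proof (induction rule: zspan.induct)
  case zspan_zero
  from u_expansion_diff[OF u_expansion_X u_expansion_X]
  show "\<exists>w. u_expansion 0 w" by simp
next
  case (zspan_base s)
  then show ?case using u_expansion_X u_expansion_Zk by (auto simp: I_gens_def)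
next
  case (zspan_diff x y)
  then show "\<exists>w. u_expansion (x - y) w" using u_expansion_diff by blast
qed

section \<open>The gamma filtration is the weight filtration\<close>

lemma gamma_op_in_F: "x \<in> augmentation_ideal G \<Longrightarrow> gamma_op G n x \<in> F n"
  using ex_u_expansion[of x] gamma_op_eq unfolding augmentation_ideal_eq u_expansion_def by metis

lemma gamma_product_Cons: "gamma_product G ((i, x) # ps) = gamma_op G i x * gamma_product G ps"
  and gamma_product_Nil: "gamma_product G [] = one_fn"
  by (simp_all add: gamma_product_def Let_def one_fn_def)

lemma gamma_product_in_F:
  "\<forall>(i, x)\<in>set ps. x \<in> augmentation_ideal G \<Longrightarrow> gamma_product G ps \<in> F (sum_list (map fst ps))"
proof (induction ps)
  case Nil
  show "gamma_product G [] \<in> F (sum_list (map fst []))" by (simp add: gamma_product_Nil one_fn_F)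
next
  case (Cons q ps)
  obtain i x where q: "q = (i, x)" by (cases q)
  then show "gamma_product G (q # ps) \<in> F (sum_list (map fst (q # ps)))"
    using Cons F_mult[OF gamma_op_in_F[of x i]] by (simp add: gamma_product_Cons)
qed

lemma gamma_X: "gamma_op G 1 X = X"
  and gamma_Zk_1: "k > 0 \<Longrightarrow> gamma_op G 1 (Zk k) = Zk k"
  and gamma_Zk_2: "k > 0 \<Longrightarrow> gamma_op G 2 (Zk k) = Yk k"
  using gamma_op_eq[OF u_expansion_X, of 1] gamma_op_eq[OF u_expansion_Zk[of k], of 1]
    gamma_op_eq[OF u_expansion_Zk[of k], of 2] by simp_all

text \<open>One inclusion is multiplicativity of the weights. For the other, every monomial X^i Y^j
  is itself a gamma product, with i factors \<gamma>^1(X) and j factors \<gamma>^2(Z_1).\<close>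

lemma gamma_filtration_eq: "gamma_filtration G n = F n"
proof -
  define S where "S = {gamma_product G ps | ps.
        (\<forall>(i, x)\<in>set ps. x \<in> augmentation_ideal G) \<and> sum_list (map fst ps) \<ge> n}"
  have SF: "S \<subseteq> F n" unfolding S_def using gamma_product_in_F F_antimono by blast
  have "gamma_filtration G n = zspan S"
    unfolding gamma_filtration_def S_def[symmetric]
    using SF F_le_carrier[of n] by (intro generate_add_monoid_eq_zspan carrier_uminus) auto
  moreover have "zspan S \<subseteq> F n" using SF unfolding F_def by (rule zspan_least)
  moreover have "F n \<subseteq> zspan S"
  proof -
    have "X ^ i * Y ^ j * one_fn \<in> S" if ij: "i + 2 * j \<ge> n" for i j
    proof -
      have I: "X \<in> augmentation_ideal G" "Zk 1 \<in> augmentation_ideal G"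
        unfolding augmentation_ideal_eq by (auto simp: I_gens_def intro!: zspan_base)
      have g2: "gamma_op G 2 (Zk 1) = Y" using gamma_Zk_2[of 1] by (simp add: Y_def)
      have Yj: "gamma_product G (replicate j (2, Zk 1)) = Y ^ j * one_fn"
      proof (induction j)
        case (Suc j)
        show "gamma_product G (replicate (Suc j) (2, Zk 1)) = Y ^ Suc j * one_fn"
          by (simp only: replicate_Suc gamma_product_Cons g2 Suc.IH power_Suc mult.assoc)
      next
        case 0
        show "gamma_product G (replicate 0 (2, Zk 1)) = Y ^ 0 * one_fn" by (simp add: gamma_product_Nil)
      qed
      have "gamma_product G (replicate i (1, X) @ replicate j (2, Zk 1)) = X ^ i * (Y ^ j * one_fn)"
      proof (induction i)
        case (Suc i)
        show "gamma_product G (replicate (Suc i) (1, X) @ replicate j (2, Zk 1)) = X ^ Suc i * (Y ^ j * one_fn)"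
          by (simp only: replicate_Suc append_Cons gamma_product_Cons gamma_X Suc.IH power_Suc mult.assoc)
      next
        case 0
        show "gamma_product G (replicate 0 (1, X) @ replicate j (2, Zk 1)) = X ^ 0 * (Y ^ j * one_fn)"
          using Yj by simp
      qed
      then have "X ^ i * Y ^ j * one_fn = gamma_product G (replicate i (1, X) @ replicate j (2, Zk 1))"
        by (simp add: mult.assoc)
      moreover have "sum_list (map fst (replicate i (1, X) @ replicate j (2 :: nat, Zk 1))) \<ge> n"
        using ij by (simp add: sum_list_replicate)
      ultimately show ?thesis unfolding S_def using I by (intro CollectI exI conjI) auto
    qed
    then show ?thesis unfolding F_def by (intro zspan_least subsetI zspan_base) blast
  qed
  ultimately show ?thesis by blast
qed

end

section \<open>Evaluation of polynomials\<close>

definition eval_poly_hom :: "('b::comm_ring_1 \<Rightarrow> 'c::comm_ring_1) \<Rightarrow> 'c \<Rightarrow> 'b poly \<Rightarrow> 'c" where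
  "eval_poly_hom f a q = poly (map_poly f q) a"

text \<open>Evaluation is again a coefficient homomorphism, so the locale can be applied twice, once
  for each variable of the iterated polynomial ring.\<close>

locale coefficient_hom =
  fixes f :: "'b::comm_ring_1 \<Rightarrow> 'c::comm_ring_1"
  assumes zero: "f 0 = 0" and one: "f 1 = 1"
    and add: "f (x + y) = f x + f y" and mult: "f (x * y) = f x * f y"
begin

lemma eval_0 [simp]: "eval_poly_hom f a 0 = 0"
  by (simp add: eval_poly_hom_def)

lemma eval_pCons [simp]: "eval_poly_hom f a (pCons c q) = f c + a * eval_poly_hom f a q"
  by (cases "c = 0 \<and> q = 0") (auto simp: eval_poly_hom_def map_poly_pCons zero)

lemma eval_add: "eval_poly_hom f a (q + r) = eval_poly_hom f a q + eval_poly_hom f a r"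
  by (induction q r rule: poly_induct2) (simp_all add: add algebra_simps)

lemma eval_smult: "eval_poly_hom f a (Polynomial.smult c q) = f c * eval_poly_hom f a q"
  by (induction q) (simp_all add: mult algebra_simps)

lemma eval_mult: "eval_poly_hom f a (q * r) = eval_poly_hom f a q * eval_poly_hom f a r"
  by (induction q) (simp_all add: eval_add eval_smult zero algebra_simps)

lemma coefficient_hom_eval: "coefficient_hom (eval_poly_hom f a)"
proof
  show "eval_poly_hom f a 1 = 1" by (simp add: one_pCons one)
qed (simp_all add: eval_add eval_mult)

end

lemma coefficient_hom_of_int: "coefficient_hom (\<lambda>c. [:of_int c:] :: 'b::comm_ring_1 poly)"
  by standard (simp_all add: one_pCons)

section \<open>Normal forms in two variables\<close>

lemma var_mult_pCons: "var_X * [:q:] = [:pCons 0 q:]" "var_Y * P = pCons 0 P"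
  by (simp_all add: var_X_def var_Y_def)

lemma int_poly_poly_induct:
  assumes const: "\<And>c. Q [:[:c:]:]" and X: "Q var_X" and Y: "Q var_Y"
    and add: "\<And>p q. Q p \<Longrightarrow> Q q \<Longrightarrow> Q (p + q)" and mult: "\<And>p q. Q p \<Longrightarrow> Q q \<Longrightarrow> Q (p * q)"
  shows "Q P"
proof -
  have inner: "Q [:q:]" for q
  proof (induction q)
    case 0
    then show ?case using const[of 0] by simp
  next
    case (pCons c q)
    have "[:pCons c q:] = [:[:c:]:] + var_X * [:q:]" by (simp only: var_mult_pCons) simp
    then show ?case using add[OF const mult[OF X pCons.IH]] by simp
  qed
  show ?thesis
  proof (induction P)
    case 0
    then show ?case using const[of 0] by simp
  next
    case (pCons q P)
    have "pCons q P = [:q:] + var_Y * P" by (simp only: var_mult_pCons) simp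
    then show ?case using add[OF inner mult[OF Y pCons.IH]] by simp
  qed
qed

definition in_Y :: "int poly \<Rightarrow> int poly poly" where
  "in_Y b = map_poly (\<lambda>c. [:c:]) b"

lemma in_Y_pCons: "in_Y (pCons c b) = [:[:c:]:] + var_Y * in_Y b"
  by (cases "c = 0 \<and> b = 0") (auto simp: in_Y_def var_mult_pCons map_poly_pCons)

lemma in_Y_0 [simp]: "in_Y 0 = 0" by (simp add: in_Y_def)

lemma in_Y_smult: "in_Y (Polynomial.smult c b) = [:[:c:]:] * in_Y b"
  by (induction b) (simp_all add: in_Y_pCons algebra_simps)

text \<open>Modulo xy only a constant and pure powers of x and of y remain. These are later tested
  at the identity, at \<tau> and on the rotations.\<close>

lemma ZXY_normal_form:
  "\<exists>c a b T. P = [:[:c:]:] + var_X * [:a:] + var_Y * in_Y b + var_X * var_Y * T"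
proof (induction P)
  case 0
  show ?case by (intro exI[of _ 0]) simp
next
  case (pCons q P)
  obtain c a b T where P: "P = [:[:c:]:] + var_X * [:a:] + var_Y * in_Y b + var_X * var_Y * T"
    using pCons.IH by blast
  obtain c' a' where q: "q = pCons c' a'" by (cases q)
  have "pCons q P = [:[:c':]:] + var_X * [:a':] + var_Y * P"
    by (simp only: q var_mult_pCons) simp
  also have "\<dots> = [:[:c':]:] + var_X * [:a':] + var_Y * in_Y (pCons c b) + var_X * var_Y * ([:a:] + var_Y * T)"
    unfolding P in_Y_pCons by (simp only: distrib_left distrib_right mult_ac add_ac)
  finally show ?case by blast
qed

context dihedral_character begin

section \<open>Weighted homogeneous components of an evaluation\<close>

definition theta_X :: "int poly \<Rightarrow> ('a \<Rightarrow> complex) poly" where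
  "theta_X = eval_poly_hom (\<lambda>c. [:of_int c:]) [:0, X:]"

text \<open>\<open>theta\<close> sends \<open>x\<close> to \<open>X t\<close> and \<open>y\<close> to \<open>Y t\<^sup>2\<close>, so that the coefficient of \<open>t\<^sup>n\<close> is the
  value of the weighted homogeneous component of degree \<open>n\<close>.\<close>

definition theta :: "int poly poly \<Rightarrow> ('a \<Rightarrow> complex) poly" where
  "theta = eval_poly_hom theta_X [:0, 0, Y:]"

sublocale X_hom: coefficient_hom theta_X
  unfolding theta_X_def by (rule coefficient_hom.coefficient_hom_eval[OF coefficient_hom_of_int])

sublocale theta_hom: coefficient_hom theta
  unfolding theta_def by (rule X_hom.coefficient_hom_eval)

lemma theta_X_pCons: "theta_X (pCons c q) = [:of_int c:] + [:0, X:] * theta_X q"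
  unfolding theta_X_def by (rule coefficient_hom.eval_pCons[OF coefficient_hom_of_int])

lemma theta_pCons: "theta (pCons q P) = theta_X q + [:0, 0, Y:] * theta P"
  unfolding theta_def by (rule X_hom.eval_pCons)

lemma theta_const: "theta [:[:c:]:] = [:of_int c:]"
  by (simp add: theta_pCons theta_X_pCons X_hom.zero theta_hom.zero)

lemma theta_var_X: "theta var_X = [:0, X:]"
  by (simp add: var_X_def theta_pCons theta_X_pCons X_hom.zero theta_hom.zero)

lemma theta_var_Y: "theta var_Y = [:0, 0, Y:]"
  by (simp add: var_Y_def theta_pCons theta_X_pCons X_hom.zero X_hom.one theta_hom.zero)

lemma coeff_theta_X: "coeff (theta_X q) n = of_int (coeff q n) * X ^ n"
proof (induction q arbitrary: n)
  case 0
  show "coeff (theta_X 0) n = of_int (coeff 0 n) * X ^ n" by (simp add: X_hom.zero)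
next
  case (pCons c q)
  have IH: "coeff (theta_X q) m = of_int (coeff q m) * X ^ m" for m by (rule pCons.IH)
  show "coeff (theta_X (pCons c q)) n = of_int (coeff (pCons c q) n) * X ^ n"
    by (cases n) (simp_all add: theta_X_pCons IH mult_ac)
qed

lemma coeff_theta_in_Y:
  "coeff (theta (in_Y b)) n = (if even n then of_int (coeff b (n div 2)) * Y ^ (n div 2) else 0)"
proof (induction b arbitrary: n)
  case 0
  show "coeff (theta (in_Y 0)) n = (if even n then of_int (coeff 0 (n div 2)) * Y ^ (n div 2) else 0)"
    by (simp add: theta_hom.zero)
next
  case (pCons c b)
  have eq: "theta (in_Y (pCons c b)) = [:of_int c:] + [:0, 0, Y:] * theta (in_Y b)"
    by (simp only: in_Y_pCons theta_hom.add theta_hom.mult theta_const theta_var_Y)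
  have IH: "coeff (theta (in_Y b)) m = (if even m then of_int (coeff b (m div 2)) * Y ^ (m div 2) else 0)" for m
    by (rule pCons.IH)
  consider "n = 0" | "n = 1" | m where "n = Suc (Suc m)" by (metis One_nat_def not0_implies_Suc)
  then show "coeff (theta (in_Y (pCons c b))) n =
    (if even n then of_int (coeff (pCons c b) (n div 2)) * Y ^ (n div 2) else 0)"
    by cases (simp_all add: eq IH mult_ac)
qed

text \<open>The factor \<open>one_fn\<close> cuts type-class constants down to the carrier, so that
  the values are virtual characters.\<close>

definition phi :: "nat \<Rightarrow> int poly poly \<Rightarrow> 'a \<Rightarrow> complex" where
  "phi n P = coeff (theta P) n * one_fn"

lemma phi_add: "phi n (P + Q) = phi n P + phi n Q"
  by (simp add: phi_def theta_hom.add distrib_right)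

lemma phi_0: "phi n 0 = 0"
  by (simp add: phi_def theta_hom.zero)

lemma phi_sum: "phi n (\<Sum>i\<in>I. f i) = (\<Sum>i\<in>I. phi n (f i))"
  by (induction I rule: infinite_finite_induct) (auto simp: phi_add phi_0)

lemma phi_mult: "phi n (P * Q) = (\<Sum>i\<le>n. phi i P * phi (n - i) Q)"
proof -
  have "a * one_fn * (b * one_fn) = a * b * one_fn" for a b
  proof -
    have "a * one_fn * (b * one_fn) = a * b * (one_fn * one_fn)" by (simp only: mult_ac)
    then show ?thesis by simp
  qed
  then show ?thesis
    by (simp add: phi_def theta_hom.mult coeff_mult sum_distrib_right)
qed

lemma phi_const: "phi n [:[:c:]:] = (if n = 0 then of_int c * one_fn else 0)"
  by (simp add: phi_def theta_const coeff_pCons split: nat.split)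

lemma phi_one: "phi n 1 = (if n = 0 then one_fn else 0)"
  by (simp add: phi_def theta_hom.one)

lemma phi_var_X: "phi n var_X = (if n = 1 then X else 0)"
  by (simp add: phi_def theta_var_X coeff_pCons split: nat.split)

lemma phi_var_Y: "phi n var_Y = (if n = 2 then Y else 0)"
  by (auto simp: phi_def theta_var_Y coeff_pCons numeral_2_eq_2 split: nat.split)

lemma phi_in_F: "phi n P \<in> F n"
proof (induction P arbitrary: n rule: int_poly_poly_induct)
  case (1 c)
  show "phi n [:[:c:]:] \<in> F n" using one_fn_F F_of_int F_zero by (simp add: phi_const)
next
  case 2
  show "phi n var_X \<in> F n" using X_F F_zero by (simp add: phi_var_X)
next
  case 3
  have "Y \<in> F 2" using Yk_F by (simp add: Y_def)
  then show "phi n var_Y \<in> F n" using F_zero by (simp add: phi_var_Y)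
next
  case (4 p q)
  then show "phi n (p + q) \<in> F n" by (simp add: phi_add F_add)
next
  case (5 p q)
  have "phi i p * phi (n - i) q \<in> F n" if "i \<le> n" for i
    using F_mult[OF 5(1)[of i] 5(2)[of "n - i"]] that by simp
  then show "phi n (p * q) \<in> F n" unfolding phi_mult by (intro F_sum) simp
qed

lemma phi_eventually_0: "finite {n. phi n P \<noteq> 0}"
proof (rule finite_subset)
  show "{n. phi n P \<noteq> 0} \<subseteq> {..degree (theta P)}"
    using coeff_eq_0[of "theta P"] by (force simp: phi_def not_le)
qed simp

text \<open>Control of the degrees other than n is included so that polynomials found degree by
  degree can be added without interference.\<close>

lemma phi_surj:
  assumes "f \<in> F n"
  shows "\<exists>P. phi n P - f \<in> F (Suc n) \<and> (\<forall>m. m \<noteq> n \<longrightarrow> phi m P \<in> F (Suc m))"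
  using assms unfolding F_def[of n]
proof induction
  case zspan_zero
  show "\<exists>P. phi n P - 0 \<in> F (Suc n) \<and> (\<forall>m. m \<noteq> n \<longrightarrow> phi m P \<in> F (Suc m))"
    by (intro exI[of _ 0]) (simp add: phi_0 F_zero)
next
  case (zspan_base s)
  then obtain i j where s: "s = X ^ i * Y ^ j * one_fn" "i + 2 * j \<ge> n" by auto
  show "\<exists>P. phi n P - s \<in> F (Suc n) \<and> (\<forall>m. m \<noteq> n \<longrightarrow> phi m P \<in> F (Suc m))"
  proof (cases "i + 2 * j = n")
    case True
    have "theta (var_X ^ i) = monom (X ^ i) i" for i
    proof (induction i)
      case 0
      show "theta (var_X ^ 0) = monom (X ^ 0) 0" using theta_hom.one by (simp add: monom_0 flip: one_pCons)
    next
      case (Suc i)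
      have IH: "theta (var_X ^ i) = monom (X ^ i) i" by (rule Suc.IH)
      show "theta (var_X ^ Suc i) = monom (X ^ Suc i) (Suc i)"
        by (simp add: theta_hom.mult theta_var_X IH monom_Suc smult_monom)
    qed
    moreover have "theta (var_Y ^ j) = monom (Y ^ j) (2 * j)" for j
    proof (induction j)
      case 0
      show "theta (var_Y ^ 0) = monom (Y ^ 0) (2 * 0)" using theta_hom.one by (simp add: monom_0 flip: one_pCons)
    next
      case (Suc j)
      have IH: "theta (var_Y ^ j) = monom (Y ^ j) (2 * j)" by (rule Suc.IH)
      show "theta (var_Y ^ Suc j) = monom (Y ^ Suc j) (2 * Suc j)"
        by (simp add: theta_hom.mult theta_var_Y IH monom_Suc smult_monom)
    qed
    ultimately have "theta (var_X ^ i * var_Y ^ j) = monom (X ^ i * Y ^ j) n"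
      by (simp add: theta_hom.mult mult_monom True)
    then have "phi m (var_X ^ i * var_Y ^ j) = (if m = n then s else 0)" for m
      by (simp add: phi_def s(1))
    then show ?thesis by (intro exI[of _ "var_X ^ i * var_Y ^ j"]) (simp add: F_zero)
  next
    case False
    then have "s \<in> F (Suc n)" using s F_monomial[of "Suc n" i j] by simp
    then show ?thesis by (intro exI[of _ 0]) (simp add: phi_0 F_zero F_uminus)
  qed
next
  case (zspan_diff x y)
  then obtain P Q where P: "phi n P - x \<in> F (Suc n)" "\<And>m. m \<noteq> n \<Longrightarrow> phi m P \<in> F (Suc m)"
    and Q: "phi n Q - y \<in> F (Suc n)" "\<And>m. m \<noteq> n \<Longrightarrow> phi m Q \<in> F (Suc m)" by blast
  have d: "phi m (P - Q) = phi m P - phi m Q" for m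
    using phi_add[of m "P - Q" Q] by simp
  have "phi n P - phi n Q - (x - y) = (phi n P - x) - (phi n Q - y)" by (simp add: algebra_simps)
  then have "phi n (P - Q) - (x - y) \<in> F (Suc n)" using F_diff[OF P(1) Q(1)] by (simp only: d)
  moreover have "phi m (P - Q) \<in> F (Suc m)" if "m \<noteq> n" for m
    using F_diff[OF P(2)[OF that] Q(2)[OF that]] by (simp only: d)
  ultimately show "\<exists>P. phi n P - (x - y) \<in> F (Suc n) \<and> (\<forall>m. m \<noteq> n \<longrightarrow> phi m P \<in> F (Suc m))"
    by blast
qed

text \<open>The shift by one comes from the extracted factors: coefficient n of \<open>a\<close>
  belongs to x^(n+1), and coefficient r of \<open>b\<close> to y^(r+1), of degree 2 r + 2, which
  meets degree n + 1 only for odd n.\<close>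

lemma phi_normal_form:
  "phi 0 ([:[:c:]:] + var_X * [:a:] + var_Y * in_Y b + var_X * var_Y * T) = of_int c * one_fn"
  "phi (Suc n) ([:[:c:]:] + var_X * [:a:] + var_Y * in_Y b + var_X * var_Y * T) =
    of_int (coeff a n) * X ^ Suc n +
    (if odd n then of_int (coeff b (n div 2)) * Y ^ Suc (n div 2) else 0)"
proof -
  have XY: "[:0, X:] * [:0, 0, Y:] = 0" by simp
  have th: "theta ([:[:c:]:] + var_X * [:a:] + var_Y * in_Y b + var_X * var_Y * T) =
    [:of_int c:] + [:0, X:] * theta_X a + [:0, 0, Y:] * theta (in_Y b)"
  proof -
    have "theta [:a:] = theta_X a" by (simp add: theta_pCons theta_hom.zero)
    then show ?thesis
      by (simp only: theta_hom.add theta_hom.mult theta_const theta_var_X theta_var_Y XY mult_zero_left add_0_right)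
  qed
  show "phi 0 ([:[:c:]:] + var_X * [:a:] + var_Y * in_Y b + var_X * var_Y * T) = of_int c * one_fn"
    unfolding phi_def th by simp
  have X1: "X ^ Suc n * one_fn = X ^ Suc n" by (simp only: power_Suc2 mult.assoc X_Y_mult)
  have Y1: "Y ^ Suc k * one_fn = Y ^ Suc k" for k by (simp only: power_Suc2 mult.assoc X_Y_mult)
  have "coeff ([:of_int c:] + [:0, X:] * theta_X a + [:0, 0, Y:] * theta (in_Y b)) (Suc n) =
    of_int (coeff a n) * X ^ Suc n +
    (if odd n then of_int (coeff b (n div 2)) * Y ^ Suc (n div 2) else 0)"
  proof (cases n)
    case 0
    then show ?thesis by (simp add: coeff_theta_X mult_ac)
  next
    case (Suc m)
    have "odd n \<Longrightarrow> m div 2 = n div 2" using Suc by presburger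
    then show ?thesis using Suc by (auto simp: coeff_theta_X coeff_theta_in_Y mult_ac)
  qed
  then show "phi (Suc n) ([:[:c:]:] + var_X * [:a:] + var_Y * in_Y b + var_X * var_Y * T) =
    of_int (coeff a n) * X ^ Suc n +
    (if odd n then of_int (coeff b (n div 2)) * Y ^ Suc (n div 2) else 0)"
    unfolding phi_def th by (simp only: distrib_right mult.assoc X1 Y1 if_distrib[of "\<lambda>x. x * one_fn"] mult_zero_left)
qed

text \<open>The kernel of the graded evaluation in terms of representatives, so that the ideal can
  be computed without cosets.\<close>

definition ker_phi :: "int poly poly set" where
  "ker_phi = {P. \<forall>n. phi n P \<in> F (Suc n)}"

section \<open>The ideal of relations\<close>

lemma ker_phi_ideal: "ideal ker_phi ZXY"
proof (rule idealI)
  show "ring ZXY" by (rule class_ring.ring_axioms)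
  have neg: "- P \<in> ker_phi" if "P \<in> ker_phi" for P
  proof -
    have "phi n (- P) = - phi n P" for n
      using phi_add[of n "- P" P] by (simp add: phi_0 eq_neg_iff_add_eq_0)
    then show ?thesis using that F_uminus by (simp add: ker_phi_def)
  qed
  have inv: "m_inv (add_monoid ZXY) P = - P" for P
    by (rule m_inv_add_monoid_eq_uminus) auto
  show "subgroup ker_phi (add_monoid ZXY)"
    by standard (use neg in \<open>auto simp: inv[simplified] ker_phi_def phi_add phi_0 F_add F_zero\<close>)
  have mult: "Q * P \<in> ker_phi" if P: "P \<in> ker_phi" for P Q
    unfolding ker_phi_def
  proof (intro CollectI allI)
    fix n
    have "phi i Q * phi (n - i) P \<in> F (Suc n)" if "i \<le> n" for i
      using F_mult[OF phi_in_F[of i Q], of "phi (n - i) P" "Suc (n - i)"] P that by (simp add: ker_phi_def)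
    then show "phi n (Q * P) \<in> F (Suc n)" unfolding phi_mult by (intro F_sum) simp
  qed
  show "Q \<otimes>\<^bsub>ZXY\<^esub> P \<in> ker_phi" if "P \<in> ker_phi" "Q \<in> carrier ZXY" for P Q using mult that by simp
  show "P \<otimes>\<^bsub>ZXY\<^esub> Q \<in> ker_phi" if "P \<in> ker_phi" "Q \<in> carrier ZXY" for P Q
    using mult[OF that(1), of Q] by (simp add: mult.commute)
qed

text \<open>2 X = - X^2 has weight 2, p Y lies in the span of Y^2 and higher powers and so has
  weight 4, and X Y is zero outright.\<close>

lemma relations_in_ker_phi: "{2 * var_X, of_nat p * var_Y, var_X * var_Y} \<subseteq> ker_phi"
proof -
  have "phi n (2 * var_X) \<in> F (Suc n)" for n
  proof -
    have "phi n (2 * var_X) = phi n var_X + phi n var_X" by (simp only: mult_2 phi_add)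
    then have eq: "phi n (2 * var_X) = (if n = 1 then - (X * X) else 0)"
      by (simp add: phi_var_X)
    have "- (X * X) \<in> F (1 + 1)" by (rule F_uminus[OF F_mult[OF X_F X_F]])
    then show ?thesis unfolding eq using F_zero by (cases "n = 1") (simp_all del: X_Y_mult)
  qed
  moreover have "phi n (of_nat p * var_Y) \<in> F (Suc n)" for n
  proof -
    have eq: "phi n (of_nat p * var_Y) = (if n = 2 then of_nat p * Y else 0)"
    proof -
      have "phi n (of_nat k * var_Y) = (if n = 2 then of_nat k * Y else 0)" for k
        by (induction k) (simp_all add: distrib_right phi_add phi_var_Y phi_0)
      then show ?thesis .
    qed
    have "of_nat p * Y \<in> F 3" using p_Y_in_Ypows Ypows_F[of 2] F_antimono[of 3 4] by auto
    then show ?thesis using F_zero by (simp add: eq numeral_3_eq_3 numeral_2_eq_2)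
  qed
  moreover have "phi n (var_X * var_Y) = 0" for n
    by (simp add: phi_def theta_hom.mult theta_var_X theta_var_Y coeff_pCons split: nat.split)
  ultimately show ?thesis using F_zero by (auto simp: ker_phi_def)
qed

lemma ker_phi_minimal:
  assumes J: "ideal J ZXY" and rel: "{2 * var_X, of_nat p * var_Y, var_X * var_Y} \<subseteq> J"
    and P: "P \<in> ker_phi"
  shows "P \<in> J"
proof -
  have Jm: "Q * S \<in> J" if "S \<in> J" for Q S using ideal.I_l_closed[OF J that, of Q] by simp
  have Ja: "Q + S \<in> J" if "Q \<in> J" "S \<in> J" for Q S
    using additive_subgroup.a_closed[OF ideal.axioms(1)[OF J] that] by simp
  obtain c a b T where Peq: "P = [:[:c:]:] + var_X * [:a:] + var_Y * in_Y b + var_X * var_Y * T"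
    using ZXY_normal_form by blast
  have ker: "phi n P \<in> F (Suc n)" for n using P by (simp add: ker_phi_def)
  have "of_int c * one_fn \<in> F 1" using ker[of 0] phi_normal_form(1)[of c a b T] by (simp add: Peq)
  then have "(of_int c * one_fn) \<one> = 0" by (rule F1_at_one)
  then have c: "c = 0" by (simp add: of_int_fun_apply)
  have val: "X \<tau> = -2" "Y \<tau> = 0"
    using X_Y_values(2)[of 0] X_Y_values(6)[of 0] by auto
  \<comment> \<open>Evaluation at \<tau> removes the power of Y that may share the degree of
    X^(n+1).\<close>
  have "even (coeff a n)" for n
  proof (rule even_X_coefficient)
    show "phi (Suc n) P \<in> F (Suc (Suc n))" by (rule ker)
    show "phi (Suc n) P \<tau> = of_int (coeff a n) * (-2) ^ Suc n"
      unfolding Peq phi_normal_form(2) by (simp add: val power_fun_apply of_int_fun_apply)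
  qed
  then have "[:2:] dvd a" by (simp add: const_poly_dvd_iff)
  then obtain a' where a: "a = [:2:] * a'" by (rule dvdE)
  \<comment> \<open>In degree 2 r + 2 the power of X vanishes on rotations, which isolates the
    coefficient of Y^(r+1).\<close>
  have "int p dvd coeff b r" for r
  proof (rule p_dvd_Y_coefficient)
    show "phi (Suc (2 * r + 1)) P \<in> F (Suc (2 * Suc r))" using ker[of "Suc (2 * r + 1)"] by simp
    show "phi (Suc (2 * r + 1)) P (\<sigma> [^] j) = of_int (coeff b r) * Y (\<sigma> [^] j) ^ Suc r" for j :: nat
      unfolding Peq phi_normal_form(2) by (simp add: power_fun_apply of_int_fun_apply)
  qed
  then have "[:int p:] dvd b" by (simp add: const_poly_dvd_iff)
  then obtain b' where b: "b = [:int p:] * b'" by (rule dvdE)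
  have "var_X * [:a:] = [:a':] * (2 * var_X)"
    by (simp add: a var_X_def numeral_poly)
  moreover have "var_Y * in_Y b = in_Y b' * (of_nat p * var_Y)"
    using in_Y_smult[of "int p" b'] by (simp add: b of_nat_poly mult_ac)
  ultimately have eq: "P = [:a':] * (2 * var_X) + in_Y b' * (of_nat p * var_Y) + T * (var_X * var_Y)"
    by (simp add: Peq c mult.commute[of T])
  have rel': "2 * var_X \<in> J" "of_nat p * var_Y \<in> J" "var_X * var_Y \<in> J" using rel by auto
  show ?thesis
    unfolding eq by (rule Ja[OF Ja[OF Jm[OF rel'(1)] Jm[OF rel'(2)]] Jm[OF rel'(3)]])
qed

lemma Idl_relations: "Idl\<^bsub>ZXY\<^esub> {2 * var_X, of_nat p * var_Y, var_X * var_Y} = ker_phi"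
  unfolding genideal_def
proof (intro equalityI)
  show "\<Inter> {J. ideal J ZXY \<and> {2 * var_X, of_nat p * var_Y, var_X * var_Y} \<subseteq> J} \<subseteq> ker_phi"
    using ker_phi_ideal relations_in_ker_phi by blast
  show "ker_phi \<subseteq> \<Inter> {J. ideal J ZXY \<and> {2 * var_X, of_nat p * var_Y, var_X * var_Y} \<subseteq> J}"
    using ker_phi_minimal by blast
qed

end

section \<open>The graded character ring\<close>

context dihedral_character begin

definition coset :: "nat \<Rightarrow> ('a \<Rightarrow> complex) \<Rightarrow> ('a \<Rightarrow> complex) set" where
  "coset n f = F (Suc n) +>\<^bsub>virtual_character_ring G\<^esub> f"

lemma coset_altdef: "coset n f = (\<lambda>h. h + f) ` F (Suc n)"
  by (auto simp: coset_def a_r_coset_def')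

lemma coset_eq_iff: "coset n f = coset n g \<longleftrightarrow> f - g \<in> F (Suc n)"
proof
  assume "coset n f = coset n g"
  moreover have "0 + f \<in> coset n f" unfolding coset_altdef by (rule imageI) (rule F_zero)
  ultimately obtain h where "h \<in> F (Suc n)" "f = h + g" by (auto simp: coset_altdef)
  then show "f - g \<in> F (Suc n)" by simp
next
  have sub: "coset n f \<subseteq> coset n g" if "f - g \<in> F (Suc n)" for f g
  proof
    fix x assume "x \<in> coset n f"
    then obtain h where "h \<in> F (Suc n)" "x = h + f" by (auto simp: coset_altdef)
    then have "x = (h + (f - g)) + g" "h + (f - g) \<in> F (Suc n)" using that by (auto intro: F_add)
    then show "x \<in> coset n g" unfolding coset_altdef by blast
  qed
  assume fg: "f - g \<in> F (Suc n)"
  then have "g - f \<in> F (Suc n)" using F_uminus[OF fg] by simp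
  then show "coset n f = coset n g" using sub fg by blast
qed

lemma coset_0: "coset n 0 = F (Suc n)"
  by (simp add: coset_altdef)

lemma carrier_graded_piece: "carrier (graded_piece G n) = coset n ` F n"
    and one_graded_piece: "\<one>\<^bsub>graded_piece G n\<^esub> = coset n 0"
  by (auto simp: graded_piece_def FactGroup_def RCOSETS_def coset_def a_r_coset_def r_coset_def
      gamma_filtration_eq coset_0[unfolded coset_def a_r_coset_def r_coset_def])

lemma mult_graded_piece: "coset n f \<otimes>\<^bsub>graded_piece G n\<^esub> coset n g = coset n (f + g)"
proof -
  have "coset n f \<otimes>\<^bsub>graded_piece G n\<^esub> coset n g = {a + b | a b. a \<in> coset n f \<and> b \<in> coset n g}"
    by (auto simp: graded_piece_def FactGroup_def set_mult_def)
  also have "\<dots> = coset n (f + g)"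
  proof (intro equalityI subsetI)
    fix x assume "x \<in> {a + b | a b. a \<in> coset n f \<and> b \<in> coset n g}"
    then obtain h k where "h \<in> F (Suc n)" "k \<in> F (Suc n)" "x = (h + f) + (k + g)"
      by (auto simp: coset_altdef)
    then have "x = (h + k) + (f + g)" "h + k \<in> F (Suc n)" by (auto intro: F_add simp: add_ac)
    then show "x \<in> coset n (f + g)" unfolding coset_altdef by blast
  next
    fix x assume "x \<in> coset n (f + g)"
    then obtain h where h: "h \<in> F (Suc n)" "x = h + (f + g)" by (auto simp: coset_altdef)
    then have "x = (h + f) + (0 + g)" by (simp add: add_ac)
    moreover have "h + f \<in> coset n f" "0 + g \<in> coset n g"
      unfolding coset_altdef using h F_zero by blast+
    ultimately show "x \<in> {a + b | a b. a \<in> coset n f \<and> b \<in> coset n g}" by blast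
  qed
  finally show ?thesis .
qed

lemma comm_group_graded_piece: "comm_group (graded_piece G n)"
proof (rule comm_groupI)
  fix u assume "u \<in> carrier (graded_piece G n)"
  then obtain f where "f \<in> F n" "u = coset n f" by (auto simp: carrier_graded_piece)
  then show "\<exists>v\<in>carrier (graded_piece G n). v \<otimes>\<^bsub>graded_piece G n\<^esub> u = \<one>\<^bsub>graded_piece G n\<^esub>"
    by (intro bexI[of _ "coset n (- f)"])
      (auto simp: carrier_graded_piece one_graded_piece mult_graded_piece intro: F_uminus)
qed (auto simp: carrier_graded_piece one_graded_piece mult_graded_piece F_zero add_ac intro: F_add)

lemma finprod_graded_piece:
  assumes "finite J" and "\<And>i. i \<in> J \<Longrightarrow> f i \<in> F n"
  shows "finprod (graded_piece G n) (\<lambda>i. coset n (f i)) J = coset n (\<Sum>i\<in>J. f i)"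
proof -
  interpret comm_group "graded_piece G n" by (rule comm_group_graded_piece)
  show ?thesis
    using assms
  proof (induction J)
    case (insert i J)
    have IH: "finprod (graded_piece G n) (\<lambda>i. coset n (f i)) J = coset n (\<Sum>i\<in>J. f i)"
      using insert by blast
    have "finprod (graded_piece G n) (\<lambda>i. coset n (f i)) (insert i J) =
      coset n (f i) \<otimes>\<^bsub>graded_piece G n\<^esub> finprod (graded_piece G n) (\<lambda>i. coset n (f i)) J"
      using insert by (intro finprod_insert) (auto simp: carrier_graded_piece)
    also have "\<dots> = coset n (\<Sum>i\<in>insert i J. f i)"
      unfolding IH mult_graded_piece sum.insert[OF insert.hyps] ..
    finally show "finprod (graded_piece G n) (\<lambda>i. coset n (f i)) (insert i J) = coset n (\<Sum>i\<in>insert i J. f i)" .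
  qed (simp add: one_graded_piece)
qed

text \<open>Changing representatives alters f g by h k + h g + f k, and each summand has weight at
  least n + 1.\<close>

lemma rcoset_mult_coset:
  assumes "i \<le> n" and f: "f \<in> F i" and g: "g \<in> F (n - i)"
  shows "rcoset_mult (virtual_character_ring G) (F (Suc n)) (coset i f) (coset (n - i) g) = coset n (f * g)"
proof -
  have eq: "coset n (a * b) = coset n (f * g)" if a: "a \<in> coset i f" and b: "b \<in> coset (n - i) g" for a b
  proof -
    obtain h k where hk: "h \<in> F (Suc i)" "a = h + f" "k \<in> F (Suc (n - i))" "b = k + g"
      using a b by (auto simp: coset_altdef)
    have "h * k \<in> F (Suc n)"
      using F_mult[OF hk(1,3)] F_antimono[of "Suc n" "Suc i + Suc (n - i)"] \<open>i \<le> n\<close> by auto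
    moreover have "h * g \<in> F (Suc n)" using F_mult[OF hk(1) g] \<open>i \<le> n\<close> by simp
    moreover have "f * k \<in> F (Suc n)" using F_mult[OF f hk(3)] \<open>i \<le> n\<close> by simp
    ultimately have "h * k + h * g + f * k \<in> F (Suc n)" by (intro F_add)
    moreover have "a * b - f * g = h * k + h * g + f * k" by (simp add: hk algebra_simps)
    ultimately show ?thesis unfolding coset_eq_iff by simp
  qed
  \<comment> \<open>\<open>rcoset_mult\<close> is a union over representatives; it collapses to the
    common coset because the index sets are non-empty.\<close>
  have ne: "coset i f \<noteq> {}" "coset (n - i) g \<noteq> {}" using F_zero by (auto simp: coset_altdef)
  have "rcoset_mult (virtual_character_ring G) (F (Suc n)) (coset i f) (coset (n - i) g) =
    (\<Union>a\<in>coset i f. \<Union>b\<in>coset (n - i) g. coset n (a * b))"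
    by (simp add: rcoset_mult_def coset_def)
  also have "\<dots> = (\<Union>a\<in>coset i f. \<Union>b\<in>coset (n - i) g. coset n (f * g))" using eq by simp
  finally show ?thesis using ne by simp
qed

lemma graded_ring_simps:
  "carrier (graded_character_ring G) =
    {u. (\<forall>n. u n \<in> coset n ` F n) \<and> finite {n. u n \<noteq> coset n 0}}"
  "\<zero>\<^bsub>graded_character_ring G\<^esub> = (\<lambda>n. coset n 0)"
  "\<one>\<^bsub>graded_character_ring G\<^esub> = (\<lambda>n. coset n 0)(0 := coset 0 one_fn)"
  "u \<oplus>\<^bsub>graded_character_ring G\<^esub> v = (\<lambda>n. u n \<otimes>\<^bsub>graded_piece G n\<^esub> v n)"
  "u \<otimes>\<^bsub>graded_character_ring G\<^esub> v = (\<lambda>n. finprod (graded_piece G n)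
    (\<lambda>i. rcoset_mult (virtual_character_ring G) (F (Suc n)) (u i) (v (n - i))) {..n})"
proof -
  have grp: "group (graded_piece G i)" for i
    using comm_group_graded_piece[of i] by (simp add: comm_group_def)
  show "carrier (graded_character_ring G) =
    {u. (\<forall>n. u n \<in> coset n ` F n) \<and> finite {n. u n \<noteq> coset n 0}}"
    by (auto simp: graded_character_ring_def Let_def carrier_sum_group[OF grp] carrier_graded_piece one_graded_piece)
qed (simp_all add: graded_character_ring_def Let_def one_graded_piece gamma_filtration_eq one_fn_def
    coset_def[of 0, symmetric] restrict_UNIV)

section \<open>The homomorphism from the polynomial ring\<close>

definition graded_eval :: "int poly poly \<Rightarrow> nat \<Rightarrow> ('a \<Rightarrow> complex) set" where
  "graded_eval P = (\<lambda>n. coset n (phi n P))"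

lemma graded_eval_ring_hom: "graded_eval \<in> Ring.ring_hom ZXY (graded_character_ring G)"
proof (rule ring_hom_memI)
  fix P Q :: "int poly poly"
  have "finite {n. coset n (phi n P) \<noteq> coset n 0}"
    by (rule finite_subset[OF _ phi_eventually_0[of P]]) auto
  then show "graded_eval P \<in> carrier (graded_character_ring G)"
    using phi_in_F by (auto simp: graded_ring_simps graded_eval_def)
  show "graded_eval (P \<oplus>\<^bsub>ZXY\<^esub> Q) = graded_eval P \<oplus>\<^bsub>graded_character_ring G\<^esub> graded_eval Q"
    by (simp add: graded_ring_simps graded_eval_def mult_graded_piece phi_add)
  show "graded_eval (P \<otimes>\<^bsub>ZXY\<^esub> Q) = graded_eval P \<otimes>\<^bsub>graded_character_ring G\<^esub> graded_eval Q"
  proof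
    fix n
    have PQ: "phi i P * phi (n - i) Q \<in> F n" if "i \<le> n" for i
      using F_mult[OF phi_in_F[of i P] phi_in_F[of "n - i" Q]] that by simp
    have "finprod (graded_piece G n)
        (\<lambda>i. rcoset_mult (virtual_character_ring G) (F (Suc n)) (coset i (phi i P)) (coset (n - i) (phi (n - i) Q))) {..n} =
      finprod (graded_piece G n) (\<lambda>i. coset n (phi i P * phi (n - i) Q)) {..n}"
    proof (rule comm_monoid.finprod_cong'[OF _ refl])
      show "comm_monoid (graded_piece G n)" using comm_group_graded_piece by (simp add: comm_group_def)
    qed (use phi_in_F PQ in \<open>auto simp: rcoset_mult_coset carrier_graded_piece\<close>)
    also have "\<dots> = coset n (\<Sum>i\<le>n. phi i P * phi (n - i) Q)"
      using PQ by (intro finprod_graded_piece) auto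
    finally show "graded_eval (P \<otimes>\<^bsub>ZXY\<^esub> Q) n = (graded_eval P \<otimes>\<^bsub>graded_character_ring G\<^esub> graded_eval Q) n"
      by (simp add: graded_ring_simps graded_eval_def phi_mult)
  qed
next
  show "graded_eval \<one>\<^bsub>ZXY\<^esub> = \<one>\<^bsub>graded_character_ring G\<^esub>"
    by (rule ext) (auto simp: graded_ring_simps graded_eval_def phi_one)
qed

lemma chern_class_chi:
  "chern_class G n (character G \<chi>) = (\<lambda>m. coset m 0)(n := coset n (gamma_op G n (Zk 1)))"
proof -
  have Z: "Zk 1 \<in> zspan I_gens" by (rule zspan_base) (simp add: I_gens_def)
  have chr: "chr 1 = of_int 2 * one_fn + Zk 1" by (simp add: Zk_def Yk_def X_def)
  have aug: "augmentation G (chr 1) = 2" unfolding chr by (rule augmentation_eq[OF Z])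
  have two: "of_int 2 * one_fn \<in> carrier (virtual_character_ring G)"
    unfolding carrier_eq_F0 by (intro F_of_int one_fn_F)
  have "character G \<chi> \<ominus>\<^bsub>virtual_character_ring G\<^esub>
      add_pow (virtual_character_ring G) (augmentation G (character G \<chi>)) \<one>\<^bsub>virtual_character_ring G\<^esub> =
    chr 1 - of_int 2 * one_fn"
    unfolding character_chi aug a_minus_def
    using add_pow_int[OF basis_in_carrier(1), of 2] a_inv_eq[OF two] by (simp add: one_fn_def)
  also have "\<dots> = Zk 1" unfolding chr by (rule add_diff_cancel_left')
  finally show ?thesis
    unfolding chern_class_def Let_def by (simp add: graded_ring_simps gamma_filtration_eq coset_def)
qed

text \<open>The first Chern class is represented by X - Y, which differs from X by an element of
  weight 2.\<close>

lemma graded_eval_var_X: "graded_eval var_X = chern_class G 1 (character G \<chi>)"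
proof
  fix n
  have "X - Zk 1 = Yk 1" by (simp add: Zk_def)
  then have "coset 1 X = coset 1 (Zk 1)" using Yk_F unfolding coset_eq_iff by (simp add: numeral_2_eq_2)
  then show "graded_eval var_X n = chern_class G 1 (character G \<chi>) n"
    unfolding chern_class_chi by (simp add: graded_eval_def phi_var_X gamma_Zk_1[OF zero_less_Suc, simplified])
qed

lemma graded_eval_var_Y: "graded_eval var_Y = chern_class G 2 (character G \<chi>)"
proof
  fix n
  have "gamma_op G 2 (Zk 1) = Y" using gamma_Zk_2[of 1] by (simp add: Y_def)
  then show "graded_eval var_Y n = chern_class G 2 (character G \<chi>) n"
    unfolding chern_class_chi by (simp add: graded_eval_def phi_var_Y)
qed

text \<open>Lift each of the finitely many non-zero components separately and add: a lift for degree
  n contributes only zero cosets in the other degrees.\<close>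

lemma graded_eval_surj: "carrier (graded_character_ring G) \<subseteq> range graded_eval"
proof
  fix u assume "u \<in> carrier (graded_character_ring G)"
  then have u: "\<And>n. u n \<in> coset n ` F n" and fin: "finite {n. u n \<noteq> coset n 0}"
    by (auto simp: graded_ring_simps)
  define N where "N = {n. u n \<noteq> coset n 0}"
  have "\<forall>n. \<exists>P. u n = coset n (phi n P) \<and> (\<forall>m. m \<noteq> n \<longrightarrow> phi m P \<in> F (Suc m))"
  proof
    fix n
    obtain f where "f \<in> F n" "u n = coset n f" using u by blast
    then show "\<exists>P. u n = coset n (phi n P) \<and> (\<forall>m. m \<noteq> n \<longrightarrow> phi m P \<in> F (Suc m))"
      using phi_surj[of f n] by (metis coset_eq_iff)
  qed
  then obtain P where P: "\<And>n. u n = coset n (phi n (P n))" "\<And>n m. m \<noteq> n \<Longrightarrow> phi m (P n) \<in> F (Suc m)"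
    by metis
  have "graded_eval (\<Sum>n\<in>N. P n) m = u m" for m
  proof (cases "m \<in> N")
    case True
    have "(\<Sum>n\<in>N. phi m (P n)) - phi m (P m) = (\<Sum>n\<in>N - {m}. phi m (P n))"
      using True fin by (simp add: N_def sum.remove)
    also have "\<dots> \<in> F (Suc m)" by (intro F_sum P(2)) auto
    finally show ?thesis by (simp add: graded_eval_def phi_sum P(1)[of m] coset_eq_iff)
  next
    case False
    have "(\<Sum>n\<in>N. phi m (P n)) \<in> F (Suc m)" by (intro F_sum P(2)) (use False in auto)
    moreover have "u m = coset m 0" using False by (simp add: N_def)
    ultimately show ?thesis by (simp add: graded_eval_def phi_sum coset_eq_iff)
  qed
  then show "u \<in> range graded_eval" by (metis ext rangeI)
qed

lemma graded_eval_kernel: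
  "a_kernel ZXY (graded_character_ring G) graded_eval =
    Idl\<^bsub>ZXY\<^esub> {2 * var_X, of_nat p * var_Y, var_X * var_Y}"
  unfolding Idl_relations
  by (simp add: a_kernel_def' graded_ring_simps graded_eval_def fun_eq_iff coset_eq_iff ker_phi_def)

end

theorem proposition4p4:
  fixes D :: "('a, 'b) monoid_scheme" and p :: nat and \<tau> \<sigma> :: 'a
    and \<chi>\<^sub>1 :: "'a \<Rightarrow> complex mat"
  assumes "prime p" and "odd p"
    and "is_dihedral_group D p \<tau> \<sigma>"
    and "complex_representation D 2 \<chi>\<^sub>1"
    and "\<And>j::nat. \<chi>\<^sub>1 (\<sigma> [^]\<^bsub>D\<^esub> j) = mat_of_rows_list 2
           [[exp (2 * of_real pi * \<i> * of_nat j / of_nat p), 0],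
            [0, exp (- (2 * of_real pi * \<i> * of_nat j / of_nat p))]]"
    and "\<chi>\<^sub>1 \<tau> = mat_of_rows_list 2 [[0, 1], [1, 0]]"
  defines "x \<equiv> chern_class D 1 (character D \<chi>\<^sub>1)"
    and "y \<equiv> chern_class D 2 (character D \<chi>\<^sub>1)"
  shows "\<exists>h. h \<in> Ring.ring_hom ZXY (graded_character_ring D) \<and> h var_X = x \<and> h var_Y = y \<and>
           h ` carrier ZXY = carrier (graded_character_ring D) \<and>
           a_kernel ZXY (graded_character_ring D) h =
             Idl\<^bsub>ZXY\<^esub> {2 * var_X, of_nat p * var_Y, var_X * var_Y}"
proof -
  have D: "group D" "\<tau> \<in> carrier D" "\<sigma> \<in> carrier D" "generate D {\<tau>, \<sigma>} = carrier D"
    "\<tau> [^]\<^bsub>D\<^esub> (2::nat) = \<one>\<^bsub>D\<^esub>" "\<sigma> [^]\<^bsub>D\<^esub> p = \<one>\<^bsub>D\<^esub>"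
    "\<tau> \<otimes>\<^bsub>D\<^esub> \<sigma> \<otimes>\<^bsub>D\<^esub> \<tau> = inv\<^bsub>D\<^esub> \<sigma>"
    using assms(3) by (auto simp: is_dihedral_group_def)
  interpret group D by (rule D(1))
  have "\<tau> \<otimes>\<^bsub>D\<^esub> \<tau> = \<one>\<^bsub>D\<^esub>" using D(2,5) by (simp add: numeral_2_eq_2)
  then interpret dihedral_character D p \<tau> \<sigma> \<chi>\<^sub>1
    by unfold_locales (use assms(1,2,4-6) D in auto)
  have "graded_eval ` carrier ZXY = carrier (graded_character_ring D)"
    using graded_eval_surj ring_hom_closed[OF graded_eval_ring_hom] by auto
  then show ?thesis
    using graded_eval_ring_hom graded_eval_var_X graded_eval_var_Y graded_eval_kernel
    unfolding x_def y_def by blast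
qed

end
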